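(* Let $\psi:\mathcal{M}\to\mathbb{U}$ be a multiplicative function such that $\mathbb{D}(\psi,\chi\xi e_\theta;\infty)<\infty$, where $\chi$ is a primitive Dirichlet character of conductor $Q\in\mathcal{M}$, $\xi$ is a short interval character of length $l$, and $\theta\in[0,1]$. Then as $n\to\infty$, $$\frac{1}{|\mathcal{M}_n|}\sum_{f\in\mathcal{M}_n}\psi(f)\overline{\psi(f+1)}=\frac{\mu(Q)}{|Q|}\prod_{P\nmid Q}\left(2\Big(1-\frac1{|P|}\Big)\Big(\sum_{m=0}^\infty\frac{\Re\big((\psi\overline{\chi}\,\overline{\xi}e_{-\theta})(P^m)\big)}{|P|^m}\Big)-1\right)+o(1).$$
   Context: $\mathbb{F}_q$ is a fixed finite field of odd cardinality $q$. $\mathcal{M}$ is the set of monic polynomials in $\mathbb{F}_q[x]$, $\mathcal{M}_n$ those of degree $n$, $\mathcal{P}$ the set of monic irreducible polynomials; $P$ denotes an element of $\mathcal{P}$. $|f|=q^{\deg f}$, $\mathbb{U}=\{z\in\mathbb{C}:|z|\le1\}$, $\mu$ is the Möbius function on $\mathcal{M}$, and $e_\theta(f)=e^{2\pi i\theta\deg f}$. A function $\psi$ on $\mathcal{M}$ is multiplicative if $\psi(1)=1$ and $\psi(fg)=\psi(f)\psi(g)$ whenever $(f,g)=1$. Short interval character of length $l$: a completely multiplicative function $\xi:\mathcal{M}\to\{z:|z|=1\}$ such that $\xi(f)=\xi(g)$ whenever the leading $l+1$ coefficients of $f$ and $g$ coincide (the coefficients of $x^{\deg f},x^{\deg f-1},\dots,x^{\deg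 f-l}$, respectively for $g$, coefficients at negative exponents being $0$). For $\psi_1,\psi_2:\mathcal{M}\to\mathbb{U}$, $\mathbb{D}(\psi_1,\psi_2;\infty)=\Big(\sum_{P\in\mathcal{P}}\frac{1-\Re(\psi_1(P)\overline{\psi_2(P)})}{q^{\deg P}}\Big)^{1/2}$. *)

theory Defs
  imports
    "HOL-Analysis.Analysis"
    "HOL-Computational_Algebra.Computational_Algebra"
    "HOL-Number_Theory.Cong"
begin

text \<open>
  Functions on the monic polynomials are represented by functions on the whole type of polynomials
  of which only the values at monic arguments are constrained and used.
\<close>

definition monics :: "'a::{field,finite} poly set" where
  "monics = {f. lead_coeff f = 1}"

definition monics_deg :: "nat \<Rightarrow> 'a::{field,finite} poly set" where
  "monics_deg n = {f \<in> monics. degree f = n}"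

definition monic_irreds :: "'a::{field,finite} poly set" where
  "monic_irreds = {P \<in> monics. irreducible P}"

definition pnorm :: "'a::{field,finite} poly \<Rightarrow> real" where
  "pnorm f = real CARD('a) ^ degree f"

definition pmoebius :: "'a::{field,finite} poly \<Rightarrow> real" where
  "pmoebius f = (if squarefree f then (- 1) ^ card {P \<in> monic_irreds. P dvd f} else 0)"

definition e_twist :: "real \<Rightarrow> 'a::{field,finite} poly \<Rightarrow> complex" where
  "e_twist \<theta> f = cis (2 * pi * \<theta> * real (degree f))"

definition multiplicative :: "('a::{field,finite} poly \<Rightarrow> complex) \<Rightarrow> bool" where
  "multiplicative \<psi> \<longleftrightarrow> \<psi> 1 = 1 \<and>
     (\<forall>f\<in>monics. \<forall>g\<in>monics. coprime f g \<longrightarrow> \<psi> (f * g) = \<psi> f * \<psi> g)"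

definition completely_multiplicative :: "('a::{field,finite} poly \<Rightarrow> complex) \<Rightarrow> bool" where
  "completely_multiplicative \<psi> \<longleftrightarrow> \<psi> 1 = 1 \<and>
     (\<forall>f\<in>monics. \<forall>g\<in>monics. \<psi> (f * g) = \<psi> f * \<psi> g)"

text \<open>
  The coefficient of \<open>x\<close> to the power \<open>degree f - i\<close>, which is \<open>0\<close> when that exponent is negative
  (subtraction on \<^typ>\<open>nat\<close> alone would give the constant coefficient).
\<close>

definition top_coeff :: "'a::{field,finite} poly \<Rightarrow> nat \<Rightarrow> 'a" where
  "top_coeff f i = (if i \<le> degree f then coeff f (degree f - i) else 0)"

definition short_interval_character :: "nat \<Rightarrow> ('a::{field,finite} poly \<Rightarrow> complex) \<Rightarrow> bool" where
  "short_interval_character l \<xi> \<longleftrightarrow>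
     completely_multiplicative \<xi> \<and> (\<forall>f\<in>monics. norm (\<xi> f) = 1) \<and>
     (\<forall>f\<in>monics. \<forall>g\<in>monics. (\<forall>i\<le>l. top_coeff f i = top_coeff g i) \<longrightarrow> \<xi> f = \<xi> g)"

text \<open>
  A homomorphism from the unit group of the residue ring modulo \<open>Q\<close> to the nonzero complex numbers,
  viewed as a function on all polynomials that vanishes at the non-coprime ones.
\<close>

definition dirichlet_character :: "'a::{field,finite} poly \<Rightarrow> ('a poly \<Rightarrow> complex) \<Rightarrow> bool" where
  "dirichlet_character Q chi \<longleftrightarrow>
     (\<forall>f. chi f \<noteq> 0 \<longleftrightarrow> coprime f Q) \<and>
     (\<forall>f g. chi (f * g) = chi f * chi g) \<and>
     (\<forall>f g. [f = g] (mod Q) \<longrightarrow> chi f = chi g)"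

text \<open>Primitive of conductor \<open>Q\<close>: not induced by a character modulo a proper divisor of \<open>Q\<close>.\<close>

definition primitive_character :: "'a::{field,finite} poly \<Rightarrow> ('a poly \<Rightarrow> complex) \<Rightarrow> bool" where
  "primitive_character Q chi \<longleftrightarrow> dirichlet_character Q chi \<and>
     \<not> (\<exists>D\<in>monics. D dvd Q \<and> D \<noteq> Q \<and>
          (\<exists>chi'. dirichlet_character D chi' \<and> (\<forall>f. coprime f Q \<longrightarrow> chi f = chi' f)))"

text \<open>
  For functions bounded by 1 all terms are nonnegative, so the series diverges to \<open>\<infinity>\<close> unless it is
  summable. The case distinction is needed because \<^const>\<open>infsum\<close> is \<open>0\<close> on non-summable families.
\<close>

definition pretentious_dist ::
    "('a::{field,finite} poly \<Rightarrow> complex) \<Rightarrow> ('a poly \<Rightarrow> complex) \<Rightarrow> ereal" where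
  "pretentious_dist \<psi>1 \<psi>2 =
     (let t = (\<lambda>P. (1 - Re (\<psi>1 P * cnj (\<psi>2 P))) / pnorm P)
      in if t summable_on monic_irreds then ereal (sqrt (\<Sum>\<^sub>\<infinity>P\<in>monic_irreds. t P)) else \<infinity>)"

text \<open>
  Unconditional infinite product over an index set, in analogy with \<^const>\<open>has_sum\<close>. Vanishing
  factors and the value \<open>0\<close> are allowed.
\<close>

definition has_unordered_prod :: "('b \<Rightarrow> real) \<Rightarrow> 'b set \<Rightarrow> real \<Rightarrow> bool" where
  "has_unordered_prod F A p \<longleftrightarrow> ((\<lambda>X. \<Prod>x\<in>X. F x) \<longlongrightarrow> p) (finite_subsets_at_top A)"

definition local_factor :: "('a::{field,finite} poly \<Rightarrow> complex) \<Rightarrow> 'a poly \<Rightarrow> real" where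
  "local_factor \<phi> P = 2 * (1 - 1 / pnorm P) * (\<Sum>m. Re (\<phi> (P ^ m)) / pnorm P ^ m) - 1"

end

theory Submission
  imports Defs
begin

text \<open>
  Twisting \<open>\<psi>\<close> by the inverse of \<open>\<xi> e\<^sub>\<theta>\<close> changes no correlation of large degree, since \<open>f\<close> and \<open>f + 1\<close>
  have the same degree and the same leading coefficients. So let \<open>\<psi>\<close> be close to \<open>\<chi>\<close>, and split
  \<open>f = f\<^sub>s f\<^sub>r\<close> into the parts composed of primes of degree at most \<open>y\<close> and larger than \<open>y\<close>.

  The values of \<open>\<psi> \<chi>\<^sup>-\<^sup>1\<close> at \<open>f\<^sub>r\<close> concentrate at one complex number \<open>c\<close> with \<open>|c|\<close> close to 1: the product over
  the primes dividing \<open>f\<^sub>r\<close> is approximated by the exponential of an additive function, whose variance is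
  computed exactly on the primes of degree at most \<open>n / 2\<close>; a polynomial of degree \<open>n\<close> has at most one
  prime factor of larger degree. As \<open>f + 1\<close> has the same distribution as \<open>f\<close>, the constants \<open>c\<close> and \<open>cnj c\<close> cancel.

  What remains depends on the valuations of \<open>f (f + 1)\<close> at finitely many primes and on residues modulo \<open>Q\<close>. Each
  prime not dividing \<open>Q\<close> contributes its local factor. At the primes dividing \<open>Q\<close>, the terms with
  \<open>P\<close> dividing \<open>f (f + 1)\<close> cancel: as \<open>\<chi>\<close> is primitive, there is a unit \<open>u\<close> with \<open>\<chi> u \<noteq> 1\<close> for which \<open>f \<mapsto> u f\<close>
  (or \<open>f + 1 \<mapsto> u (f + 1)\<close>) fixes the other factor. The sum of \<open>\<chi> t cnj (\<chi> (t + 1))\<close> modulo \<open>Q\<close> is \<open>\<mu> Q\<close>.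
\<close>

subsection \<open>Coprimality and irreducible factors\<close>

text \<open>The order of limits shapes the proof. For fixed \<open>y\<close> the average over the
  small primes converges as \<open>n\<close> grows, while the error caused by the primes of degree
  above \<open>y\<close> is bounded uniformly in \<open>n\<close> by tails of two convergent sums;
  only then does \<open>y\<close> grow. The number \<open>c\<close> depends on \<open>n\<close> and
  need not converge: a finite distance controls the real parts of \<open>\<Phi> P - 1\<close>, but
  not the sum of the imaginary parts. So only |c|^2 may enter the result. The shape of the local
  factor, twice a real part minus 1, has its origin in the fact that a prime divides at most one of
  \<open>f\<close> and \<open>f + 1\<close>: if A and B are the local values, one of them is 1 and A
  cnj(B) = A + cnj(B) - 1. At the primes of \<open>Q\<close> the function \<open>\<psi>\<close> is
  arbitrary and \<open>chi\<close> vanishes, so the two cannot be compared there. \<open>Psi\<close>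
  keeps \<open>\<psi>\<close> at these primes; as valuations are unbounded, it must be truncated
  before it can be treated as periodic.\<close>

lemma poly_bezout:
  fixes a b :: "'a::field poly"
  assumes "coprime a b"
  obtains s t where "s * a + t * b = 1"
proof -
  define I where "I = {f. f \<noteq> 0 \<and> (\<exists>s t. f = s * a + t * b)}"
  have "a \<noteq> 0 \<or> b \<noteq> 0"
    using assms by auto
  then have "\<exists>f. f \<in> I"
    unfolding I_def by (metis (mono_tags, lifting) add.right_neutral add_0 mem_Collect_eq mult_1 mult_zero_left)
  then obtain g where g: "g \<in> I" and least: "\<And>f. f \<in> I \<Longrightarrow> degree g \<le> degree f"
    using ex_has_least_nat[of "\<lambda>f. f \<in> I" _ degree] by blast
  obtain s t where st: "g = s * a + t * b" and g0: "g \<noteq> 0"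
    using g unfolding I_def by blast
  \<comment> \<open>A nonzero remainder of \<open>c\<close> modulo \<open>g\<close> would lie in
    \<open>I\<close> and have smaller degree than \<open>g\<close>, which was chosen of least
    degree.\<close>
  have *: "g dvd c" if "c = u * a + v * b" for c u v
  proof (rule ccontr)
    assume "\<not> g dvd c"
    then have "c mod g \<noteq> 0"
      by (simp add: dvd_eq_mod_eq_0)
    moreover have "c mod g = (u - (c div g) * s) * a + (v - (c div g) * t) * b"
      by (simp add: minus_div_mult_eq_mod[symmetric] that st algebra_simps)
    ultimately have "degree g \<le> degree (c mod g)"
      using least unfolding I_def by blast
    then show False
      using degree_mod_less'[OF g0 \<open>c mod g \<noteq> 0\<close>] by simp
  qed
  have "g dvd a" "g dvd b"
    using *[of a 1 0] *[of b 0 1] by simp_all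
  then have "is_unit g"
    using assms by (meson coprime_common_divisor)
  then obtain h where "1 = g * h"
    by (elim dvdE)
  then have "(h * s) * a + (h * t) * b = 1"
    by (simp add: st algebra_simps)
  then show ?thesis
    using that by blast
qed

lemma bezout_imp_coprime:
  fixes a b :: "'a::field poly"
  assumes "s * a + t * b = 1"
  shows "coprime a b"
proof (rule coprimeI)
  fix c assume "c dvd a" "c dvd b"
  then have "c dvd s * a + t * b"
    by (intro dvd_add dvd_mult)
  then show "is_unit c"
    by (simp add: assms)
qed

lemma poly_coprime_mult_right:
  fixes a b c :: "'a::field poly"
  shows "coprime a (b * c) \<longleftrightarrow> coprime a b \<and> coprime a c"
proof
  assume "coprime a (b * c)"
  then show "coprime a b \<and> coprime a c"
    by (meson coprime_divisors dvd_refl dvd_triv_left dvd_triv_right)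
next
  assume *: "coprime a b \<and> coprime a c"
  obtain s t u v where st: "s * a + t * b = 1" and uv: "u * a + v * c = 1"
    using * by (metis poly_bezout)
  have "(s * a + t * b) * (u * a + v * c) = 1"
    by (simp add: st uv)
  then have "(s * a * u + s * v * c + t * b * u) * a + (t * v) * (b * c) = 1"
    by (simp add: algebra_simps)
  then show "coprime a (b * c)"
    by (rule bezout_imp_coprime)
qed

lemma poly_coprime_mult_left:
  fixes a b c :: "'a::field poly"
  shows "coprime (b * c) a \<longleftrightarrow> coprime b a \<and> coprime c a"
  using poly_coprime_mult_right[of a b c] by (simp add: coprime_commute)

lemma poly_coprime_power_right:
  fixes a b :: "'a::field poly"
  shows "coprime a b \<Longrightarrow> coprime a (b ^ n)"
  by (induction n) (auto simp: poly_coprime_mult_right)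

lemma poly_coprime_power_left:
  fixes a b :: "'a::field poly"
  shows "coprime a b \<Longrightarrow> coprime (a ^ n) b"
  using poly_coprime_power_right[of b a n] by (simp add: coprime_commute)

lemma poly_coprime_prod_right:
  fixes a :: "'a::field poly"
  shows "(\<And>x. x \<in> A \<Longrightarrow> coprime a (f x)) \<Longrightarrow> coprime a (\<Prod>x\<in>A. f x)"
  by (induction A rule: infinite_finite_induct) (auto simp: poly_coprime_mult_right)

lemma poly_coprime_dvd_mult:
  fixes a b c :: "'a::field poly"
  assumes "coprime a b" "a dvd b * c"
  shows "a dvd c"
proof -
  obtain s t where "s * a + t * b = 1"
    using assms(1) by (rule poly_bezout)
  then have "c = (s * a + t * b) * c"
    by simp
  also have "\<dots> = s * c * a + t * (b * c)"
    by (simp add: algebra_simps)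
  finally have "c = s * c * a + t * (b * c)" .
  moreover have "a dvd s * c * a + t * (b * c)"
    using assms(2) by (metis dvd_add dvd_mult dvd_triv_right)
  ultimately show ?thesis
    by metis
qed

lemma poly_divides_mult:
  fixes a b c :: "'a::field poly"
  assumes "coprime a b" "a dvd c" "b dvd c"
  shows "a * b dvd c"
proof -
  obtain d where d: "c = b * d"
    using assms(3) by (rule dvdE)
  then have "a dvd d"
    using assms poly_coprime_dvd_mult by blast
  then show ?thesis
    by (simp add: d mult.commute)
qed

lemma poly_prod_dvd:
  fixes c :: "'a::field poly"
  assumes "finite A" "\<And>x. x \<in> A \<Longrightarrow> f x dvd c"
    "\<And>x y. x \<in> A \<Longrightarrow> y \<in> A \<Longrightarrow> x \<noteq> y \<Longrightarrow> coprime (f x) (f y)"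
  shows "(\<Prod>x\<in>A. f x) dvd c"
  using assms
proof (induction A rule: finite_induct)
  case (insert x A)
  have "coprime (f x) (\<Prod>x\<in>A. f x)"
    using insert by (intro poly_coprime_prod_right) auto
  then show ?case
    using insert by (auto intro!: poly_divides_mult)
qed auto

lemma poly_chinese_remainder:
  fixes a b x y :: "'a::field poly"
  assumes "coprime a b"
  obtains r where "a dvd r - x" "b dvd r - y"
proof -
  obtain s t where st: "s * a + t * b = 1"
    using assms by (rule poly_bezout)
  have "x = x * (s * a + t * b)" "y = y * (s * a + t * b)"
    by (simp_all add: st)
  then have "y * s * a + x * t * b - x = (y - x) * s * a" "y * s * a + x * t * b - y = (x - y) * t * b"
    by (auto simp: algebra_simps)
  then show ?thesis
    by (intro that[of "y * s * a + x * t * b"]) simp_all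
qed

section \<open>Monic polynomials and monic irreducibles\<close>

lemma monics_1 [simp]: "1 \<in> monics"
  by (simp add: monics_def)

lemma monics_nonzero: "f \<in> monics \<Longrightarrow> f \<noteq> 0"
  by (auto simp: monics_def)

lemma monics_mult [intro]: "f \<in> monics \<Longrightarrow> g \<in> monics \<Longrightarrow> f * g \<in> monics"
  by (simp add: monics_def lead_coeff_mult)

lemma monics_power [intro]: "f \<in> monics \<Longrightarrow> f ^ n \<in> monics"
  by (induction n) auto

lemma monics_prod [intro]: "(\<And>x. x \<in> A \<Longrightarrow> f x \<in> monics) \<Longrightarrow> (\<Prod>x\<in>A. f x) \<in> monics"
  by (induction A rule: infinite_finite_induct) auto

lemma monics_cofactor: "f * g \<in> monics \<Longrightarrow> f \<in> monics \<Longrightarrow> g \<in> monics"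
  by (simp add: monics_def lead_coeff_mult)

lemma monics_div:
  assumes "f \<in> monics" "g \<in> monics" "g dvd f"
  shows "f div g \<in> monics"
  using assms monics_cofactor[of g "f div g"] by simp

lemma monics_associated_eq:
  assumes "f \<in> monics" "g \<in> monics" "f dvd g" "g dvd f"
  shows "f = g"
proof -
  obtain h where h: "g = f * h"
    using assms(3) by (rule dvdE)
  then have "h \<in> monics" "f \<noteq> 0" "g \<noteq> 0"
    using assms monics_cofactor monics_nonzero by blast+
  moreover have "degree g \<le> degree f"
    using assms \<open>f \<noteq> 0\<close> by (intro dvd_imp_degree_le) auto
  ultimately have "degree h = 0" "lead_coeff h = 1"
    using h by (auto simp: degree_mult_eq monics_def)
  then have "h = 1"
    by (auto simp: one_pCons elim!: degree_eq_zeroE)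
  then show ?thesis
    using h by simp
qed

lemma monics_degree_0: "f \<in> monics \<Longrightarrow> degree f = 0 \<Longrightarrow> f = 1"
  by (auto simp: monics_def one_pCons elim!: degree_eq_zeroE)

lemma
  assumes "P \<in> monic_irreds"
  shows monic_irreds_monic [simp]: "P \<in> monics"
    and monic_irreds_irreducible: "irreducible P"
    and monic_irreds_nonzero: "P \<noteq> 0"
    and monic_irreds_not_unit: "\<not> is_unit P"
    and monic_irreds_prime: "prime_elem P"
    and monic_irreds_degree: "degree P > 0"
proof -
  show *: "P \<in> monics" "irreducible P"
    using assms by (auto simp: monic_irreds_def)
  show "P \<noteq> 0" "\<not> is_unit P" "prime_elem P"
    using * by (auto simp: irreducible_def field_poly_irreducible_imp_prime)
  then show "degree P > 0"
    using is_unit_iff_degree by blast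
qed

lemma coprime_monic_irred_iff:
  assumes "P \<in> monic_irreds"
  shows "coprime P f \<longleftrightarrow> \<not> P dvd f"
proof
  assume "coprime P f"
  then show "\<not> P dvd f"
    using assms monic_irreds_not_unit by (meson coprime_common_divisor dvd_refl)
next
  assume "\<not> P dvd f"
  show "coprime P f"
  proof (rule coprimeI)
    fix d assume d: "d dvd P" "d dvd f"
    then obtain e where e: "P = d * e"
      by (elim dvdE)
    then have "is_unit d \<or> is_unit e"
      using assms monic_irreds_irreducible irreducibleD by blast
    moreover have "\<not> is_unit e"
      using d e \<open>\<not> P dvd f\<close> by (metis dvd_mult_unit_iff dvd_refl dvd_trans)
    ultimately show "is_unit d"
      by simp
  qed
qed

lemma coprime_monic_irreds:
  assumes "P \<in> monic_irreds" "R \<in> monic_irreds" "P \<noteq> R"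
  shows "coprime P R"
proof -
  have "\<not> P dvd R"
  proof
    assume *: "P dvd R"
    then obtain e where e: "R = P * e"
      by (elim dvdE)
    then have "is_unit e"
      using irreducibleD[OF monic_irreds_irreducible[OF assms(2)] e] monic_irreds_not_unit[OF assms(1)]
      by blast
    then have "R dvd P"
      using e by (simp add: mult_unit_dvd_iff)
    then show False
      using * assms monics_associated_eq[of P R] by simp
  qed
  then show ?thesis
    using assms coprime_monic_irred_iff by blast
qed

lemma monic_irred_dvd_mult_iff:
  "P \<in> monic_irreds \<Longrightarrow> P dvd f * g \<longleftrightarrow> P dvd f \<or> P dvd g"
  by (simp add: monic_irreds_prime prime_elem_dvd_mult_iff)

lemma monic_irred_divisor_exists:
  fixes f :: "'a::{field,finite} poly"
  assumes "\<not> is_unit f" "f \<noteq> 0"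
  shows "\<exists>P\<in>monic_irreds. P dvd f"
  using assms
proof (induction "degree f" arbitrary: f rule: less_induct)
  case less
  show ?case
  proof (cases "irreducible f")
    case True
    define P where "P = smult (inverse (lead_coeff f)) f"
    have "P dvd f" "f dvd P"
      using less.prems by (simp_all add: P_def smult_dvd_iff dvd_smult)
    moreover have "irreducible P"
    proof (rule irreducibleI)
      show "P \<noteq> 0"
        using less.prems \<open>P dvd f\<close> by auto
      show "\<not> is_unit P"
        using less.prems \<open>f dvd P\<close> dvd_trans by blast
      fix a b assume "P = a * b"
      then have "smult (lead_coeff f) P = smult (lead_coeff f) a * b"
        by simp
      then have "f = smult (lead_coeff f) a * b"
        using less.prems by (simp add: P_def)
      then have "is_unit (smult (lead_coeff f) a) \<or> is_unit b"
        by (rule irreducibleD[OF True])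
      then show "is_unit a \<or> is_unit b"
        using less.prems by (simp add: smult_dvd_iff)
    qed
    moreover have "P \<in> monics"
      using less.prems by (simp add: P_def monics_def)
    ultimately show ?thesis
      unfolding monic_irreds_def by blast
  next
    case False
    then obtain a b where ab: "f = a * b" "\<not> is_unit a" "\<not> is_unit b"
      using less.prems by (auto simp: irreducible_def)
    have "a \<noteq> 0" "b \<noteq> 0"
      using ab less.prems by auto
    then have "degree a < degree f"
      using ab is_unit_iff_degree by (auto simp: degree_mult_eq)
    then show ?thesis
      using less.hyps[of a] ab \<open>a \<noteq> 0\<close> dvd_mult2 by blast
  qed
qed

lemma coprime_iff_no_monic_irred:
  fixes f Q :: "'a::{field,finite} poly"
  assumes "Q \<noteq> 0"
  shows "coprime f Q \<longleftrightarrow> (\<forall>P\<in>monic_irreds. P dvd Q \<longrightarrow> \<not> P dvd f)"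
proof
  assume "coprime f Q"
  then show "\<forall>P\<in>monic_irreds. P dvd Q \<longrightarrow> \<not> P dvd f"
    by (meson coprime_common_divisor monic_irreds_not_unit)
next
  assume *: "\<forall>P\<in>monic_irreds. P dvd Q \<longrightarrow> \<not> P dvd f"
  show "coprime f Q"
  proof (rule coprimeI, rule ccontr)
    fix d assume d: "d dvd f" "d dvd Q" "\<not> is_unit d"
    moreover have "d \<noteq> 0"
      using d assms by auto
    ultimately show False
      using * monic_irred_divisor_exists[of d] dvd_trans by blast
  qed
qed

text \<open>Stated by coefficients because \<open>0\<close> has degree 0: a bound
  \<open>degree f < d\<close> would lose \<open>0\<close> at \<open>d = 0\<close>, where it is the
  only residue.\<close>

definition residues :: "nat \<Rightarrow> 'a::{field,finite} poly set" where
  "residues d = {f. \<forall>i\<ge>d. coeff f i = 0}"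

lemma finite_card_residues:
  "finite (residues d :: 'a::{field,finite} poly set) \<and> card (residues d :: 'a poly set) = CARD('a) ^ d"
proof (induction d)
  case 0
  have "residues 0 = {0 :: 'a poly}"
    by (auto simp: residues_def poly_eq_iff)
  then show ?case
    by simp
next
  case (Suc d)
  have eq: "residues (Suc d) = (\<lambda>(a, f). pCons a f) ` (UNIV \<times> (residues d :: 'a poly set))"
  proof (intro equalityI subsetI)
    fix f :: "'a poly" assume f: "f \<in> residues (Suc d)"
    obtain a g where ag: "f = pCons a g"
      by (cases f) auto
    have "g \<in> residues d"
      unfolding residues_def
    proof (clarify)
      fix i assume "d \<le> i"
      then show "coeff g i = 0"
        using f unfolding ag residues_def by (auto dest: spec[of _ "Suc i"])
    qed
    then show "f \<in> (\<lambda>(a, f). pCons a f) ` (UNIV \<times> residues d)"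
      by (auto simp: ag)
  next
    fix f :: "'a poly" assume "f \<in> (\<lambda>(a, f). pCons a f) ` (UNIV \<times> residues d)"
    then show "f \<in> residues (Suc d)"
      by (auto simp: residues_def coeff_pCons split: nat.splits)
  qed
  have "inj_on (\<lambda>(a, f). pCons a f) (UNIV \<times> (residues d :: 'a poly set))"
    by (auto simp: inj_on_def)
  then show ?case
    using Suc by (simp add: eq card_image card_cartesian_product)
qed

lemma finite_residues [simp]: "finite (residues d :: 'a::{field,finite} poly set)"
  and card_residues: "card (residues d :: 'a::{field,finite} poly set) = CARD('a) ^ d"
  using finite_card_residues by blast+

lemma residues_iff_degree: "f \<in> residues d \<longleftrightarrow> f = 0 \<or> degree f < d"
proof -
  have "f = 0 \<or> degree f < d" if "f \<in> residues d"
  proof (cases "degree f < d")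
    case False
    then have "lead_coeff f = 0"
      using that by (simp add: residues_def)
    then show ?thesis
      by simp
  qed simp
  moreover have "f \<in> residues d" if "f = 0 \<or> degree f < d"
    using that by (auto simp: residues_def coeff_eq_0)
  ultimately show ?thesis
    by blast
qed

lemma mod_in_residues: "D \<noteq> 0 \<Longrightarrow> f mod D \<in> residues (degree D)"
  using degree_mod_less residues_iff_degree by blast

lemma residues_mod_eq: "f \<in> residues (degree D) \<Longrightarrow> f mod D = f"
  by (auto simp: residues_iff_degree mod_poly_less)

lemma finite_degree_le: "finite {f :: 'a::{field,finite} poly. degree f \<le> n}"
  by (rule finite_subset[OF _ finite_residues[of "Suc n"]]) (auto simp: residues_iff_degree)

lemma finite_monic_irred_divisors:
  fixes f :: "'a::{field,finite} poly"
  assumes "f \<noteq> 0"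
  shows "finite {P \<in> monic_irreds. P dvd f}"
  by (rule finite_subset[OF _ finite_degree_le[of "degree f"]]) (use assms in \<open>auto intro: dvd_imp_degree_le\<close>)

subsection \<open>Valuations\<close>

text \<open>Meaningless at \<open>f = 0\<close>, where every power of \<open>P\<close> divides.\<close>

definition pval :: "'a::field poly \<Rightarrow> 'a poly \<Rightarrow> nat" where
  "pval P f = (GREATEST k. P ^ k dvd f)"

lemma power_dvd_imp_le_degree:
  assumes "P \<in> monic_irreds" "f \<noteq> 0" "P ^ k dvd f"
  shows "k \<le> degree f"
proof -
  have "k * 1 \<le> k * degree P"
    using monic_irreds_degree[OF assms(1)] by (intro mult_le_mono2) simp
  also have "\<dots> = degree (P ^ k)"
    using monic_irreds_nonzero[OF assms(1)] by (simp add: degree_power_eq)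
  also have "\<dots> \<le> degree f"
    using assms by (intro dvd_imp_degree_le) auto
  finally show ?thesis
    by simp
qed

lemma pval_dvd_iff:
  assumes "P \<in> monic_irreds" "f \<noteq> 0"
  shows "P ^ k dvd f \<longleftrightarrow> k \<le> pval P f"
proof
  assume "P ^ k dvd f"
  then show "k \<le> pval P f"
    unfolding pval_def
    by (intro Greatest_le_nat[where b = "degree f"]) (use assms power_dvd_imp_le_degree in auto)
next
  have "P ^ pval P f dvd f"
    unfolding pval_def
    by (rule GreatestI_nat[where k = 0 and b = "degree f"]) (use assms power_dvd_imp_le_degree in auto)
  then show "P ^ k dvd f" if "k \<le> pval P f"
    using that by (meson dvd_trans le_imp_power_dvd)
qed

lemma pval_le_degree:
  assumes "P \<in> monic_irreds" "f \<noteq> 0"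
  shows "pval P f \<le> degree f"
  using assms pval_dvd_iff power_dvd_imp_le_degree by blast

lemma pval_eq_0_iff:
  assumes "P \<in> monic_irreds" "f \<noteq> 0"
  shows "pval P f = 0 \<longleftrightarrow> \<not> P dvd f"
  using pval_dvd_iff[OF assms, of 1] by auto

lemma pval_eqI:
  assumes "P \<in> monic_irreds" "P ^ k dvd f" "\<not> P ^ Suc k dvd f"
  shows "pval P f = k"
proof -
  have "f \<noteq> 0"
    using assms by auto
  then show ?thesis
    using pval_dvd_iff[OF assms(1)] assms by (metis le_antisym not_less_eq_eq)
qed

lemma pval_power_mult:
  assumes "P \<in> monic_irreds" "\<not> P dvd g"
  shows "pval P (P ^ k * g) = k"
  using assms monic_irreds_nonzero[of P] by (intro pval_eqI) auto

lemma pval_decompose: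
  assumes "P \<in> monic_irreds" "f \<noteq> 0"
  obtains g where "f = P ^ pval P f * g" "\<not> P dvd g"
proof -
  obtain g where g: "f = P ^ pval P f * g"
    using pval_dvd_iff[OF assms, of "pval P f"] by (auto elim: dvdE)
  have "\<not> P dvd g"
  proof
    assume "P dvd g"
    then have "P ^ Suc (pval P f) dvd P ^ pval P f * g"
      by (simp add: mult.commute mult_dvd_mono)
    then show False
      using pval_dvd_iff[OF assms, of "Suc (pval P f)"] g by simp
  qed
  then show ?thesis
    using g that by blast
qed

lemma pval_mult:
  assumes "P \<in> monic_irreds" "f \<noteq> 0" "g \<noteq> 0"
  shows "pval P (f * g) = pval P f + pval P g"
proof -
  obtain f' where f': "f = P ^ pval P f * f'" "\<not> P dvd f'"
    using pval_decompose[OF assms(1,2)] .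
  obtain g' where g': "g = P ^ pval P g * g'" "\<not> P dvd g'"
    using pval_decompose[OF assms(1,3)] .
  have "f * g = P ^ (pval P f + pval P g) * (f' * g')"
    by (subst f'(1), subst g'(1)) (simp add: power_add algebra_simps)
  moreover have "\<not> P dvd f' * g'"
    using assms f' g' by (simp add: monic_irred_dvd_mult_iff)
  ultimately show ?thesis
    using pval_power_mult[OF assms(1)] by metis
qed

text \<open>By the ultrametric inequality, a change of higher valuation than \<open>f\<close> cannot
  alter the valuation. The single extra power of \<open>P\<close> needed here is what the factor
  \<open>Q\<close> supplies in \<open>Psi_cong\<close>.\<close>

lemma pval_cong:
  assumes "P \<in> monic_irreds" "f \<noteq> 0" "P ^ Suc (pval P f) dvd g - f"
  shows "pval P g = pval P f"
proof (rule pval_eqI)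
  have d: "P ^ pval P f dvd f"
    using assms pval_dvd_iff by blast
  have "P ^ pval P f dvd g - f"
    using assms(3) by (meson dvd_trans le_imp_power_dvd lessI less_imp_le)
  then show "P ^ pval P f dvd g"
    using dvd_add[OF _ d] by force
  show "\<not> P ^ Suc (pval P f) dvd g"
  proof
    assume "P ^ Suc (pval P f) dvd g"
    then have "P ^ Suc (pval P f) dvd f"
      using dvd_diff[OF _ assms(3), of g] by simp
    then show False
      using pval_dvd_iff[OF assms(1,2), of "Suc (pval P f)"] by simp
  qed
qed fact

text \<open>For nonzero \<open>f\<close> and a finite set \<open>S\<close> of monic irreducibles,
  the largest monic divisor of \<open>f\<close> composed of primes from \<open>S\<close>; with
  \<open>S\<close> all primes of degree at most \<open>y\<close> it is the smooth part of
  \<open>f\<close>.\<close>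

definition ppart :: "'a::field poly set \<Rightarrow> 'a poly \<Rightarrow> 'a poly" where
  "ppart S f = (\<Prod>P\<in>S. P ^ pval P f)"

lemma ppart_monic: "S \<subseteq> monic_irreds \<Longrightarrow> ppart S f \<in> monics"
  unfolding ppart_def by (intro monics_prod monics_power) auto

lemma ppart_dvd:
  assumes "finite S" "S \<subseteq> monic_irreds" "f \<noteq> 0"
  shows "ppart S f dvd f"
  unfolding ppart_def
proof (rule poly_prod_dvd)
  show "P ^ pval P f dvd f" if "P \<in> S" for P
    using that assms pval_dvd_iff by blast
  show "coprime (P ^ pval P f) (R ^ pval R f)" if "P \<in> S" "R \<in> S" "P \<noteq> R" for P R
    using that assms
    by (intro poly_coprime_power_left poly_coprime_power_right coprime_monic_irreds) auto
qed fact

lemma pval_ppart: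
  assumes "finite S" "S \<subseteq> monic_irreds" "P \<in> S"
  shows "pval P (ppart S f) = pval P f"
proof -
  have "\<not> P dvd ppart (S - {P}) f"
    unfolding coprime_monic_irred_iff[OF subsetD[OF assms(2,3)], symmetric] ppart_def
    using assms by (intro poly_coprime_prod_right poly_coprime_power_right coprime_monic_irreds) auto
  moreover have "ppart S f = P ^ pval P f * ppart (S - {P}) f"
    unfolding ppart_def using assms by (simp add: prod.remove)
  ultimately show ?thesis
    using pval_power_mult assms by (metis subsetD)
qed

lemma ppart_coprime_cofactor:
  assumes "finite S" "S \<subseteq> monic_irreds" "f \<noteq> 0" "P \<in> S"
  shows "\<not> P dvd f div ppart S f"
proof -
  have P: "P \<in> monic_irreds"
    using assms by auto
  have eq: "ppart S f * (f div ppart S f) = f"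
    using ppart_dvd[OF assms(1-3)] by simp
  then have nz: "ppart S f \<noteq> 0" "f div ppart S f \<noteq> 0"
    using assms(3) by auto
  have "pval P (ppart S f) + pval P (f div ppart S f) = pval P f"
    using pval_mult[OF P nz] by (simp add: eq)
  then have "pval P (f div ppart S f) = 0"
    using pval_ppart[OF assms(1,2,4)] by simp
  then show ?thesis
    using pval_eq_0_iff[OF P nz(2)] by simp
qed

lemma multiplicative_prod:
  fixes \<psi> :: "'a::{field,finite} poly \<Rightarrow> complex"
  assumes "multiplicative \<psi>" "finite A" "\<And>x. x \<in> A \<Longrightarrow> f x \<in> monics"
    "\<And>x y. x \<in> A \<Longrightarrow> y \<in> A \<Longrightarrow> x \<noteq> y \<Longrightarrow> coprime (f x) (f y)"
  shows "\<psi> (\<Prod>x\<in>A. f x) = (\<Prod>x\<in>A. \<psi> (f x))"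
  using assms(2-)
proof (induction A rule: finite_induct)
  case empty
  then show ?case
    using assms(1) by (simp add: multiplicative_def)
next
  case (insert x A)
  have "coprime (f x) (\<Prod>x\<in>A. f x)"
    using insert by (intro poly_coprime_prod_right) auto
  moreover have "(\<Prod>x\<in>A. f x) \<in> monics"
    using insert by (intro monics_prod) auto
  ultimately show ?case
    using insert assms(1) by (simp add: multiplicative_def)
qed

lemma multiplicative_ppart:
  fixes \<psi> :: "'a::{field,finite} poly \<Rightarrow> complex"
  assumes "multiplicative \<psi>" "finite S" "S \<subseteq> monic_irreds"
  shows "\<psi> (ppart S f) = (\<Prod>P\<in>S. \<psi> (P ^ pval P f))"
  unfolding ppart_def
proof (rule multiplicative_prod)
  show "coprime (P ^ pval P f) (R ^ pval R f)" if "P \<in> S" "R \<in> S" "P \<noteq> R" for P R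
    using that assms
    by (intro poly_coprime_power_left poly_coprime_power_right coprime_monic_irreds) auto
qed (use assms in \<open>auto intro!: monics_power\<close>)

lemma multiplicative_split:
  fixes \<psi> :: "'a::{field,finite} poly \<Rightarrow> complex"
  assumes "multiplicative \<psi>" "finite S" "S \<subseteq> monic_irreds" "f \<in> monics"
  shows "\<psi> f = \<psi> (ppart S f) * \<psi> (f div ppart S f)"
proof -
  have f0: "f \<noteq> 0"
    using assms monics_nonzero by blast
  have "coprime (f div ppart S f) (ppart S f)"
    unfolding ppart_def
  proof (intro poly_coprime_prod_right poly_coprime_power_right)
    fix P assume "P \<in> S"
    then have "P \<in> monic_irreds" "\<not> P dvd f div ppart S f"
      using assms ppart_coprime_cofactor[OF assms(2,3) f0] by auto
    then show "coprime (f div (\<Prod>P\<in>S. P ^ pval P f)) P"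
      unfolding ppart_def by (metis coprime_commute coprime_monic_irred_iff)
  qed
  then have "coprime (ppart S f) (f div ppart S f)"
    by (simp add: coprime_commute)
  moreover have "ppart S f dvd f" "ppart S f \<in> monics"
    using ppart_dvd[OF assms(2,3) f0] ppart_monic[OF assms(3)] by auto
  moreover from this have "f div ppart S f \<in> monics"
    using assms monics_div by blast
  ultimately show ?thesis
    using assms(1) by (metis dvd_mult_div_cancel multiplicative_def)
qed

subsection \<open>Averages over the monic polynomials of a given degree\<close>

lemma pnorm_pos [simp]: "pnorm D > 0"
  by (simp add: pnorm_def)

lemma pnorm_nonzero [simp]: "pnorm D \<noteq> 0"
  using pnorm_pos[of D] by linarith

lemma pnorm_1 [simp]: "pnorm 1 = 1"
  by (simp add: pnorm_def)

lemma pnorm_mult: "f \<noteq> 0 \<Longrightarrow> g \<noteq> 0 \<Longrightarrow> pnorm (f * g) = pnorm f * pnorm g"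
  by (simp add: pnorm_def degree_mult_eq power_add)

lemma pnorm_power: "f \<noteq> 0 \<Longrightarrow> pnorm (f ^ k) = pnorm f ^ k"
  by (induction k) (auto simp: pnorm_mult)

lemma CARD_field_ge_2: "CARD('a::{field,finite}) \<ge> 2"
proof -
  have "card {0, 1 :: 'a} \<le> CARD('a)"
    by (intro card_mono) auto
  then show ?thesis
    by simp
qed

lemma pnorm_irred_ge_2: "P \<in> monic_irreds \<Longrightarrow> pnorm P \<ge> 2"
proof -
  assume P: "P \<in> monic_irreds"
  have "2 ^ 1 \<le> (2 :: real) ^ degree P"
    using monic_irreds_degree[OF P] by (intro power_increasing) auto
  also have "\<dots> \<le> pnorm P"
    unfolding pnorm_def using CARD_field_ge_2[where ?'a = 'a] by (intro power_mono) auto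
  finally show ?thesis
    by simp
qed

lemma monics_degI: "f \<in> monics \<Longrightarrow> degree f = n \<Longrightarrow> f \<in> monics_deg n"
  by (simp add: monics_deg_def)

lemma monics_degD:
  assumes "f \<in> monics_deg n"
  shows "f \<in> monics" "degree f = n" "f \<noteq> 0"
  using assms monics_nonzero by (auto simp: monics_deg_def)

lemma monics_add_small:
  assumes "f \<in> monics" "r = 0 \<or> degree r < degree f"
  shows "f + r \<in> monics" "degree (f + r) = degree f"
proof -
  show *: "degree (f + r) = degree f"
    using assms by (auto simp: degree_add_eq_left)
  show "f + r \<in> monics"
    using assms * by (auto simp: monics_def coeff_eq_0)
qed

lemma monics_deg_conv: "monics_deg n = (\<lambda>r. monom 1 n + r) ` residues n"
proof (intro equalityI subsetI)
  fix f :: "'a poly" assume "f \<in> monics_deg n"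
  then have f: "coeff f n = 1" "degree f = n"
    by (auto simp: monics_deg_def monics_def)
  have "f - monom 1 n \<in> residues n"
    unfolding residues_def
  proof clarify
    fix i assume "n \<le> i"
    then show "coeff (f - monom 1 n) i = 0"
      using f by (cases "i = n") (auto simp: coeff_eq_0)
  qed
  then show "f \<in> (\<lambda>r. monom 1 n + r) ` residues n"
    by (intro image_eqI[of _ _ "f - monom 1 n"]) auto
next
  fix f :: "'a poly" assume "f \<in> (\<lambda>r. monom 1 n + r) ` residues n"
  then obtain r where r: "f = monom 1 n + r" "r \<in> residues n"
    by blast
  have "monom 1 n \<in> (monics :: 'a poly set)"
    by (simp add: monics_def degree_monom_eq)
  then show "f \<in> monics_deg n"
    using monics_add_small[of "monom 1 n" r] r
    by (auto simp: residues_iff_degree degree_monom_eq intro!: monics_degI)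
qed

lemma finite_monics_deg [simp]: "finite (monics_deg n :: 'a::{field,finite} poly set)"
  by (simp add: monics_deg_conv)

lemma card_monics_deg: "card (monics_deg n :: 'a::{field,finite} poly set) = CARD('a) ^ n"
  by (simp add: monics_deg_conv card_image card_residues)

text \<open>Division with remainder by \<open>D\<close>. It makes the monics of degree
  \<open>n\<close> equidistributed modulo \<open>D\<close> with no error term as soon as
  \<open>degree D \<le> n\<close>; the exact averages below rest on it.\<close>

lemma bij_betw_monics_deg:
  fixes D :: "'a::{field,finite} poly"
  assumes "D \<in> monics" "degree D \<le> n"
  shows "bij_betw (\<lambda>(g, r). g * D + r) (monics_deg (n - degree D) \<times> residues (degree D)) (monics_deg n)"
proof (rule bij_betwI[where g = "\<lambda>f. (f div D, f mod D)"])
  have D0: "D \<noteq> 0"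
    using assms monics_nonzero by blast
  have *: "g * D + r \<in> monics_deg n"
    if "g \<in> monics_deg (n - degree D)" "r \<in> residues (degree D)" for g r
  proof -
    have "g * D \<in> monics" "degree (g * D) = n"
      using monics_degD[OF that(1)] D0 assms by (auto simp: degree_mult_eq)
    moreover have "r = 0 \<or> degree r < n"
      using that assms by (auto simp: residues_iff_degree)
    ultimately show ?thesis
      using monics_add_small[of "g * D" r] by (auto intro: monics_degI)
  qed
  then show "(\<lambda>(g, r). g * D + r) \<in> monics_deg (n - degree D) \<times> residues (degree D) \<rightarrow> monics_deg n"
    by auto
  have **: "(g * D + r) div D = g \<and> (g * D + r) mod D = r" if "r \<in> residues (degree D)" for g r
    using that D0 residues_mod_eq[OF that]
    by (auto simp: residues_iff_degree div_poly_less)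
  then show "(\<lambda>f. (f div D, f mod D)) ((\<lambda>(g, r). g * D + r) x) = x"
    if "x \<in> monics_deg (n - degree D) \<times> residues (degree D)" for x
    using that by auto
  show "(\<lambda>f. (f div D, f mod D)) \<in> monics_deg n \<rightarrow> monics_deg (n - degree D) \<times> residues (degree D)"
  proof
    fix f :: "'a poly" assume f: "f \<in> monics_deg n"
    have r: "f mod D \<in> residues (degree D)"
      using D0 by (rule mod_in_residues)
    then have small: "- (f mod D) = 0 \<or> degree (- (f mod D)) < degree f"
      using assms monics_degD[OF f] by (auto simp: residues_iff_degree)
    have "f div D * D = f + - (f mod D)"
      by (simp add: minus_mod_eq_div_mult)
    then have "f div D * D \<in> monics" "degree (f div D * D) = n"
      using monics_add_small[OF monics_degD(1)[OF f] small] monics_degD[OF f] by auto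
    moreover from this have "f div D \<noteq> 0"
      using monics_nonzero by fastforce
    ultimately have "f div D \<in> monics" "degree (f div D) = n - degree D"
      using assms D0 monics_cofactor[of D "f div D"] by (auto simp: mult.commute degree_mult_eq)
    then show "(f div D, f mod D) \<in> monics_deg (n - degree D) \<times> residues (degree D)"
      using r by (auto intro: monics_degI)
  qed
  show "(\<lambda>(g, r). g * D + r) ((\<lambda>f. (f div D, f mod D)) f) = f" for f
    by simp
qed

section \<open>Averages and periodic functions\<close>

definition avg :: "nat \<Rightarrow> ('a::{field,finite} poly \<Rightarrow> 'b::real_normed_field) \<Rightarrow> 'b" where
  "avg n H = (\<Sum>f\<in>monics_deg n. H f) / of_nat (CARD('a) ^ n)"

definition periodic :: "'a::{field,finite} poly \<Rightarrow> ('a poly \<Rightarrow> 'b) \<Rightarrow> bool" where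
  "periodic D H \<longleftrightarrow> (\<forall>f g. D dvd g - f \<longrightarrow> H g = H f)"

lemma periodicI: "(\<And>f g. D dvd g - f \<Longrightarrow> H g = H f) \<Longrightarrow> periodic D H"
  by (simp add: periodic_def)

lemma periodicD: "periodic D H \<Longrightarrow> D dvd g - f \<Longrightarrow> H g = H f"
  by (simp add: periodic_def)

lemma periodic_mod: "periodic D H \<Longrightarrow> H (f mod D) = H f"
  by (erule periodicD) (metis mod_eq_dvd_iff mod_mod_trivial)

lemma periodic_dvd: "periodic D H \<Longrightarrow> D dvd E \<Longrightarrow> periodic E H"
  by (meson dvd_trans periodic_def)

lemma periodic_mult:
  "periodic D H \<Longrightarrow> periodic D K \<Longrightarrow> periodic D (\<lambda>f. H f * (K f :: 'b::times))"
  by (simp add: periodic_def)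

lemma periodic_of_bool_dvd: "periodic D (\<lambda>f. of_bool (D dvd f - r))"
proof (rule periodicI)
  fix f g assume "D dvd g - f"
  then have "D dvd (g - f) + (f - r) \<longleftrightarrow> D dvd f - r"
    by (rule dvd_add_right_iff)
  then show "of_bool (D dvd g - r) = of_bool (D dvd f - r)"
    by simp
qed

lemma avg_add: "avg n (\<lambda>f. H f + K f) = avg n H + avg n K"
  by (simp add: avg_def sum.distrib add_divide_distrib)

lemma avg_diff: "avg n (\<lambda>f. H f - K f) = avg n H - avg n K"
  by (simp add: avg_def sum_subtractf diff_divide_distrib)

lemma avg_sum: "avg n (\<lambda>f. \<Sum>i\<in>A. H i f) = (\<Sum>i\<in>A. avg n (H i))"
  unfolding avg_def sum_divide_distrib by (subst sum.swap) simp

lemma avg_cmult: "avg n (\<lambda>f. c * H f) = c * avg n H"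
  by (simp add: avg_def sum_distrib_left)

lemma avg_cnj: "avg n (\<lambda>f. cnj (H f)) = cnj (avg n H)"
  by (simp add: avg_def)

lemma avg_of_real: "avg n (\<lambda>f. of_real (H f)) = of_real (avg n H)"
  by (simp add: avg_def)

lemma avg_cong: "(\<And>f. f \<in> monics_deg n \<Longrightarrow> H f = K f) \<Longrightarrow> avg n H = avg n K"
  by (simp add: avg_def cong: sum.cong)

lemma avg_const [simp]: "avg n (\<lambda>f :: 'a::{field,finite} poly. c) = c"
  by (simp add: avg_def card_monics_deg)

lemma avg_mono: "(\<And>f. f \<in> monics_deg n \<Longrightarrow> H f \<le> K f) \<Longrightarrow> avg n H \<le> (avg n K :: real)"
  unfolding avg_def by (intro divide_right_mono sum_mono) auto

lemma norm_avg_le: "norm (avg n H) \<le> avg n (\<lambda>f. norm (H f))"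
  unfolding avg_def by (simp add: norm_divide norm_power norm_sum divide_right_mono)

lemma norm_avg_le':
  assumes "\<And>f. f \<in> monics_deg n \<Longrightarrow> norm (H f) \<le> K f"
  shows "norm (avg n H) \<le> avg n K"
  using norm_avg_le[of n H] avg_mono[of n "\<lambda>f. norm (H f)" K] assms by fastforce

lemma avg_Cauchy_Schwarz: "(avg n H)\<^sup>2 \<le> avg n (\<lambda>f. (H f)\<^sup>2 :: real)"
  for H :: "'a::{field,finite} poly \<Rightarrow> real"
proof -
  have "(\<Sum>f\<in>monics_deg n. 1 * H f)\<^sup>2 \<le> (\<Sum>f\<in>(monics_deg n :: 'a poly set). 1\<^sup>2) * (\<Sum>f\<in>monics_deg n. (H f)\<^sup>2)"
    by (rule Cauchy_Schwarz_ineq_sum)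
  then have "(\<Sum>f\<in>monics_deg n. H f)\<^sup>2 \<le> real CARD('a) ^ n * (\<Sum>f\<in>monics_deg n. (H f)\<^sup>2)"
    by (simp add: card_monics_deg)
  then show ?thesis
    by (simp add: avg_def divide_simps power2_eq_square mult_ac)
qed

lemma avg_periodic:
  fixes D :: "'a::{field,finite} poly" and H :: "'a poly \<Rightarrow> 'b::real_normed_field"
  assumes "D \<in> monics" "degree D \<le> n" "periodic D H"
  shows "avg n H = (\<Sum>r\<in>residues (degree D). H r) / of_real (pnorm D)"
proof -
  have "(\<Sum>f\<in>monics_deg n. H f) =
      (\<Sum>(g, r)\<in>monics_deg (n - degree D) \<times> residues (degree D). H (g * D + r))"
    using sum.reindex_bij_betw[OF bij_betw_monics_deg[OF assms(1,2)], of H, symmetric]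
    by (simp add: case_prod_unfold)
  also have "\<dots> = (\<Sum>(g :: 'a poly, r)\<in>monics_deg (n - degree D) \<times> residues (degree D). H r)"
    by (rule sum.cong) (auto intro!: periodicD[OF assms(3)])
  also have "\<dots> = of_nat (CARD('a) ^ (n - degree D)) * (\<Sum>r\<in>residues (degree D). H r)"
    by (simp add: sum.cartesian_product[symmetric] card_monics_deg)
  finally have "(\<Sum>f\<in>monics_deg n. H f) = of_nat CARD('a) ^ (n - degree D) * (\<Sum>r\<in>residues (degree D). H r)"
    by simp
  moreover have "(of_nat CARD('a) :: 'b) ^ n = of_nat CARD('a) ^ (n - degree D) * of_nat CARD('a) ^ degree D"
    using assms(2) by (simp flip: power_add)
  ultimately show ?thesis
    by (simp add: avg_def pnorm_def)
qed

text \<open>In degree 0, adding 1 would change the leading coefficient, hence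
  \<open>n \<ge> 1\<close>. The invariance lets average bounds for \<open>f\<close> serve for
  \<open>f + 1\<close>.\<close>

lemma avg_shift:
  fixes H :: "'a::{field,finite} poly \<Rightarrow> 'b::real_normed_field"
  assumes "n \<ge> 1"
  shows "avg n (\<lambda>f. H (f + 1)) = avg n H"
proof -
  have *: "f + c \<in> monics_deg n" if "f \<in> monics_deg n" "c = 1 \<or> c = - 1" for f c :: "'a poly"
    using monics_add_small[of f c] that assms by (auto simp: monics_deg_def)
  have "(\<Sum>f\<in>monics_deg n. H (f + 1)) = (\<Sum>f\<in>monics_deg n. H f)"
    by (rule sum.reindex_bij_witness[where i = "\<lambda>f. f + - 1" and j = "\<lambda>f. f + 1"]) (use *[where c = 1] *[where c = "- 1"] in auto)
  then show ?thesis
    by (simp add: avg_def)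
qed

lemma monics_deg_add_1:
  assumes "f \<in> monics_deg n" "n \<ge> 1"
  shows "f + 1 \<in> monics_deg n"
  using monics_add_small[of f 1] assms by (auto simp: monics_deg_def)

lemma avg_dvd:
  assumes "D \<in> monics" "degree D \<le> n"
  shows "avg n (\<lambda>f. of_bool (D dvd f - r) :: real) = 1 / pnorm D"
proof -
  have D0: "D \<noteq> 0"
    using assms monics_nonzero by blast
  have eq: "D dvd s - r \<longleftrightarrow> s = r mod D" if "s \<in> residues (degree D)" for s
    using residues_mod_eq[OF that] by (simp flip: mod_eq_dvd_iff)
  have "(\<Sum>s\<in>residues (degree D). of_bool (D dvd s - r) :: real) = (\<Sum>s\<in>residues (degree D). if s = r mod D then 1 else 0)"
    by (intro sum.cong) (auto simp: eq)
  also have "\<dots> = 1"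
    using mod_in_residues[OF D0] by (subst sum.delta) auto
  finally show ?thesis
    using avg_periodic[OF assms periodic_of_bool_dvd[of D r], where ?'b = real] by simp
qed

text \<open>A polynomial of degree above \<open>n\<close> divides nothing in
  \<open>monics_deg n\<close>, so the bound, unlike the exact value, holds without relating
  \<open>degree D\<close> to \<open>n\<close>. This gives majorants over all prime powers that are
  uniform in \<open>n\<close>.\<close>

lemma avg_dvd_le:
  assumes "D \<in> monics"
  shows "avg n (\<lambda>f. of_bool (D dvd f) :: real) \<le> 1 / pnorm D"
proof (cases "degree D \<le> n")
  case True
  then show ?thesis
    using avg_dvd[OF assms True, of 0] by simp
next
  case False
  then have "\<not> D dvd f" if "f \<in> monics_deg n" for f
    using monics_degD[OF that] dvd_imp_degree_le by blast
  then have "avg n (\<lambda>f. of_bool (D dvd f) :: real) = avg n (\<lambda>f. 0)"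
    using avg_cong[of n "\<lambda>f. of_bool (D dvd f) :: real" "\<lambda>f. 0"] by auto
  then show ?thesis
    by (simp add: less_imp_le)
qed

section \<open>Sums over complete residue systems\<close>

lemma residue_sum_reindex:
  fixes H :: "'a::{field,finite} poly \<Rightarrow> 'b::comm_monoid_add"
  assumes "D \<noteq> 0" "periodic D H" "\<And>r s. D dvd F r - F s \<Longrightarrow> D dvd r - s"
  shows "(\<Sum>r\<in>residues (degree D). H (F r)) = (\<Sum>r\<in>residues (degree D). H r)"
proof -
  let ?R = "residues (degree D)" and ?F = "\<lambda>r. F r mod D"
  have "inj_on ?F ?R"
  proof (rule inj_onI)
    fix r s assume *: "r \<in> ?R" "s \<in> ?R" "F r mod D = F s mod D"
    then have "D dvd r - s"
      using assms(3) by (simp add: mod_eq_dvd_iff)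
    then show "r = s"
      using * residues_mod_eq[of r] residues_mod_eq[of s] by (simp flip: mod_eq_dvd_iff)
  qed
  moreover have "?F ` ?R \<subseteq> ?R"
    using mod_in_residues[OF assms(1)] by auto
  ultimately have "bij_betw ?F ?R ?R"
    by (simp add: bij_betw_def endo_inj_surj)
  then have "(\<Sum>r\<in>?R. H (F r mod D)) = (\<Sum>r\<in>?R. H r)"
    by (rule sum.reindex_bij_betw)
  then show ?thesis
    by (simp add: periodic_mod[OF assms(2)])
qed

lemma residue_sum_shift:
  assumes "D \<noteq> 0" "periodic D H"
  shows "(\<Sum>r\<in>residues (degree D). H (r + c)) = (\<Sum>r\<in>residues (degree D). H r)"
  using assms by (rule residue_sum_reindex) simp

text \<open>The usual vanishing argument for character sums: multiplication by the unit
  \<open>u\<close> permutes the residues, so the sum equals \<open>\<zeta>\<close> times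
  itself.\<close>

lemma residue_sum_eq_0:
  fixes H :: "'a::{field,finite} poly \<Rightarrow> complex"
  assumes "D \<noteq> 0" "periodic D H" "coprime u D" "\<And>r. H (u * r) = \<zeta> * H r" "\<zeta> \<noteq> 1"
  shows "(\<Sum>r\<in>residues (degree D). H r) = 0"
proof -
  have "(\<Sum>r\<in>residues (degree D). H (u * r)) = (\<Sum>r\<in>residues (degree D). H r)"
  proof (rule residue_sum_reindex[OF assms(1,2)])
    fix r s assume "D dvd u * r - u * s"
    then have "D dvd u * (r - s)"
      by (simp add: algebra_simps)
    then show "D dvd r - s"
      using assms(3) poly_coprime_dvd_mult coprime_commute by blast
  qed
  then have "\<zeta> * (\<Sum>r\<in>residues (degree D). H r) = (\<Sum>r\<in>residues (degree D). H r)"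
    by (simp add: assms(4) sum_distrib_left)
  then show ?thesis
    using assms(5) by simp
qed

text \<open>The Chinese remainder theorem in counted form: reduction modulo \<open>A\<close> and
  \<open>B\<close> is injective by coprimality, and both sides have the same cardinality.\<close>

lemma residue_sum_mult:
  fixes H K :: "'a::{field,finite} poly \<Rightarrow> 'b::comm_semiring_1"
  assumes "A \<noteq> 0" "B \<noteq> 0" "coprime A B" "periodic A H" "periodic B K"
  shows "(\<Sum>r\<in>residues (degree (A * B)). H r * K r) =
    (\<Sum>r\<in>residues (degree A). H r) * (\<Sum>r\<in>residues (degree B). K r)"
proof -
  let ?F = "\<lambda>r. (r mod A, r mod B)"
  have "inj_on ?F (residues (degree (A * B)))"
  proof (rule inj_onI)
    fix r s assume *: "r \<in> residues (degree (A * B))" "s \<in> residues (degree (A * B))" "?F r = ?F s"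
    then have "A dvd r - s" "B dvd r - s"
      by (simp_all add: mod_eq_dvd_iff)
    then have "A * B dvd r - s"
      using assms poly_divides_mult by blast
    then show "r = s"
      using * residues_mod_eq[of r] residues_mod_eq[of s] by (simp flip: mod_eq_dvd_iff)
  qed
  moreover have sub: "?F ` residues (degree (A * B)) \<subseteq> residues (degree A) \<times> residues (degree B)"
    using mod_in_residues assms by auto
  moreover from calculation have "?F ` residues (degree (A * B)) = residues (degree A) \<times> residues (degree B)"
    using assms
    by (intro card_subset_eq)
      (simp_all add: card_image card_residues card_cartesian_product degree_mult_eq power_add)
  ultimately have "bij_betw ?F (residues (degree (A * B))) (residues (degree A) \<times> residues (degree B))"
    unfolding bij_betw_def by blast
  then have "(\<Sum>r\<in>residues (degree (A * B)). (\<lambda>(x, y). H x * K y) (?F r)) =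
      (\<Sum>(x, y)\<in>residues (degree A) \<times> residues (degree B). H x * K y)"
    by (rule sum.reindex_bij_betw)
  then show ?thesis
    by (simp add: periodic_mod assms sum_product sum.cartesian_product)
qed

subsection \<open>Primitive characters\<close>

lemma residue_sum_delta:
  fixes H :: "'a::{field,finite} poly \<Rightarrow> complex"
  assumes "D \<noteq> 0"
  shows "(\<Sum>s\<in>residues (degree D). of_bool (D dvd s - r) * H s) = H (r mod D)"
proof -
  have eq: "D dvd s - r \<longleftrightarrow> s = r mod D" if "s \<in> residues (degree D)" for s
    using residues_mod_eq[OF that] by (simp flip: mod_eq_dvd_iff)
  have "(\<Sum>s\<in>residues (degree D). of_bool (D dvd s - r) * H s) = (\<Sum>s\<in>residues (degree D). if s = r mod D then H s else 0)"
    by (intro sum.cong) (auto simp: eq)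
  then show ?thesis
    using mod_in_residues[OF assms] by (simp add: sum.delta)
qed

locale primitive_char =
  fixes Q :: "'a::{field,finite} poly" and chi :: "'a poly \<Rightarrow> complex"
  assumes Q_monic: "Q \<in> monics" and primitive: "primitive_character Q chi"
begin

definition QP :: "'a poly set" where
  "QP = {P \<in> monic_irreds. P dvd Q}"

lemma Q_nonzero: "Q \<noteq> 0"
  using Q_monic monics_nonzero by blast

lemma finite_QP [simp]: "finite QP"
  unfolding QP_def by (rule finite_monic_irred_divisors[OF Q_nonzero])

lemma QP_irreds: "QP \<subseteq> monic_irreds"
  by (auto simp: QP_def)

lemma coprime_Q_iff: "coprime f Q \<longleftrightarrow> (\<forall>P\<in>QP. \<not> P dvd f)"
  using coprime_iff_no_monic_irred[OF Q_nonzero] by (auto simp: QP_def)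

lemma chi_nonzero_iff: "chi f \<noteq> 0 \<longleftrightarrow> coprime f Q"
  and chi_mult: "chi (f * g) = chi f * chi g"
  and chi_cong: "Q dvd f - g \<Longrightarrow> chi f = chi g"
  using primitive unfolding primitive_character_def dirichlet_character_def
  by (auto simp: cong_iff_dvd_diff)

lemma periodic_chi: "periodic Q chi"
  by (rule periodicI) (rule chi_cong)

lemma chi_1 [simp]: "chi 1 = 1"
  using chi_mult[of 1 1] chi_nonzero_iff[of 1] by simp

lemma chi_power: "chi (f ^ k) = chi f ^ k"
  by (induction k) (simp_all add: chi_mult)

text \<open>The definition of a character only asks for nonzero values on units. Since there are
  finitely many residues, two powers of \<open>f\<close> agree modulo \<open>Q\<close>, and so a
  positive power of \<open>norm (chi f)\<close> is 1.\<close>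

lemma norm_chi:
  assumes "coprime f Q"
  shows "norm (chi f) = 1"
proof -
  have "\<not> inj_on (\<lambda>k :: nat. f ^ k mod Q) UNIV"
  proof
    assume "inj_on (\<lambda>k :: nat. f ^ k mod Q) UNIV"
    moreover have "finite (range (\<lambda>k :: nat. f ^ k mod Q))"
      using mod_in_residues[OF Q_nonzero] by (intro finite_subset[OF _ finite_residues]) auto
    ultimately show False
      using finite_imageD by blast
  qed
  then obtain i j :: nat where ij: "i < j" "f ^ i mod Q = f ^ j mod Q"
    unfolding inj_on_def by (metis linorder_neqE_nat)
  then have "chi f ^ i = chi f ^ j"
    by (metis chi_cong chi_power mod_eq_dvd_iff)
  then have "norm (chi f) ^ i * 1 = norm (chi f) ^ i * norm (chi f) ^ (j - i)"
    using ij by (metis norm_power power_add less_imp_le le_add_diff_inverse mult_1_right)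
  moreover have "norm (chi f) > 0"
    using assms chi_nonzero_iff by simp
  ultimately have "norm (chi f) ^ (j - i) = 1"
    by simp
  then show ?thesis
    using ij power_eq_1_iff[of "norm (chi f)" "j - i"] by auto
qed

lemma norm_chi_le: "norm (chi f) \<le> 1"
  using norm_chi[of f] chi_nonzero_iff[of f] by (cases "coprime f Q") auto

lemma unit_inverse:
  assumes "coprime f Q"
  obtains s where "Q dvd s * f - 1" "coprime s Q"
proof -
  obtain s t where st: "s * f + t * Q = 1"
    using assms by (rule poly_bezout)
  then have "s * f - 1 = Q * (- t)"
    by (simp add: algebra_simps)
  then have "Q dvd s * f - 1"
    by (rule dvdI)
  moreover have "coprime s Q"
    using bezout_imp_coprime[of f s t Q] st by (simp add: mult.commute)
  ultimately show ?thesis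
    using that by simp
qed

text \<open>Otherwise \<open>chi\<close>, on units modulo \<open>Q\<close>, would depend only on the
  class modulo \<open>D\<close> and would be induced by a character modulo \<open>D\<close>; the
  proof builds that character as \<open>chi'\<close>.\<close>

lemma primitive_witness:
  assumes "D \<in> monics" "D dvd Q" "D \<noteq> Q"
  obtains u where "coprime u Q" "D dvd u - 1" "chi u \<noteq> 1"
proof (rule ccontr)
  assume "\<not> thesis"
  then have triv: "chi u = 1" if "coprime u Q" "D dvd u - 1" for u
    using that \<open>\<And>u. coprime u Q \<Longrightarrow> D dvd u - 1 \<Longrightarrow> chi u \<noteq> 1 \<Longrightarrow> thesis\<close> by blast
  \<comment> \<open>Division by \<open>g\<close>: with \<open>s\<close> inverse to \<open>g\<close>
    modulo \<open>Q\<close>, the unit \<open>s * f\<close> is congruent to 1 modulo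
    \<open>D\<close>, and \<open>triv\<close> applies to it.\<close>
  have step: "chi f = chi g" if fg: "coprime f Q" "coprime g Q" "D dvd f - g" for f g
  proof -
    obtain s where s: "Q dvd s * g - 1" "coprime s Q"
      using fg(2) by (rule unit_inverse)
    have "s * f - 1 = s * (f - g) + (s * g - 1)"
      by (simp add: algebra_simps)
    moreover have "D dvd s * (f - g) + (s * g - 1)"
      using fg(3) s(1) assms(2) by (meson dvd_add dvd_mult dvd_trans)
    ultimately have "D dvd s * f - 1"
      by (simp only:)
    then have "chi (s * f) = 1"
      using fg s by (intro triv) (simp_all add: poly_coprime_mult_left)
    moreover have "chi (s * g) = 1"
      using chi_cong[OF s(1)] by simp
    ultimately show ?thesis
      using s(2) chi_nonzero_iff by (simp add: chi_mult)
        (metis mult_cancel_left)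
  qed
  have lift: "\<exists>g. coprime g Q \<and> D dvd g - f" if f: "coprime f D" for f
  proof -
    \<comment> \<open>With this \<open>t\<close>, each prime of \<open>Q\<close> divides exactly one
      of \<open>f\<close> and \<open>t * D\<close>, hence not their sum.\<close>
    define t where "t = \<Prod>{P \<in> QP. \<not> P dvd f}"
    have "\<not> P dvd f + t * D" if P: "P \<in> QP" for P
    proof (cases "P dvd f")
      case True
      have irr: "P \<in> monic_irreds"
        using P QP_irreds by auto
      have "\<not> P dvd D"
        using f True irr by (meson coprime_common_divisor monic_irreds_not_unit)
      moreover have "\<not> P dvd t"
        unfolding coprime_monic_irred_iff[OF irr, symmetric] t_def
        using irr True QP_irreds by (intro poly_coprime_prod_right coprime_monic_irreds) auto
      ultimately have "\<not> P dvd t * D"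
        by (simp add: monic_irred_dvd_mult_iff[OF irr])
      then show ?thesis
        using True by (simp add: dvd_add_right_iff)
    next
      case False
      then have "P dvd t"
        unfolding t_def using P by (intro dvd_prodI) auto
      then show ?thesis
        using False by (simp add: dvd_add_left_iff)
    qed
    then have "coprime (f + t * D) Q"
      by (simp add: coprime_Q_iff)
    then show ?thesis
      by (intro exI[of _ "f + t * D"]) simp
  qed
  \<comment> \<open>Every class prime to \<open>D\<close> is represented by a unit modulo
    \<open>Q\<close>; by \<open>step\<close> the value of \<open>chi\<close> does not depend on the
    representative.\<close>
  define rep where "rep f = (SOME g. coprime g Q \<and> D dvd g - f)" for f
  have rep: "coprime (rep f) Q" "D dvd rep f - f" if "coprime f D" for f
    using someI_ex[OF lift[OF that]] by (auto simp: rep_def)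
  define chi' where "chi' f = (if coprime f D then chi (rep f) else 0)" for f
  have chi'_eq: "chi' f = chi g" if "coprime g Q" "D dvd f - g" "coprime f D" for f g
  proof -
    have "rep f - g = (rep f - f) + (f - g)"
      by simp
    moreover have "D dvd (rep f - f) + (f - g)"
      using rep(2)[OF that(3)] that(2) by (rule dvd_add)
    ultimately have "D dvd rep f - g"
      by simp
    then show ?thesis
      using step[OF rep(1)[OF that(3)] that(1)] that(3) by (simp add: chi'_def)
  qed
  have "dirichlet_character D chi'"
    unfolding dirichlet_character_def
  proof (intro conjI allI impI)
    show "chi' f \<noteq> 0 \<longleftrightarrow> coprime f D" for f
      using rep chi_nonzero_iff by (auto simp: chi'_def)
    show "chi' (f * g) = chi' f * chi' g" for f g
    proof (cases "coprime f D \<and> coprime g D")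
      case True
      have "f * g - rep f * rep g = - ((rep f - f) * rep g + f * (rep g - g))"
        by (simp add: algebra_simps)
      moreover have "D dvd - ((rep f - f) * rep g + f * (rep g - g))"
        using True rep by (metis dvd_add dvd_minus_iff dvd_mult dvd_mult2)
      ultimately have "chi' (f * g) = chi (rep f * rep g)"
        using True rep by (intro chi'_eq) (simp_all add: poly_coprime_mult_left)
      then show ?thesis
        using True by (simp add: chi'_def chi_mult)
    next
      case False
      then show ?thesis
        by (auto simp: chi'_def poly_coprime_mult_left)
    qed
    show "chi' f = chi' g" if "[f = g] (mod D)" for f g
    proof (cases "coprime f D")
      case True
      then have g: "coprime g D"
        using that coprime_cong_cong_left by blast
      have "f - rep g = (f - g) - (rep g - g)"
        by simp
      moreover have "D dvd (f - g) - (rep g - g)"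
        using that rep(2)[OF g] dvd_diff[of D "f - g" "rep g - g"] by (simp only: cong_iff_dvd_diff)
      ultimately have "chi' f = chi (rep g)"
        using True rep(1)[OF g] by (intro chi'_eq) simp_all
      then show ?thesis
        using g by (simp add: chi'_def)
    next
      case False
      then show ?thesis
        using that coprime_cong_cong_left by (auto simp: chi'_def)
    qed
  qed
  moreover have "chi f = chi' f" if "coprime f Q" for f
  proof -
    have "coprime f D"
      using that assms(2) by (meson coprime_divisors dvd_refl)
    then show ?thesis
      using chi'_eq[of f f] that by simp
  qed
  ultimately show False
    using primitive assms unfolding primitive_character_def by blast
qed

lemma chi_inverse:
  assumes "Q dvd s * t - 1" "coprime s Q"
  shows "cnj (chi s) = chi t"
proof -
  have "chi s * chi t = 1"
    using chi_cong[OF assms(1)] by (simp add: chi_mult)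
  moreover have "chi s * cnj (chi s) = 1"
    using norm_chi[OF assms(2)] by (simp flip: complex_norm_square)
  ultimately show ?thesis
    using assms(2) chi_nonzero_iff by (metis mult_cancel_left)
qed

text \<open>The source of \<open>pmoebius Q\<close>: among the products of distinct primes of
  \<open>Q\<close> only the full one can be \<open>Q\<close>, and only for squarefree
  \<open>Q\<close>.\<close>

lemma prod_QP_subset_eq_Q_iff:
  assumes "X \<subseteq> QP"
  shows "\<Prod>X = Q \<longleftrightarrow> squarefree Q \<and> X = QP"
proof
  assume *: "\<Prod>X = Q"
  have not_dvd: "\<not> P dvd \<Prod>Y" if "Y \<subseteq> QP" "P \<in> QP" "P \<notin> Y" for P Y
    using that QP_irreds coprime_monic_irred_iff[of P] poly_coprime_prod_right[of Y P "\<lambda>x. x"] coprime_monic_irreds[of P]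
    by blast
  have X: "X = QP"
    using not_dvd[OF assms] assms * by (auto simp: QP_def)
  have "squarefree Q"
  proof (rule squarefreeI, rule ccontr)
    fix a assume a: "a ^ 2 dvd Q" "\<not> is_unit a"
    then have "a \<noteq> 0"
      using Q_nonzero by auto
    then obtain P where P: "P \<in> monic_irreds" "P dvd a"
      using a monic_irred_divisor_exists by blast
    then have "P ^ 2 dvd Q"
      using a by (meson dvd_power_same dvd_trans)
    then have PQ: "P \<in> QP" "P * P dvd Q"
      using P by (auto simp: QP_def power2_eq_square intro: dvd_mult_left)
    have "Q = P * \<Prod>(QP - {P})"
      using * X PQ by (metis finite_QP prod.remove)
    then have "P dvd \<Prod>(QP - {P})"
      using PQ(2) monic_irreds_nonzero[OF P(1)] by (metis dvd_mult_cancel_left)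
    then show False
      using not_dvd[of "QP - {P}" P] PQ by blast
  qed
  with X show "squarefree Q \<and> X = QP"
    by blast
next
  assume *: "squarefree Q \<and> X = QP"
  have dvd: "\<Prod>QP dvd Q"
    using QP_irreds finite_QP by (intro poly_prod_dvd coprime_monic_irreds) (auto simp: QP_def simp del: finite_QP)
  then obtain e where e: "Q = \<Prod>QP * e"
    by (elim dvdE)
  have "\<Prod>QP \<in> monics"
    by (intro monics_prod) (auto simp: QP_def)
  then have em: "e \<in> monics"
    using e Q_monic monics_cofactor[of "\<Prod>QP" e] by simp
  have "is_unit e"
  proof (rule ccontr)
    assume "\<not> is_unit e"
    then obtain P where P: "P \<in> monic_irreds" "P dvd e"
      using monic_irred_divisor_exists[of e] monics_nonzero[OF em] by auto
    then have "P \<in> QP"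
      using dvd_mult[OF P(2), of "\<Prod>QP"] unfolding e[symmetric] by (simp add: QP_def)
    then have "P dvd \<Prod>QP"
      using dvd_prodI[OF finite_QP, of P "\<lambda>x. x"] by simp
    then have "P ^ 2 dvd Q"
      using mult_dvd_mono[OF _ P(2), of P "\<Prod>QP"] unfolding e[symmetric] by (simp add: power2_eq_square)
    then show False
      using * squarefreeD[of Q P] monic_irreds_not_unit[OF P(1)] by simp
  qed
  then have "e = 1"
    using em monics_degree_0[OF em] is_unit_iff_degree[OF monics_nonzero[OF em]] by simp
  then show "\<Prod>X = Q"
    using e * by simp
qed

text \<open>Primitivity as a character sum: for proper \<open>D\<close>, multiplication by the unit
  of \<open>primitive_witness\<close> preserves the progression 1 modulo \<open>D\<close> and scales
  the sum by a number other than 1.\<close>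

lemma sum_chi_progression:
  assumes "D \<in> monics" "D dvd Q"
  shows "(\<Sum>v\<in>residues (degree Q). of_bool (D dvd v - 1) * cnj (chi v)) = of_bool (D = Q)"
proof (cases "D = Q")
  case True
  then show ?thesis
    using residue_sum_delta[OF Q_nonzero, of 1 "\<lambda>v. cnj (chi v)"] periodic_mod[OF periodic_chi, of 1] by simp
next
  case False
  obtain u where u: "coprime u Q" "D dvd u - 1" "chi u \<noteq> 1"
    using primitive_witness[OF assms False] .
  have "(\<Sum>v\<in>residues (degree Q). of_bool (D dvd v - 1) * cnj (chi v)) = 0"
  proof (rule residue_sum_eq_0[OF Q_nonzero _ u(1)])
    show "periodic Q (\<lambda>v. of_bool (D dvd v - 1) * cnj (chi v))"
      using periodic_chi
      by (intro periodic_mult periodic_dvd[OF periodic_of_bool_dvd assms(2)]) (simp add: periodic_def)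
    fix r
    have "u * r - 1 = (u - 1) * r + (r - 1)"
      by (simp add: algebra_simps)
    moreover have "D dvd (u - 1) * r + (r - 1) \<longleftrightarrow> D dvd r - 1"
      using u(2) by (intro dvd_add_right_iff) simp
    ultimately have "D dvd u * r - 1 \<longleftrightarrow> D dvd r - 1"
      by (simp only:)
    then show "of_bool (D dvd u * r - 1) * cnj (chi (u * r)) = cnj (chi u) * (of_bool (D dvd r - 1) * cnj (chi r))"
      by (simp add: chi_mult)
    show "cnj (chi u) \<noteq> 1"
      using u(3) by simp
  qed
  then show ?thesis
    using False by simp
qed

text \<open>
  On units, \<open>t \<mapsto> 1 / t\<close> turns \<open>chi t * cnj (chi (t + 1))\<close> into \<open>cnj (chi (t + 1))\<close>; the condition that \<open>t\<close>
  is a unit is then resolved by inclusion and exclusion.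
\<close>

lemma sum_chi_cnj_chi_succ:
  "(\<Sum>t\<in>residues (degree Q). chi t * cnj (chi (t + 1))) = of_real (pmoebius Q)"
proof -
  let ?R = "residues (degree Q)"
  let ?U = "{t \<in> ?R. coprime t Q}"
  \<comment> \<open>Choosing the inverse within the residues makes it unique, so \<open>iv\<close>
    is an involution of \<open>?U\<close> and serves as both witnesses of the reindexing.\<close>
  define iv where "iv t = (SOME s. s \<in> ?R \<and> Q dvd s * t - 1)" for t
  have iv: "iv t \<in> ?R" "Q dvd iv t * t - 1" "coprime (iv t) Q" if "t \<in> ?U" for t
  proof -
    have "coprime t Q"
      using that by simp
    then obtain s where s: "Q dvd s * t - 1" "coprime s Q"
      by (rule unit_inverse)
    have "Q dvd (s mod Q) * t - 1"
      using s(1) by (metis mod_eq_dvd_iff mod_mult_left_eq)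
    then have "\<exists>s. s \<in> ?R \<and> Q dvd s * t - 1"
      using mod_in_residues[OF Q_nonzero] by blast
    from someI_ex[OF this] show *: "iv t \<in> ?R" "Q dvd iv t * t - 1"
      by (auto simp: iv_def)
    then have "chi (iv t) * chi t = 1"
      using chi_cong[OF *(2)] by (simp add: chi_mult)
    then show "coprime (iv t) Q"
      using chi_nonzero_iff by (metis mult_zero_left zero_neq_one)
  qed
  have iv_iv: "iv (iv t) = t" if t: "t \<in> ?U" for t
  proof -
    have t': "iv t \<in> ?U"
      using iv[OF t] by simp
    have "t - iv (iv t) = t * - (iv (iv t) * iv t - 1) + iv (iv t) * (iv t * t - 1)"
      by (simp add: algebra_simps)
    moreover have "Q dvd t * - (iv (iv t) * iv t - 1) + iv (iv t) * (iv t * t - 1)"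
      using iv(2)[OF t] iv(2)[OF t'] by (intro dvd_add dvd_mult) (simp_all only: dvd_minus_iff)
    ultimately have "Q dvd t - iv (iv t)"
      by simp
    then show ?thesis
      using t iv(1)[OF t'] residues_mod_eq[of t Q] residues_mod_eq[of "iv (iv t)" Q]
      by (simp flip: mod_eq_dvd_iff)
  qed
  have "(\<Sum>t\<in>?R. chi t * cnj (chi (t + 1))) = (\<Sum>t\<in>?U. chi t * cnj (chi (t + 1)))"
    using chi_nonzero_iff by (intro sum.mono_neutral_right) auto
  also have "\<dots> = (\<Sum>s\<in>?U. cnj (chi (s + 1)))"
  proof (rule sum.reindex_bij_witness[where i = iv and j = iv])
    show "iv t \<in> ?U" "iv (iv t) = t" if "t \<in> ?U" for t
      using that iv iv_iv by auto
    then show "iv t \<in> ?U" "iv (iv t) = t" if "t \<in> ?U" for t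
      using that by auto
    fix t assume t: "t \<in> ?U"
    have "(iv t + 1) - iv t * (t + 1) = - (iv t * t - 1)"
      by (simp add: algebra_simps)
    then have "chi (iv t + 1) = chi (iv t) * chi (t + 1)"
      using iv(2)[OF t] chi_cong[of "iv t + 1" "iv t * (t + 1)"] by (simp only: dvd_minus_iff chi_mult)
    then show "cnj (chi (iv t + 1)) = chi t * cnj (chi (t + 1))"
      using chi_inverse iv[OF t] by simp
  qed
  also have "\<dots> = (\<Sum>s\<in>?R. of_bool (coprime s Q) * cnj (chi (s + 1)))"
    by (intro sum.mono_neutral_cong_left) auto
  also have "\<dots> = (\<Sum>s\<in>?R. (\<lambda>v. of_bool (coprime (v - 1) Q) * cnj (chi v)) (s + 1))"
    by simp
  also have "\<dots> = (\<Sum>v\<in>?R. of_bool (coprime (v - 1) Q) * cnj (chi v))"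
  proof (rule residue_sum_shift[OF Q_nonzero], rule periodicI)
    fix f g assume *: "Q dvd g - f"
    then have "coprime (g - 1) Q \<longleftrightarrow> coprime (f - 1) Q"
      by (intro coprime_cong_cong_left) (simp add: cong_iff_dvd_diff)
    then show "of_bool (coprime (g - 1) Q) * cnj (chi g) = of_bool (coprime (f - 1) Q) * cnj (chi f)"
      using chi_cong[OF *] by simp
  qed
  also have "\<dots> = (\<Sum>v\<in>?R. \<Sum>X\<in>Pow QP. (- 1) ^ card X * (of_bool (\<Prod>X dvd v - 1) * cnj (chi v)))"
  proof (rule sum.cong[OF refl])
    fix v
    have fin: "finite X" if "X \<in> Pow QP" for X
      using that finite_subset[OF _ finite_QP] by simp
    have *: "(\<Prod>P\<in>X. - of_bool (P dvd v - 1)) = (- 1) ^ card X * (of_bool (\<Prod>X dvd v - 1) :: complex)"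
      if X: "X \<in> Pow QP" for X
    proof (cases "\<forall>P\<in>X. P dvd v - 1")
      case True
      then have "\<Prod>X dvd v - 1"
        using X QP_irreds fin[OF X] by (intro poly_prod_dvd coprime_monic_irreds) auto
      then show ?thesis
        using True by simp
    next
      case False
      then have "\<not> \<Prod>X dvd v - 1"
        using fin[OF X] by (meson dvd_prodI dvd_trans)
      moreover have "(\<Prod>P\<in>X. - of_bool (P dvd v - 1)) = (0 :: complex)"
        using False fin[OF X] by auto
      ultimately show ?thesis
        by simp
    qed
    \<comment> \<open>Coprimality to \<open>Q\<close> is the product of 1 - [P divides v - 1] over
      the primes P of \<open>Q\<close>; expanding it gives the sum over subsets.\<close>
    have "of_bool (coprime (v - 1) Q) = (\<Prod>P\<in>QP. - of_bool (P dvd v - 1) + (1 :: complex))"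
      by (auto simp: coprime_Q_iff)
    also have "\<dots> = (\<Sum>X\<in>Pow QP. (\<Prod>P\<in>X. - of_bool (P dvd v - 1)))"
      by (subst prod_add) simp_all
    also have "\<dots> = (\<Sum>X\<in>Pow QP. (- 1) ^ card X * of_bool (\<Prod>X dvd v - 1))"
      by (rule sum.cong[OF refl *])
    finally show "of_bool (coprime (v - 1) Q) * cnj (chi v) =
        (\<Sum>X\<in>Pow QP. (- 1) ^ card X * (of_bool (\<Prod>X dvd v - 1) * cnj (chi v)))"
      by (simp only: sum_distrib_right mult.assoc)
  qed
  also have "\<dots> = (\<Sum>X\<in>Pow QP. (- 1) ^ card X * (\<Sum>v\<in>?R. of_bool (\<Prod>X dvd v - 1) * cnj (chi v)))"
    by (subst sum.swap) (simp only: sum_distrib_left)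
  also have "\<dots> = (\<Sum>X\<in>Pow QP. (- 1) ^ card X * of_bool (\<Prod>X = Q))"
  proof (intro sum.cong refl arg_cong2[of _ _ _ _ "(*)"] sum_chi_progression)
    fix X assume X: "X \<in> Pow QP"
    show "\<Prod>X \<in> monics"
      using X by (intro monics_prod) (auto simp: QP_def)
    show "\<Prod>X dvd Q"
      using X QP_irreds finite_subset[OF _ finite_QP, of X]
      by (intro poly_prod_dvd coprime_monic_irreds) (auto simp: QP_def)
  qed
  also have "\<dots> = (\<Sum>X\<in>Pow QP. if X = QP then (- 1) ^ card X * of_bool (squarefree Q) else 0)"
    using prod_QP_subset_eq_Q_iff by (intro sum.cong) auto
  also have "\<dots> = (- 1) ^ card QP * of_bool (squarefree Q)"
    by (subst sum.delta) auto
  also have "\<dots> = of_real (pmoebius Q)"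
    by (simp add: pmoebius_def QP_def)
  finally show ?thesis .
qed

end

subsection \<open>Correlations at the primes dividing the conductor\<close>

text \<open>
  The progressions modulo \<open>D\<close> leave room to multiply \<open>H\<close> by functions of the valuations at further primes,
  which are sums of indicators of such progressions.
\<close>

definition equid :: "'a::{field,finite} poly set \<Rightarrow> ('a poly \<Rightarrow> complex) \<Rightarrow> complex \<Rightarrow> bool" where
  "equid S H m \<longleftrightarrow> (\<forall>D\<in>monics. (\<forall>P\<in>S. \<not> P dvd D) \<longrightarrow>
     (\<forall>r. (\<lambda>n. avg n (\<lambda>f. H f * of_bool (D dvd f - r))) \<longlonglongrightarrow> m / of_real (pnorm D)))"

lemma avg_shift_minus:
  fixes H :: "'a::{field,finite} poly \<Rightarrow> 'b::real_normed_field"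
  assumes "n \<ge> 1"
  shows "avg n (\<lambda>f. H (f - 1)) = avg n H"
  using avg_shift[OF assms, of "\<lambda>f. H (f - 1)"] by simp

lemma norm_mult_le_1: "norm a \<le> 1 \<Longrightarrow> norm b \<le> 1 \<Longrightarrow> norm (a * b :: 'a::real_normed_div_algebra) \<le> 1"
  by (simp add: norm_mult mult_le_one)

locale multiplicative_with_char = primitive_char Q chi
  for Q :: "'a::{field,finite} poly" and chi :: "'a poly \<Rightarrow> complex" +
  fixes \<psi> :: "'a poly \<Rightarrow> complex"
  assumes psi_mult: "multiplicative \<psi>" and psi_bound: "f \<in> monics \<Longrightarrow> norm (\<psi> f) \<le> 1"
begin

text \<open>Keeps \<open>\<psi>\<close> on the part of \<open>f\<close> composed of primes of
  \<open>Q\<close>, where \<open>chi\<close> vanishes, and replaces it by \<open>chi\<close> on the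
  cofactor, which is prime to \<open>Q\<close> for nonzero \<open>f\<close>.\<close>

definition Psi :: "'a poly \<Rightarrow> complex" where
  "Psi f = \<psi> (ppart QP f) * chi (f div ppart QP f)"

lemma norm_Psi_le: "norm (Psi f) \<le> 1"
  unfolding Psi_def using psi_bound[OF ppart_monic[OF QP_irreds]] norm_chi_le
  by (intro norm_mult_le_1) auto

text \<open>The modulus fixes the valuations at the primes of \<open>Q\<close> and, after division
  by \<open>ppart QP f\<close>, still fixes the cofactor modulo \<open>Q\<close>. As it depends on
  \<open>f\<close>, it yields no common period; this is the reason for the truncation below.\<close>

lemma Psi_cong:
  assumes "f \<noteq> 0" "ppart QP f * Q dvd g - f"
  shows "Psi g = Psi f" "ppart QP g = ppart QP f"
proof -
  have "pval P g = pval P f" if P: "P \<in> QP" for P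
  proof (rule pval_cong[OF _ assms(1)])
    show "P \<in> monic_irreds"
      using P QP_irreds by auto
    have "P ^ pval P f dvd ppart QP f"
      unfolding ppart_def using dvd_prodI[OF finite_QP P, of "\<lambda>P. P ^ pval P f"] by simp
    moreover have "P dvd Q"
      using P by (simp add: QP_def)
    ultimately have "P ^ pval P f * P dvd ppart QP f * Q"
      by (rule mult_dvd_mono)
    then show "P ^ Suc (pval P f) dvd g - f"
      using assms(2) by (metis dvd_trans power_Suc2)
  qed
  then show eq: "ppart QP g = ppart QP f"
    unfolding ppart_def by (intro prod.cong) auto
  let ?a = "ppart QP f"
  have a: "?a dvd f" "?a \<noteq> 0"
    using ppart_dvd[OF finite_QP QP_irreds assms(1)] ppart_monic[OF QP_irreds] monics_nonzero by auto
  obtain h where h: "g - f = ?a * Q * h"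
    using assms(2) by (elim dvdE)
  have "g = ?a * (Q * h + f div ?a)"
    using a h by (simp add: algebra_simps)
  then have "g div ?a = Q * h + f div ?a"
    using a(2) by (metis nonzero_mult_div_cancel_left)
  then have "chi (g div ?a) = chi (f div ?a)"
    by (intro chi_cong) simp
  then show "Psi g = Psi f"
    by (simp add: Psi_def eq)
qed

lemma ppart_coprime_Q:
  assumes "coprime f Q"
  shows "ppart QP f = 1"
  unfolding ppart_def
proof (intro prod.neutral ballI)
  fix P assume P: "P \<in> QP"
  then have "\<not> P dvd f" "P \<in> monic_irreds"
    using assms coprime_Q_iff QP_irreds by auto
  then have "pval P f = 0"
    by (metis dvd_0_right pval_eq_0_iff)
  then show "P ^ pval P f = 1"
    by simp
qed

lemma Psi_coprime_Q: "coprime f Q \<Longrightarrow> Psi f = chi f"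
  using psi_mult by (simp add: Psi_def ppart_coprime_Q multiplicative_def)

lemma Psi_mult_unit:
  assumes "coprime u Q" "u \<noteq> 0" "f \<noteq> 0"
  shows "Psi (u * f) = chi u * Psi f" "ppart QP (u * f) = ppart QP f"
proof -
  have "pval P (u * f) = pval P f" if P: "P \<in> QP" for P
  proof -
    have "P \<in> monic_irreds" "\<not> P dvd u"
      using P assms QP_irreds coprime_Q_iff by auto
    then show ?thesis
      using assms pval_mult[of P u f] pval_eq_0_iff[of P u] by simp
  qed
  then show eq: "ppart QP (u * f) = ppart QP f"
    unfolding ppart_def by (intro prod.cong) auto
  have "(u * f) div ppart QP f = u * (f div ppart QP f)"
    using ppart_dvd[OF finite_QP QP_irreds assms(3)] by (simp add: div_mult_swap)
  then show "Psi (u * f) = chi u * Psi f"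
    by (simp add: Psi_def eq chi_mult)
qed

text \<open>For \<open>Q = P ^ Suc k * R\<close>, primitivity gives a witness \<open>u0\<close> for
  the proper divisor \<open>P ^ k * R\<close>. The Chinese remainder theorem replaces it by a
  \<open>u\<close> equal to \<open>u0\<close> modulo \<open>P ^ Suc k\<close> and to 1 modulo
  \<open>R ^ K * D\<close>. As \<open>R dvd u0 - 1\<close>, the class modulo \<open>Q\<close>, and
  with it the value of \<open>chi\<close>, is unchanged.\<close>

lemma twist_exists:
  assumes P: "P \<in> QP" and D: "D \<in> monics" "coprime Q D" and K: "K \<ge> 1"
  obtains k R u where "Q = P ^ Suc k * R" "\<not> P dvd R" "coprime u (Q ^ K * D)" "chi u \<noteq> 1"
    "P ^ k * R ^ K * D dvd u - 1"
proof -
  have irr: "P \<in> monic_irreds" and PQ: "P dvd Q"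
    using P by (auto simp: QP_def)
  obtain R where R: "Q = P ^ pval P Q * R" "\<not> P dvd R"
    using pval_decompose[OF irr Q_nonzero] .
  have "pval P Q \<noteq> 0"
    using PQ pval_eq_0_iff[OF irr Q_nonzero] by simp
  then obtain k where k: "pval P Q = Suc k"
    using not0_implies_Suc by blast
  have Q: "Q = P ^ Suc k * R"
    using R k by simp
  have Rm: "R \<in> monics"
    using Q Q_monic irr by (metis monics_cofactor monics_power monic_irreds_monic)
  have "P ^ k * R \<noteq> Q"
  proof
    assume "P ^ k * R = Q"
    then have "P ^ k * R = P * (P ^ k * R)"
      using Q by (simp add: mult.assoc)
    moreover have "P ^ k * R \<noteq> 0"
      using Rm irr monic_irreds_nonzero monics_nonzero by auto
    ultimately have "P = 1"
      by (metis mult_cancel_right1)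
    then show False
      using irr monic_irreds_not_unit by force
  qed
  moreover have "P ^ k * R \<in> monics" "P ^ k * R dvd Q"
    using irr Rm Q by (auto intro!: monics_mult monics_power)
  ultimately obtain u0 where u0: "coprime u0 Q" "P ^ k * R dvd u0 - 1" "chi u0 \<noteq> 1"
    using primitive_witness by metis
  have PR: "coprime P R"
    using R(2) coprime_monic_irred_iff[OF irr] by simp
  have PD: "coprime P D" "coprime R D"
    using D(2) Q by (simp_all add: poly_coprime_mult_left)
  have "coprime (P ^ Suc k) (R ^ K * D)"
    using PR PD by (intro poly_coprime_power_left) (simp add: poly_coprime_mult_right poly_coprime_power_right)
  then obtain u where u: "P ^ Suc k dvd u - u0" "R ^ K * D dvd u - 1"
    by (rule poly_chinese_remainder)
  have RK: "R dvd R ^ K"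
    using K by (intro dvd_power) auto
  have RD: "R dvd u - 1" "D dvd u - 1"
    using dvd_trans[OF RK dvd_mult_left[OF u(2)]] dvd_mult_right[OF u(2)] by auto
  have "R dvd u0 - 1"
    using u0(2) by (rule dvd_mult_right)
  then have "R dvd u - u0"
    using dvd_diff[OF RD(1), of "u0 - 1"] by simp
  then have Qu: "Q dvd u - u0"
    unfolding Q using u(1) PR by (intro poly_divides_mult poly_coprime_power_left)
  have "P ^ k dvd (u - u0) + (u0 - 1)"
    using dvd_trans[OF le_imp_power_dvd u(1)] dvd_mult_left[OF u0(2)] by (intro dvd_add) auto
  then have Pk: "P ^ k dvd u - 1"
    by simp
  have "coprime u Q"
    using Qu u0(1) coprime_cong_cong_left[of u u0 Q] by (simp add: cong_iff_dvd_diff)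
  moreover have "coprime u D"
    using RD(2) coprime_cong_cong_left[of u 1 D] by (simp add: cong_iff_dvd_diff)
  ultimately have "coprime u (Q ^ K * D)"
    by (simp add: poly_coprime_mult_right poly_coprime_power_right)
  moreover have "chi u \<noteq> 1"
    using chi_cong[OF Qu] u0(3) by simp
  moreover have "P ^ k * (R ^ K * D) dvd u - 1"
    using PR PD
    by (intro poly_divides_mult[OF _ Pk u(2)] poly_coprime_power_left)
      (simp add: poly_coprime_mult_right poly_coprime_power_right)
  ultimately show ?thesis
    using that[of k R u] Q R(2) by (simp add: mult.assoc)
qed

text \<open>Keeps the valuations at the primes of \<open>Q\<close> below \<open>K\<close>, so that
  \<open>ppart QP f * Q\<close> divides \<open>Q ^ K\<close> and \<open>Q ^ K\<close> is a modulus
  for \<open>Psi_cong\<close> at all nonzero truncated arguments.\<close>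

definition truncated :: "nat \<Rightarrow> 'a poly \<Rightarrow> bool" where
  "truncated K f \<longleftrightarrow> (\<forall>R\<in>QP. \<not> R ^ K dvd f)"

lemma truncated_pval_le:
  assumes "truncated K f" "f \<noteq> 0" "R \<in> QP"
  shows "pval R f \<le> K - 1"
proof -
  have "\<not> K \<le> pval R f"
    using assms pval_dvd_iff[of R f K] QP_irreds unfolding truncated_def by blast
  then show ?thesis
    by simp
qed

lemma truncated_ppart_dvd:
  assumes "truncated K f" "f \<noteq> 0" "K \<ge> 1"
  shows "ppart QP f * Q dvd Q ^ K"
proof -
  have "ppart QP f dvd Q ^ (K - 1)"
    unfolding ppart_def
  proof (rule poly_prod_dvd[OF finite_QP])
    fix R assume R: "R \<in> QP"
    then have "R ^ pval R f dvd R ^ (K - 1)"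
      using truncated_pval_le[OF assms(1,2)] by (intro le_imp_power_dvd) auto
    also have "\<dots> dvd Q ^ (K - 1)"
      using R by (intro dvd_power_same) (auto simp: QP_def)
    finally show "R ^ pval R f dvd Q ^ (K - 1)" .
  next
    fix R R' assume "R \<in> QP" "R' \<in> QP" "R \<noteq> R'"
    then show "coprime (R ^ pval R f) (R' ^ pval R' f)"
      using QP_irreds
      by (intro poly_coprime_power_left poly_coprime_power_right coprime_monic_irreds) auto
  qed
  then have "ppart QP f * Q dvd Q ^ (K - 1) * Q"
    by (rule mult_dvd_mono) simp
  then show ?thesis
    using assms(3) by (metis One_nat_def Suc_pred' less_eq_Suc_le power_Suc2)
qed

lemma dvd_power_cong:
  assumes "R \<in> QP" "Q ^ K dvd g - f"
  shows "R ^ K dvd g \<longleftrightarrow> R ^ K dvd f"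
proof -
  have "R ^ K dvd Q ^ K"
    using assms(1) by (intro dvd_power_same) (auto simp: QP_def)
  then have "R ^ K dvd g - f"
    using assms(2) dvd_trans by blast
  then have "R ^ K dvd (g - f) + f \<longleftrightarrow> R ^ K dvd f"
    by (rule dvd_add_right_iff)
  then show ?thesis
    by simp
qed

lemma truncated_cong: "Q ^ K dvd g - f \<Longrightarrow> truncated K g \<longleftrightarrow> truncated K f"
  unfolding truncated_def using dvd_power_cong by blast

lemma truncated_nonzero: "QP \<noteq> {} \<Longrightarrow> truncated K f \<Longrightarrow> f \<noteq> 0"
  unfolding truncated_def by auto

text \<open>
  For \<open>P dvd f\<close> the unit \<open>u\<close> of \<open>twist_exists\<close> makes \<open>u * f\<close> congruent to \<open>f\<close> modulo \<open>P ^ Suc k * R ^ K * D\<close>, so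
  passing from \<open>f\<close> to \<open>u * f\<close> changes only the factor \<open>Psi f\<close>, by \<open>chi u\<close>. The truncation makes everything periodic.
\<close>

lemma residue_sum_truncated_eq_0:
  assumes P: "P \<in> QP" and D: "D \<in> monics" "coprime Q D" and w: "periodic (Q * D) w"
    and K: "K \<ge> 1" and c: "is_unit c"
  defines "h \<equiv> \<lambda>f. Psi f * cnj (Psi (f + c)) * w f * of_bool (P dvd f)
     * of_bool (truncated K f \<and> truncated K (f + c))"
  shows "periodic (Q ^ K * D) h \<and> (\<Sum>r\<in>residues (degree (Q ^ K * D)). h r) = 0"
proof
  have ne: "QP \<noteq> {}"
    using P by auto
  have irr: "P \<in> monic_irreds" and PQ: "P dvd Q"
    using P by (auto simp: QP_def)
  have QK: "Q dvd Q ^ K"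
    using K by (intro dvd_power) auto
  show per: "periodic (Q ^ K * D) h"
  proof (rule periodicI)
    fix f g assume "Q ^ K * D dvd g - f"
    then have 1: "Q ^ K dvd g - f" "Q ^ K dvd (g + c) - (f + c)" "Q * D dvd g - f"
      using mult_dvd_mono[OF QK dvd_refl[of D]] by (auto dest: dvd_mult_left intro: dvd_trans)
    then have tr: "truncated K g \<longleftrightarrow> truncated K f" "truncated K (g + c) \<longleftrightarrow> truncated K (f + c)"
      by (auto simp only: truncated_cong)
    have "P dvd g - f"
      using 1(1) PQ QK by (meson dvd_trans)
    then have "P dvd (g - f) + f \<longleftrightarrow> P dvd f"
      by (rule dvd_add_right_iff)
    then have P: "P dvd g \<longleftrightarrow> P dvd f"
      by simp
    show "h g = h f"
    proof (cases "truncated K f \<and> truncated K (f + c)")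
      case True
      then have "f \<noteq> 0" "f + c \<noteq> 0"
        using truncated_nonzero[OF ne] by auto
      moreover have "ppart QP f * Q dvd g - f" "ppart QP (f + c) * Q dvd (g + c) - (f + c)"
        using True calculation truncated_ppart_dvd K dvd_trans[OF _ 1(1)] dvd_trans[OF _ 1(2)] by blast+
      ultimately have "Psi g = Psi f" "Psi (g + c) = Psi (f + c)"
        by (auto intro: Psi_cong)
      then show ?thesis
        using tr P periodicD[OF w 1(3)] by (simp add: h_def)
    next
      case False
      then show ?thesis
        using tr by (auto simp: h_def)
    qed
  qed
  obtain k R u where kRu: "Q = P ^ Suc k * R" "\<not> P dvd R" "coprime u (Q ^ K * D)" "chi u \<noteq> 1"
    "P ^ k * R ^ K * D dvd u - 1"
    using twist_exists[OF P D K] .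
  have uQ: "coprime u Q"
    using coprime_divisors[OF dvd_refl dvd_mult2[OF QK] kRu(3)] .
  have Pu: "\<not> R' dvd u" if "R' \<in> QP" for R'
    using uQ that coprime_Q_iff by blast
  have u0: "u \<noteq> 0"
    using Pu[OF P] by auto
  have Pc: "\<not> P dvd c"
    using c irr monic_irreds_not_unit dvd_trans by blast
  have nonzero: "Q ^ K * D \<noteq> 0"
    using Q_nonzero monics_nonzero[OF D(1)] by simp
  show "(\<Sum>r\<in>residues (degree (Q ^ K * D)). h r) = 0"
  proof (rule residue_sum_eq_0[OF nonzero per kRu(3) _ kRu(4)])
    fix f
    show "h (u * f) = chi u * h f"
    proof (cases "P dvd f")
      case False
      then show ?thesis
        using Pu[OF P] by (simp add: h_def monic_irred_dvd_mult_iff[OF irr])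
    next
      case True
      \<comment> \<open>At \<open>P\<close> the unit is known to be 1 only modulo
        \<open>P ^ k\<close>; the factor \<open>P\<close> of \<open>f\<close> supplies the missing
        power.\<close>
      have "u * f - f = (u - 1) * f"
        by (simp add: algebra_simps)
      moreover have "(P ^ k * R ^ K * D) * P dvd (u - 1) * f"
        using kRu(5) True by (rule mult_dvd_mono)
      ultimately have N: "P ^ Suc k * R ^ K * D dvd u * f - f"
        by (simp add: mult_ac)
      have N': "P ^ Suc k * R ^ K dvd (u * f + c) - (f + c)"
        using dvd_mult_left[OF N] by simp
      have tr1: "truncated K (u * f) \<longleftrightarrow> truncated K f"
      proof -
        have "R' ^ K dvd u * f \<longleftrightarrow> R' ^ K dvd f" if R': "R' \<in> QP" for R'
        proof
          have "coprime (R' ^ K) u"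
            using R' Pu[OF R'] QP_irreds coprime_monic_irred_iff[of R' u] by (intro poly_coprime_power_left) auto
          then show "R' ^ K dvd f" if "R' ^ K dvd u * f"
            using that poly_coprime_dvd_mult by blast
        qed simp
        then show ?thesis
          by (simp add: truncated_def)
      qed
      have RR: "R' dvd R" if R': "R' \<in> QP" "R' \<noteq> P" for R'
      proof -
        have irr': "R' \<in> monic_irreds"
          using R' QP_irreds by auto
        have "coprime R' (P ^ Suc k)"
          using irr irr' R' by (intro poly_coprime_power_right coprime_monic_irreds) auto
        moreover have "R' dvd P ^ Suc k * R"
          using R' unfolding kRu(1)[symmetric] by (simp add: QP_def)
        ultimately show ?thesis
          by (rule poly_coprime_dvd_mult)
      qed
      \<comment> \<open>As \<open>c\<close> is a unit and \<open>P dvd f\<close>, the prime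
        \<open>P\<close> does not divide \<open>f + c\<close>. At the other primes of
        \<open>Q\<close> the factor \<open>R ^ K\<close> of the modulus decides divisibility by K-th
        powers.\<close>
      have Pfc: "\<not> P dvd f + c" "\<not> P dvd u * f + c"
        using True Pc by (simp_all add: dvd_add_right_iff)
      have tr2: "truncated K (u * f + c) \<longleftrightarrow> truncated K (f + c)"
      proof -
        have "R' ^ K dvd u * f + c \<longleftrightarrow> R' ^ K dvd f + c" if R': "R' \<in> QP" for R'
        proof (cases "R' = P")
          case True
          have "P dvd P ^ K"
            using K by (intro dvd_power) auto
          then show ?thesis
            using Pfc True dvd_trans[of P "P ^ K"] by auto
        next
          case False
          then have "R' ^ K dvd R ^ K"
            using RR[OF R'] by (intro dvd_power_same)
          then have "R' ^ K dvd (u * f + c) - (f + c)"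
            using dvd_mult_right[OF N'] by (rule dvd_trans)
          then have "R' ^ K dvd ((u * f + c) - (f + c)) + (f + c) \<longleftrightarrow> R' ^ K dvd f + c"
            by (rule dvd_add_right_iff)
          then show ?thesis
            by simp
        qed
        then show ?thesis
          by (simp add: truncated_def)
      qed
      have "R dvd R ^ K"
        using K by (intro dvd_power) auto
      then have "Q * D dvd P ^ Suc k * R ^ K * D"
        unfolding kRu(1) by (intro mult_dvd_mono) auto
      then have wf: "w (u * f) = w f"
        using periodicD[OF w dvd_trans[OF _ N]] by simp
      show ?thesis
      proof (cases "truncated K f \<and> truncated K (f + c)")
        case False
        then show ?thesis
          using tr1 tr2 by (auto simp: h_def)
      next
        case trunc: True
        then have f0: "f \<noteq> 0" "f + c \<noteq> 0"
          using truncated_nonzero[OF ne] by auto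
        \<comment> \<open>The exponent \<open>K - 1\<close> keeps one factor \<open>R\<close> of
          \<open>R ^ K\<close> back for the \<open>Q\<close> in the modulus of
          \<open>Psi_cong\<close>.\<close>
        have "ppart QP (f + c) dvd R ^ (K - 1)"
          unfolding ppart_def
        proof (rule poly_prod_dvd[OF finite_QP])
          fix R' assume R': "R' \<in> QP"
          show "R' ^ pval R' (f + c) dvd R ^ (K - 1)"
          proof (cases "R' = P")
            case True
            then show ?thesis
              using pval_eq_0_iff[OF irr f0(2)] Pfc by simp
          next
            case False
            have "R' ^ pval R' (f + c) dvd R' ^ (K - 1)"
              using truncated_pval_le[of K "f + c" R'] trunc f0 R' by (intro le_imp_power_dvd) auto
            also have "\<dots> dvd R ^ (K - 1)"
              using RR[OF R' False] by (rule dvd_power_same)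
            finally show ?thesis .
          qed
        next
          fix R' R'' assume "R' \<in> QP" "R'' \<in> QP" "R' \<noteq> R''"
          then show "coprime (R' ^ pval R' (f + c)) (R'' ^ pval R'' (f + c))"
            using QP_irreds
            by (intro poly_coprime_power_left poly_coprime_power_right coprime_monic_irreds) auto
        qed
        then have "ppart QP (f + c) * (P ^ Suc k * R) dvd R ^ (K - 1) * (P ^ Suc k * R)"
          by (rule mult_dvd_mono) simp
        also have "R ^ (K - 1) * (P ^ Suc k * R) = P ^ Suc k * R ^ Suc (K - 1)"
          by (simp add: mult_ac)
        also have "Suc (K - 1) = K"
          using K by simp
        finally have "ppart QP (f + c) * Q dvd (u * f + c) - (f + c)"
          using N' unfolding kRu(1)[symmetric] by (rule dvd_trans)
        then have "Psi (u * f + c) = Psi (f + c)"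
          using f0 by (intro Psi_cong)
        moreover have "Psi (u * f) = chi u * Psi f"
          using f0 u0 uQ by (intro Psi_mult_unit)
        ultimately show ?thesis
          using tr1 tr2 wf True trunc by (simp add: h_def)
      qed
    qed
  qed
qed

text \<open>A union bound over the primes of \<open>Q\<close>. It is uniform in \<open>n\<close> and
  tends to 0 as \<open>K\<close> grows, so the truncation costs nothing in the limit.\<close>

lemma avg_not_truncated: "avg n (\<lambda>f. of_bool (\<not> truncated K f)) \<le> real (card QP) / 2 ^ K"
proof -
  have "avg n (\<lambda>f. of_bool (\<not> truncated K f) :: real) \<le> avg n (\<lambda>f. \<Sum>R\<in>QP. of_bool (R ^ K dvd f))"
  proof (rule avg_mono)
    fix f
    show "of_bool (\<not> truncated K f) \<le> (\<Sum>R\<in>QP. of_bool (R ^ K dvd f) :: real)"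
    proof (cases "truncated K f")
      case False
      then obtain R where "R \<in> QP" "R ^ K dvd f"
        unfolding truncated_def by blast
      then show ?thesis
        using member_le_sum[of R QP "\<lambda>R. of_bool (R ^ K dvd f) :: real"] False by simp
    qed (simp add: sum_nonneg)
  qed
  also have "\<dots> = (\<Sum>R\<in>QP. avg n (\<lambda>f. of_bool (R ^ K dvd f)))"
    by (rule avg_sum)
  also have "\<dots> \<le> (\<Sum>R\<in>QP. 1 / 2 ^ K)"
  proof (rule sum_mono)
    fix R assume "R \<in> QP"
    then have R: "R \<in> monic_irreds"
      using QP_irreds by auto
    have "avg n (\<lambda>f. of_bool (R ^ K dvd f) :: real) \<le> 1 / pnorm (R ^ K)"
      using R by (intro avg_dvd_le monics_power) simp
    also have "\<dots> \<le> 1 / 2 ^ K"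
      using pnorm_irred_ge_2[OF R] monic_irreds_nonzero[OF R]
      by (simp add: pnorm_power frac_le power_mono)
    finally show "avg n (\<lambda>f. of_bool (R ^ K dvd f) :: real) \<le> 1 / 2 ^ K" .
  qed
  finally show ?thesis
    by simp
qed

text \<open>For fixed \<open>K\<close> the truncated average is exactly 0 once \<open>n\<close>
  reaches the degree of its period, and removing the truncation costs at most
  \<open>2 * card QP / 2 ^ K\<close>. The case \<open>c = - 1\<close> serves the primes dividing
  \<open>f + 1\<close>.\<close>

lemma avg_Psi_dvd_tendsto_0:
  assumes P: "P \<in> QP" and D: "D \<in> monics" "coprime Q D" and w: "periodic (Q * D) w"
    and w1: "\<And>f. norm (w f) \<le> 1" and c: "c = 1 \<or> c = - 1"
  shows "(\<lambda>n. avg n (\<lambda>f. Psi f * cnj (Psi (f + c)) * w f * of_bool (P dvd f))) \<longlonglongrightarrow> 0"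
    (is "(\<lambda>n. avg n ?h) \<longlonglongrightarrow> 0")
proof (rule LIMSEQ_I)
  fix e :: real assume e: "e > 0"
  obtain K0 where K0: "2 * real (card QP) / e < 2 ^ K0"
    using real_arch_pow[of 2 "2 * real (card QP) / e"] by auto
  define K where "K = Suc K0"
  have K: "K \<ge> 1"
    by (simp add: K_def)
  have "2 * real (card QP) < e * 2 ^ K0"
    using K0 e by (simp add: field_simps)
  also have "\<dots> \<le> e * 2 ^ K"
    using e by (simp add: K_def)
  finally have Ke: "2 * (real (card QP) / 2 ^ K) < e"
    by (simp add: field_simps)
  have cu: "is_unit c"
    using c by auto
  define hK where "hK = (\<lambda>f. ?h f * of_bool (truncated K f \<and> truncated K (f + c)))"
  have hK: "periodic (Q ^ K * D) hK" "(\<Sum>r\<in>residues (degree (Q ^ K * D)). hK r) = 0"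
    using residue_sum_truncated_eq_0[OF P D w K cu] by (auto simp: hK_def)
  show "\<exists>N. \<forall>n\<ge>N. norm (avg n ?h - 0) < e"
  proof (intro exI allI impI)
    fix n assume n: "max 1 (degree (Q ^ K * D)) \<le> n"
    have "Q ^ K * D \<in> monics"
      using Q_monic D by (intro monics_mult monics_power)
    then have 0: "avg n hK = 0"
      using avg_periodic[OF _ _ hK(1), of n] hK(2) n by simp
    have "norm (avg n (\<lambda>f. ?h f - hK f)) \<le> avg n (\<lambda>f. of_bool (\<not> truncated K f) + of_bool (\<not> truncated K (f + c)))"
    proof (rule norm_avg_le')
      fix f
      have "norm (?h f) \<le> 1"
        using norm_Psi_le w1 by (intro norm_mult_le_1) auto
      then show "norm (?h f - hK f) \<le> of_bool (\<not> truncated K f) + of_bool (\<not> truncated K (f + c))"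
        by (auto simp: hK_def)
    qed
    also have "\<dots> = avg n (\<lambda>f. of_bool (\<not> truncated K f)) + avg n (\<lambda>f. of_bool (\<not> truncated K (f + c)))"
      by (rule avg_add)
    also have "avg n (\<lambda>f. of_bool (\<not> truncated K (f + c)) :: real) = avg n (\<lambda>f. of_bool (\<not> truncated K f))"
      using c n avg_shift[of n "\<lambda>f. of_bool (\<not> truncated K f) :: real"]
        avg_shift_minus[of n "\<lambda>f. of_bool (\<not> truncated K f) :: real"] by auto
    finally have "norm (avg n (\<lambda>f. ?h f - hK f)) < e"
      using avg_not_truncated[of n K] Ke by simp
    then show "norm (avg n ?h - 0) < e"
      by (simp only: avg_diff 0 diff_zero)
  qed
qed

text \<open>Substituting \<open>f - 1\<close> for \<open>f\<close> and conjugating exchanges the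
  roles of the two arguments, which reduces the claim to \<open>c = - 1\<close>.\<close>

lemma avg_Psi_dvd_succ_tendsto_0:
  assumes P: "P \<in> QP" and D: "D \<in> monics" "coprime Q D" and w: "periodic (Q * D) w"
    and w1: "\<And>f. norm (w f) \<le> 1"
  shows "(\<lambda>n. avg n (\<lambda>f. Psi f * cnj (Psi (f + 1)) * w f * of_bool (P dvd f + 1))) \<longlonglongrightarrow> 0"
proof -
  let ?J = "\<lambda>f. Psi f * cnj (Psi (f + - 1)) * cnj (w (f - 1)) * of_bool (P dvd f)"
  have "periodic (Q * D) (\<lambda>f. cnj (w (f - 1)))"
    using w by (auto simp: periodic_def intro!: arg_cong[of _ _ cnj])
  then have "(\<lambda>n. avg n ?J) \<longlonglongrightarrow> 0"
    using w1 by (intro avg_Psi_dvd_tendsto_0[OF P D]) auto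
  then have "(\<lambda>n. cnj (avg n ?J)) \<longlonglongrightarrow> 0"
    using tendsto_cnj by fastforce
  moreover have "eventually (\<lambda>n. cnj (avg n ?J) =
      avg n (\<lambda>f. Psi f * cnj (Psi (f + 1)) * w f * of_bool (P dvd f + 1))) sequentially"
    using eventually_ge_at_top[of 1]
  proof eventually_elim
    case (elim n)
    have "avg n (\<lambda>f. cnj (?J (f + 1))) = avg n (\<lambda>f. cnj (?J f))"
      using elim by (rule avg_shift)
    moreover have "(\<lambda>f. cnj (?J (f + 1))) = (\<lambda>f. Psi f * cnj (Psi (f + 1)) * w f * of_bool (P dvd f + 1))"
      by (auto simp: fun_eq_iff)
    ultimately show ?case
      by (simp only: avg_cnj)
  qed
  ultimately show ?thesis
    by (rule Lim_transform_eventually)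
qed

text \<open>The polynomials are sorted by the sets of primes of \<open>Q\<close> dividing
  \<open>f\<close> and \<open>f + 1\<close>. Classes with a nonempty set contribute 0 in the limit.
  On the remaining class both arguments are units modulo \<open>Q\<close>, \<open>Psi\<close> agrees
  with \<open>chi\<close>, and for large \<open>n\<close> the average is a complete character
  sum.\<close>

lemma equid_Psi: "equid QP (\<lambda>f. Psi f * cnj (Psi (f + 1))) (of_real (pmoebius Q / pnorm Q))"
  unfolding equid_def
proof (intro ballI impI allI)
  fix D r assume D: "D \<in> monics" "\<forall>P\<in>QP. \<not> P dvd D"
  have cop: "coprime Q D"
    using D(2) by (simp add: coprime_commute coprime_Q_iff)
  have QD: "Q * D \<in> monics"
    using Q_monic D by auto
  let ?H = "\<lambda>f. Psi f * cnj (Psi (f + 1)) * of_bool (D dvd f - r)"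
  let ?m = "of_real (pmoebius Q / pnorm Q) / of_real (pnorm D) :: complex"
  define Z where "Z f = ({P \<in> QP. P dvd f}, {P \<in> QP. P dvd f + 1})" for f
  have part: "avg n ?H = (\<Sum>z\<in>Pow QP \<times> Pow QP. avg n (\<lambda>f. ?H f * of_bool (Z f = z)))" for n
  proof -
    have "?H f = (\<Sum>z\<in>Pow QP \<times> Pow QP. ?H f * of_bool (Z f = z))" for f
    proof -
      have "(\<Sum>z\<in>Pow QP \<times> Pow QP. ?H f * of_bool (Z f = z)) = (\<Sum>z\<in>Pow QP \<times> Pow QP. if Z f = z then ?H f else 0)"
        by (intro sum.cong) auto
      also have "\<dots> = ?H f"
        by (subst sum.delta') (auto simp: Z_def)
      finally show ?thesis
        by (rule sym)
    qed
    then have "avg n ?H = avg n (\<lambda>f. \<Sum>z\<in>Pow QP \<times> Pow QP. ?H f * of_bool (Z f = z))"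
      by (intro avg_cong)
    then show ?thesis
      by (simp only: avg_sum)
  qed
  have perZ: "periodic (Q * D) (\<lambda>f. of_bool (Z f = z) :: complex)" for z
  proof (rule periodicI)
    fix f g assume *: "Q * D dvd g - f"
    have "P dvd g \<longleftrightarrow> P dvd f" "P dvd g + 1 \<longleftrightarrow> P dvd f + 1" if "P \<in> QP" for P
    proof -
      have "P dvd g - f"
        using that * by (auto simp: QP_def intro: dvd_trans dest: dvd_mult_left)
      then have "P dvd (g - f) + f \<longleftrightarrow> P dvd f" "P dvd (g - f) + (f + 1) \<longleftrightarrow> P dvd f + 1"
        by (rule dvd_add_right_iff)+
      then show "P dvd g \<longleftrightarrow> P dvd f" "P dvd g + 1 \<longleftrightarrow> P dvd f + 1"
        by simp_all
    qed
    then have "Z g = Z f"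
      by (auto simp: Z_def)
    then show "of_bool (Z g = z) = (of_bool (Z f = z) :: complex)"
      by simp
  qed
  have perw: "periodic (Q * D) (\<lambda>f. of_bool (D dvd f - r) * of_bool (Z f = z) :: complex)" for z
    by (intro periodic_mult perZ periodic_dvd[OF periodic_of_bool_dvd]) simp
  have lim: "(\<lambda>n. avg n (\<lambda>f. ?H f * of_bool (Z f = z))) \<longlonglongrightarrow> (if z = ({}, {}) then ?m else 0)"
    if z: "z \<in> Pow QP \<times> Pow QP" for z
  proof (cases "fst z = {}")
    case False
    then obtain P where P: "P \<in> fst z" "P \<in> QP"
      using z by (cases z) auto
    have "(\<lambda>n. avg n (\<lambda>f. Psi f * cnj (Psi (f + 1)) * (of_bool (D dvd f - r) * of_bool (Z f = z)) * of_bool (P dvd f))) \<longlonglongrightarrow> 0"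
      by (intro avg_Psi_dvd_tendsto_0[OF P(2) D(1) cop perw]) (auto simp: norm_mult)
    moreover have "(\<lambda>f. Psi f * cnj (Psi (f + 1)) * (of_bool (D dvd f - r) * of_bool (Z f = z)) * of_bool (P dvd f)) = (\<lambda>f. ?H f * of_bool (Z f = z))"
      using P by (auto simp: fun_eq_iff Z_def)
    ultimately show ?thesis
      using False by auto
  next
    case 1: True
    show ?thesis
    proof (cases "snd z = {}")
      case False
      then obtain P where P: "P \<in> snd z" "P \<in> QP"
        using z by (cases z) auto
      have "(\<lambda>n. avg n (\<lambda>f. Psi f * cnj (Psi (f + 1)) * (of_bool (D dvd f - r) * of_bool (Z f = z)) * of_bool (P dvd f + 1))) \<longlonglongrightarrow> 0"
        by (intro avg_Psi_dvd_succ_tendsto_0[OF P(2) D(1) cop perw]) (auto simp: norm_mult)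
      moreover have "(\<lambda>f. Psi f * cnj (Psi (f + 1)) * (of_bool (D dvd f - r) * of_bool (Z f = z)) * of_bool (P dvd f + 1)) = (\<lambda>f. ?H f * of_bool (Z f = z))"
        using P by (auto simp: fun_eq_iff Z_def)
      ultimately show ?thesis
        using False by auto
    next
      case True
      let ?K = "\<lambda>f. chi f * cnj (chi (f + 1))"
      have HK: "?H f * of_bool (Z f = z) = ?K f * of_bool (D dvd f - r)" for f
      proof (cases "Z f = z")
        case t: True
        then have "coprime f Q" "coprime (f + 1) Q"
          using 1 True by (auto simp: Z_def coprime_Q_iff)
        then show ?thesis
          using t by (simp add: Psi_coprime_Q)
      next
        case False
        then have "\<not> coprime f Q \<or> \<not> coprime (f + 1) Q"
          using 1 True by (cases z) (auto simp: Z_def coprime_Q_iff)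
        then have "chi f = 0 \<or> chi (f + 1) = 0"
          using chi_nonzero_iff by blast
        then show ?thesis
          using False by auto
      qed
      have perK: "periodic Q ?K"
      proof (rule periodicI)
        fix f g assume "Q dvd g - f"
        then show "?K g = ?K f"
          using chi_cong[of g f] chi_cong[of "g + 1" "f + 1"] by simp
      qed
      have "avg n (\<lambda>f. ?H f * of_bool (Z f = z)) = ?m" if n: "n \<ge> degree (Q * D)" for n
      proof -
        have "avg n (\<lambda>f. ?H f * of_bool (Z f = z)) = avg n (\<lambda>f. ?K f * of_bool (D dvd f - r))"
          by (simp only: HK)
        also have "\<dots> = (\<Sum>s\<in>residues (degree (Q * D)). ?K s * of_bool (D dvd s - r)) / of_real (pnorm (Q * D))"
          by (intro avg_periodic QD n periodic_mult[OF periodic_dvd[OF perK] periodic_dvd[OF periodic_of_bool_dvd]])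
            simp_all
        also have "(\<Sum>s\<in>residues (degree (Q * D)). ?K s * of_bool (D dvd s - r)) =
            (\<Sum>s\<in>residues (degree Q). ?K s) * (\<Sum>s\<in>residues (degree D). of_bool (D dvd s - r))"
          using Q_nonzero monics_nonzero[OF D(1)] cop perK periodic_of_bool_dvd by (rule residue_sum_mult)
        also have "(\<Sum>s\<in>residues (degree D). of_bool (D dvd s - r)) = (1 :: complex)"
          using residue_sum_delta[OF monics_nonzero[OF D(1)], of r "\<lambda>_. 1"] by simp
        also have "(\<Sum>s\<in>residues (degree Q). ?K s) = of_real (pmoebius Q)"
          by (rule sum_chi_cnj_chi_succ)
        finally show ?thesis
          using Q_nonzero monics_nonzero[OF D(1)] by (simp add: pnorm_mult)
      qed
      then have "eventually (\<lambda>n. ?m = avg n (\<lambda>f. ?H f * of_bool (Z f = z))) sequentially"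
        by (metis (mono_tags, lifting) eventually_sequentiallyI)
      moreover have "z = ({}, {})"
        using 1 True by (cases z) auto
      ultimately show ?thesis
        by (auto intro: Lim_transform_eventually[OF tendsto_const])
    qed
  qed
  have "(\<lambda>n. avg n ?H) \<longlonglongrightarrow> (\<Sum>z\<in>Pow QP \<times> Pow QP. if z = ({}, {}) then ?m else 0)"
    unfolding part by (intro tendsto_sum lim)
  also have "(\<Sum>z\<in>Pow QP \<times> Pow QP. if z = ({}, {}) then ?m else 0) = ?m"
    by (subst sum.delta) auto
  finally show "(\<lambda>n. avg n ?H) \<longlonglongrightarrow> ?m" .
qed

end

subsection \<open>Correlations at the primes not dividing the conductor\<close>

lemma summable_geometric_bounded:
  fixes g :: "nat \<Rightarrow> 'b::banach" and x :: real
  assumes "\<And>i. norm (g i) \<le> C * x ^ i" "0 \<le> x" "x < 1"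
  shows "summable g"
  by (rule summable_comparison_test'[where g = "\<lambda>i. C * x ^ i" and N = 0])
    (use assms in \<open>auto intro!: summable_mult summable_geometric\<close>)

text \<open>Summation by parts: multiplication by 1 - 1/|P| turns the series into one in the
  differences \<open>c i\<close>. These are the coefficients at the indicators of
  \<open>P ^ Suc i dvd f\<close>, whose averages are known.\<close>

lemma local_factor_conv_differences:
  fixes \<phi> :: "'a::{field,finite} poly \<Rightarrow> complex"
  assumes P: "P \<in> monic_irreds" and "\<phi> 1 = 1" and bound: "\<And>i. norm (\<phi> (P ^ i)) \<le> 1"
  defines "c \<equiv> \<lambda>i. \<phi> (P ^ Suc i) - \<phi> (P ^ i)"
  shows "local_factor \<phi> P = 1 + 2 * (\<Sum>i. Re (c i) / pnorm P ^ Suc i)"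
    and "summable (\<lambda>i. Re (c i) / pnorm P ^ Suc i)"
proof -
  define x where "x = 1 / pnorm P"
  have x: "0 \<le> x" "x < 1"
    using pnorm_irred_ge_2[OF P] by (auto simp: x_def)
  have div: "a / pnorm P ^ i = a * x ^ i" for a i
    by (simp add: x_def power_divide)
  have bound': "\<bar>Re (\<phi> (P ^ i))\<bar> \<le> 1" for i
    using abs_Re_le_cmod[of "\<phi> (P ^ i)"] bound[of i] by linarith
  have s0: "summable (\<lambda>i. Re (\<phi> (P ^ i)) * x ^ i)"
    by (rule summable_geometric_bounded[of _ 1 x])
      (use bound' x in \<open>auto simp: abs_mult intro!: mult_left_le_one_le\<close>)
  then have s1: "summable (\<lambda>i. Re (\<phi> (P ^ Suc i)) * x ^ Suc i)"
    using summable_Suc_iff[of "\<lambda>i. Re (\<phi> (P ^ i)) * x ^ i"] by simp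
  have s2: "summable (\<lambda>i. x * (Re (\<phi> (P ^ i)) * x ^ i))"
    using s0 by (rule summable_mult)
  have eq: "Re (c i) / pnorm P ^ Suc i = Re (\<phi> (P ^ Suc i)) * x ^ Suc i - x * (Re (\<phi> (P ^ i)) * x ^ i)" for i
    unfolding div by (simp add: c_def algebra_simps)
  show "summable (\<lambda>i. Re (c i) / pnorm P ^ Suc i)"
    unfolding eq using s1 s2 by (rule summable_diff)
  have "(\<Sum>i. Re (c i) / pnorm P ^ Suc i) =
      (\<Sum>i. Re (\<phi> (P ^ Suc i)) * x ^ Suc i) - x * (\<Sum>i. Re (\<phi> (P ^ i)) * x ^ i)"
    unfolding eq suminf_diff[OF s1 s2, symmetric] suminf_mult[OF s0] ..
  also have "(\<Sum>i. Re (\<phi> (P ^ Suc i)) * x ^ Suc i) = (\<Sum>i. Re (\<phi> (P ^ i)) * x ^ i) - 1"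
    using suminf_split_head[OF s0] \<open>\<phi> 1 = 1\<close> by simp
  finally show "local_factor \<phi> P = 1 + 2 * (\<Sum>i. Re (c i) / pnorm P ^ Suc i)"
    unfolding local_factor_def div by (simp add: x_def algebra_simps)
qed

text \<open>Turns a function of the valuation into a combination of divisibility indicators. The sum
  may stop at any bound for the degree, beyond which no power of \<open>P\<close> divides
  \<open>f\<close>.\<close>

lemma pval_telescope:
  fixes g :: "nat \<Rightarrow> complex"
  assumes "P \<in> monic_irreds" "f \<noteq> 0" "degree f \<le> n" "g 0 = 1"
  shows "g (pval P f) = 1 + (\<Sum>i<n. (g (Suc i) - g i) * of_bool (P ^ Suc i dvd f))"
proof -
  have "pval P f \<le> n"
    using assms pval_le_degree le_trans by blast
  have "(\<Sum>i<n. (g (Suc i) - g i) * of_bool (P ^ Suc i dvd f)) =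
      (\<Sum>i<n. (g (Suc i) - g i) * of_bool (i < pval P f))"
    using pval_dvd_iff[OF assms(1,2)] by (simp only: Suc_le_eq)
  also have "\<dots> = (\<Sum>i<pval P f. g (Suc i) - g i)"
    using \<open>pval P f \<le> n\<close> by (intro sum.mono_neutral_cong_right) auto
  also have "\<dots> = g (pval P f) - g 0"
    by (rule sum_lessThan_telescope)
  finally show ?thesis
    using assms(4) by simp
qed

lemma not_dvd_succ: "P \<in> monic_irreds \<Longrightarrow> P dvd f \<Longrightarrow> \<not> P dvd f + 1"
  using monic_irreds_not_unit by (metis dvd_add_right_iff)

text \<open>Since \<open>P\<close> cannot divide both \<open>f\<close> and \<open>f + 1\<close>, the
  product of the local values is linear in them. Expanded in divisibility indicators, the two values
  give series with conjugate coefficients, whence twice a real part. Tannery's theorem moves the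
  limit in \<open>n\<close> inside both series.\<close>

lemma equid_insert:
  fixes H :: "'a::{field,finite} poly \<Rightarrow> complex" and \<phi> :: "'a poly \<Rightarrow> complex"
  assumes eq: "equid S H m" and H: "\<And>f. norm (H f) \<le> 1" and S: "S \<subseteq> monic_irreds"
    and P: "P \<in> monic_irreds" "P \<notin> S"
    and g: "\<phi> 1 = 1" "\<And>i. norm (\<phi> (P ^ i)) \<le> 1"
  shows "equid (insert P S) (\<lambda>f. H f * (\<phi> (P ^ pval P f) * cnj (\<phi> (P ^ pval P (f + 1)))))
    (m * of_real (local_factor \<phi> P))"
  unfolding equid_def
proof (intro ballI impI allI)
  fix D r assume D: "D \<in> monics" "\<forall>R\<in>insert P S. \<not> R dvd D"
  define x where "x = 1 / pnorm P"
  have x: "0 \<le> x" "x < 1"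
    using pnorm_irred_ge_2[OF P(1)] by (auto simp: x_def)
  define c where "c = (\<lambda>i. \<phi> (P ^ Suc i) - \<phi> (P ^ i))"
  have c2: "norm (c i) \<le> 2" for i
    unfolding c_def using norm_triangle_ineq4[of "\<phi> (P ^ Suc i)" "\<phi> (P ^ i)"] g(2)[of i] g(2)[of "Suc i"]
    by linarith
  let ?B = "\<lambda>f. of_bool (D dvd f - r) :: complex"
  define J where "J = (\<lambda>f. H f * ?B f)"
  have J: "norm (J f) \<le> 1" for f
    unfolding J_def using H by (intro norm_mult_le_1) auto
  define a where "a = (\<lambda>k n. c k * avg n (\<lambda>f. J f * of_bool (P ^ Suc k dvd f)))"
  define b where "b = (\<lambda>k n. cnj (c k) * avg n (\<lambda>f. J f * of_bool (P ^ Suc k dvd f + 1)))"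
  let ?M = "m / of_real (pnorm D)"
  \<comment> \<open>The two congruences merge into one modulo \<open>D * P ^ Suc k\<close>. The
    residue \<open>s = 0\<close> serves \<open>f\<close>, and \<open>s = - 1\<close> serves
    \<open>f + 1\<close>.\<close>
  have lim: "(\<lambda>n. avg n (\<lambda>f. J f * of_bool (P ^ Suc k dvd f - s))) \<longlonglongrightarrow> ?M * of_real (x ^ Suc k)" for k s
  proof -
    have nP: "D * P ^ Suc k \<in> monics"
      using D P by (auto intro!: monics_mult monics_power simp del: power_Suc)
    have "coprime P D"
      using D P by (simp add: coprime_monic_irred_iff)
    then have cop: "coprime D (P ^ Suc k)"
      by (intro poly_coprime_power_right) (simp add: coprime_commute)
    then obtain r' where r': "D dvd r' - r" "P ^ Suc k dvd r' - s"
      by (rule poly_chinese_remainder)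
    have "\<not> R dvd D * P ^ Suc k" if "R \<in> S" for R
    proof -
      have R: "R \<in> monic_irreds" "R \<noteq> P" "\<not> R dvd D"
        using that S P D by auto
      then have "coprime R (P ^ Suc k)"
        using P by (intro poly_coprime_power_right coprime_monic_irreds) auto
      then show ?thesis
        using R by (simp add: monic_irred_dvd_mult_iff coprime_monic_irred_iff del: power_Suc)
    qed
    then have "(\<lambda>n. avg n (\<lambda>f. H f * of_bool (D * P ^ Suc k dvd f - r'))) \<longlonglongrightarrow> m / of_real (pnorm (D * P ^ Suc k))"
      using eq nP unfolding equid_def by blast
    moreover have "D * P ^ Suc k dvd f - r' \<longleftrightarrow> D dvd f - r \<and> P ^ Suc k dvd f - s" for f
    proof -
      have 1: "D dvd f - r' \<longleftrightarrow> D dvd f - r" "P ^ Suc k dvd f - r' \<longleftrightarrow> P ^ Suc k dvd f - s"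
        using dvd_add_left_iff[OF r'(1), of "f - r'"] dvd_add_left_iff[OF r'(2), of "f - r'"]
        by simp_all
      show ?thesis
        unfolding 1[symmetric] using poly_divides_mult[OF cop] dvd_mult_left dvd_mult_right by metis
    qed
    moreover have "pnorm (D * P ^ Suc k) = pnorm D / x ^ Suc k"
      using monics_nonzero[OF D(1)] monic_irreds_nonzero[OF P(1)]
      by (simp add: pnorm_mult pnorm_power x_def power_divide del: power_Suc)
    ultimately show ?thesis
      by (simp add: J_def mult.assoc of_bool_conj del: power_Suc)
  qed
  have avg_le: "norm (avg n (\<lambda>f. J f * of_bool (P ^ Suc k dvd f))) \<le> x ^ Suc k" for n k
  proof -
    have "norm (avg n (\<lambda>f. J f * of_bool (P ^ Suc k dvd f))) \<le> avg n (\<lambda>f. of_bool (P ^ Suc k dvd f))"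
      using J by (intro norm_avg_le') (auto simp: norm_mult)
    also have "\<dots> \<le> 1 / pnorm (P ^ Suc k)"
      using P by (intro avg_dvd_le monics_power) simp
    finally show ?thesis
      using monic_irreds_nonzero[OF P(1)] by (simp add: x_def pnorm_power power_divide del: power_Suc)
  qed
  have avg_le': "norm (avg n (\<lambda>f. J f * of_bool (P ^ Suc k dvd f + 1))) \<le> x ^ Suc k" if "n \<ge> 1" for n k
  proof -
    have "norm (avg n (\<lambda>f. J f * of_bool (P ^ Suc k dvd f + 1))) \<le> avg n (\<lambda>f. of_bool (P ^ Suc k dvd f + 1))"
      using J by (intro norm_avg_le') (auto simp: norm_mult)
    also have "\<dots> = avg n (\<lambda>f. of_bool (P ^ Suc k dvd f))"
      using that by (rule avg_shift)
    also have "\<dots> \<le> 1 / pnorm (P ^ Suc k)"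
      using P by (intro avg_dvd_le monics_power) simp
    finally show ?thesis
      using monic_irreds_nonzero[OF P(1)] by (simp add: x_def pnorm_power power_divide del: power_Suc)
  qed
  have sumM: "summable (\<lambda>k. 2 * x ^ Suc k)"
    using x by (intro summable_mult) (simp add: summable_geometric)
  have tan1: "(\<lambda>n. \<Sum>k. a k n) \<longlonglongrightarrow> (\<Sum>k. c k * (?M * of_real (x ^ Suc k)))"
    and sum1: "summable (\<lambda>k. norm (c k * (?M * of_real (x ^ Suc k))))"
  proof -
    have "eventually (\<lambda>(k, n). norm (a k n) \<le> 2 * x ^ Suc k) (at_top \<times>\<^sub>F sequentially)"
      using c2 avg_le by (intro always_eventually) (auto simp: a_def norm_mult intro!: mult_mono simp del: power_Suc)
    moreover have "(\<lambda>n. a k n) \<longlonglongrightarrow> c k * (?M * of_real (x ^ Suc k))" for k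
      unfolding a_def using lim[of k 0] by (intro tendsto_mult tendsto_const) simp
    ultimately show "(\<lambda>n. \<Sum>k. a k n) \<longlonglongrightarrow> (\<Sum>k. c k * (?M * of_real (x ^ Suc k)))"
      "summable (\<lambda>k. norm (c k * (?M * of_real (x ^ Suc k))))"
      using tannerys_theorem[of a "\<lambda>k. c k * (?M * of_real (x ^ Suc k))" sequentially "\<lambda>k. 2 * x ^ Suc k"] sumM
      by simp_all
  qed
  have tan2: "(\<lambda>n. \<Sum>k. b k n) \<longlonglongrightarrow> (\<Sum>k. cnj (c k) * (?M * of_real (x ^ Suc k)))"
    and sum2: "summable (\<lambda>k. norm (cnj (c k) * (?M * of_real (x ^ Suc k))))"
  proof -
    have "eventually (\<lambda>(k, n). norm (b k n) \<le> 2 * x ^ Suc k) (at_top \<times>\<^sub>F sequentially)"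
    proof -
      \<comment> \<open>The majorant for the shifted indicators needs \<open>n \<ge> 1\<close>, so
        the domination is only established eventually in \<open>n\<close>.\<close>
      have "eventually (\<lambda>p :: nat \<times> nat. snd p \<ge> 1) (at_top \<times>\<^sub>F sequentially)"
        using eventually_ge_at_top[of "1::nat"] filterlim_snd[of at_top sequentially]
        by (rule eventually_compose_filterlim)
      then show ?thesis
        by eventually_elim
          (use c2 avg_le' x in \<open>auto simp: b_def norm_mult intro!: mult_mono simp del: power_Suc\<close>)
    qed
    moreover have "(\<lambda>n. b k n) \<longlonglongrightarrow> cnj (c k) * (?M * of_real (x ^ Suc k))" for k
      unfolding b_def using lim[of k "- 1"] by (intro tendsto_mult tendsto_const) simp
    ultimately show "(\<lambda>n. \<Sum>k. b k n) \<longlonglongrightarrow> (\<Sum>k. cnj (c k) * (?M * of_real (x ^ Suc k)))"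
      "summable (\<lambda>k. norm (cnj (c k) * (?M * of_real (x ^ Suc k))))"
      using tannerys_theorem[of b "\<lambda>k. cnj (c k) * (?M * of_real (x ^ Suc k))" sequentially "\<lambda>k. 2 * x ^ Suc k"] sumM
      by simp_all
  qed
  have limJ: "(\<lambda>n. avg n J) \<longlonglongrightarrow> ?M"
    using eq D unfolding equid_def J_def by simp
  have "(\<lambda>n. avg n J + (\<Sum>k. a k n) + (\<Sum>k. b k n)) \<longlonglongrightarrow>
      ?M + (\<Sum>k. c k * (?M * of_real (x ^ Suc k))) + (\<Sum>k. cnj (c k) * (?M * of_real (x ^ Suc k)))"
    by (intro tendsto_add limJ tan1 tan2)
  also have "?M + (\<Sum>k. c k * (?M * of_real (x ^ Suc k))) + (\<Sum>k. cnj (c k) * (?M * of_real (x ^ Suc k))) =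
      ?M + (\<Sum>k. c k * (?M * of_real (x ^ Suc k)) + cnj (c k) * (?M * of_real (x ^ Suc k)))"
    using suminf_add[OF summable_norm_cancel[OF sum1] summable_norm_cancel[OF sum2]] by simp
  also have "(\<Sum>k. c k * (?M * of_real (x ^ Suc k)) + cnj (c k) * (?M * of_real (x ^ Suc k))) =
      (\<Sum>k. 2 * ?M * of_real (Re (c k) / pnorm P ^ Suc k))"
  proof (rule suminf_cong)
    fix k
    have "c k * (?M * of_real (x ^ Suc k)) + cnj (c k) * (?M * of_real (x ^ Suc k)) =
        (c k + cnj (c k)) * (?M * of_real (x ^ Suc k))"
      by (rule distrib_right[symmetric])
    also have "c k + cnj (c k) = of_real (2 * Re (c k))"
      by (rule complex_add_cnj)
    finally show "c k * (?M * of_real (x ^ Suc k)) + cnj (c k) * (?M * of_real (x ^ Suc k)) =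
        2 * ?M * of_real (Re (c k) / pnorm P ^ Suc k)"
      by (simp add: x_def power_divide del: power_Suc)
  qed
  also have "\<dots> = 2 * ?M * of_real (\<Sum>k. Re (c k) / pnorm P ^ Suc k)"
  proof -
    have s: "summable (\<lambda>k. Re (c k) / pnorm P ^ Suc k)"
      unfolding c_def using local_factor_conv_differences(2)[OF P(1) g] .
    then have "summable (\<lambda>k. of_real (Re (c k) / pnorm P ^ Suc k) :: complex)"
      by (rule summable_of_real)
    then show ?thesis
      by (subst suminf_mult) (simp_all only: suminf_of_real[OF s])
  qed
  also have "?M + 2 * ?M * of_real (\<Sum>k. Re (c k) / pnorm P ^ Suc k) = m * of_real (local_factor \<phi> P) / of_real (pnorm D)"
    unfolding local_factor_conv_differences(1)[OF P(1) g] c_def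
    by (simp add: algebra_simps add_divide_distrib del: power_Suc)
  finally have main: "(\<lambda>n. avg n J + (\<Sum>k. a k n) + (\<Sum>k. b k n)) \<longlonglongrightarrow> \<dots>" .
  have "avg n J + (\<Sum>k. a k n) + (\<Sum>k. b k n) =
      avg n (\<lambda>f. H f * (\<phi> (P ^ pval P f) * cnj (\<phi> (P ^ pval P (f + 1)))) * of_bool (D dvd f - r))"
    if n: "n \<ge> 1" for n
  proof -
    \<comment> \<open>Powers of degree above \<open>n\<close> divide nothing of degree
      \<open>n\<close>, so at fixed \<open>n\<close> both series are finite sums.\<close>
    have z: "\<not> P ^ Suc k dvd f" if "f \<in> monics_deg n" "k \<ge> n" for f k
      using that power_dvd_imp_le_degree[OF P(1), of f "Suc k"] monics_degD[OF that(1)] by auto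
    have a0: "a k n = 0" if "k \<notin> {..<n}" for k
    proof -
      have "avg n (\<lambda>f. J f * of_bool (P ^ Suc k dvd f)) = avg n (\<lambda>f :: 'a poly. 0 :: complex)"
        using z that by (intro avg_cong) (auto simp del: power_Suc)
      then show ?thesis
        by (simp add: a_def del: power_Suc)
    qed
    have b0: "b k n = 0" if "k \<notin> {..<n}" for k
    proof -
      have "avg n (\<lambda>f. J f * of_bool (P ^ Suc k dvd f + 1)) = avg n (\<lambda>f :: 'a poly. 0 :: complex)"
        using z[OF monics_deg_add_1[OF _ n]] that by (intro avg_cong) (auto simp del: power_Suc)
      then show ?thesis
        by (simp add: b_def del: power_Suc)
    qed
    have "avg n J + (\<Sum>k. a k n) + (\<Sum>k. b k n) = avg n J + (\<Sum>k<n. a k n) + (\<Sum>k<n. b k n)"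
      using suminf_finite[of "{..<n}" "\<lambda>k. a k n"] suminf_finite[of "{..<n}" "\<lambda>k. b k n"] a0 b0 by simp
    also have "\<dots> = avg n (\<lambda>f. J f + (\<Sum>k<n. c k * (J f * of_bool (P ^ Suc k dvd f))) + (\<Sum>k<n. cnj (c k) * (J f * of_bool (P ^ Suc k dvd f + 1))))"
      unfolding avg_add avg_sum avg_cmult a_def b_def ..
    also have "\<dots> = avg n (\<lambda>f. H f * (\<phi> (P ^ pval P f) * cnj (\<phi> (P ^ pval P (f + 1)))) * of_bool (D dvd f - r))"
    proof (rule avg_cong)
      fix f :: "'a poly" assume f: "f \<in> monics_deg n"
      define A where "A = \<phi> (P ^ pval P f)"
      define B where "B = \<phi> (P ^ pval P (f + 1))"
      note f1 = monics_deg_add_1[OF f n]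
      have A: "A = 1 + (\<Sum>k<n. c k * of_bool (P ^ Suc k dvd f))"
        unfolding A_def c_def using pval_telescope[OF P(1) monics_degD(3)[OF f], of n "\<lambda>i. \<phi> (P ^ i)"] monics_degD[OF f] g(1) by simp
      have "B = 1 + (\<Sum>k<n. c k * of_bool (P ^ Suc k dvd f + 1))"
        unfolding B_def c_def using pval_telescope[OF P(1) monics_degD(3)[OF f1], of n "\<lambda>i. \<phi> (P ^ i)"] monics_degD[OF f1] g(1) by simp
      moreover have "cnj (of_bool b) = of_bool b" for b
        by simp
      ultimately have B: "cnj B = 1 + (\<Sum>k<n. cnj (c k) * of_bool (P ^ Suc k dvd f + 1))"
        by (simp del: power_Suc sum_mult_of_bool_eq)
      have "A = 1 \<or> B = 1"
        using not_dvd_succ[OF P(1), of f] pval_eq_0_iff[OF P(1) monics_degD(3)[OF f]]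
          pval_eq_0_iff[OF P(1) monics_degD(3)[OF f1]] g(1) unfolding A_def B_def by (cases "P dvd f") auto
      then have "A * cnj B = 1 + (A - 1) + (cnj B - 1)"
        by auto
      then have "J f * (A * cnj B) = J f * (1 + (A - 1) + (cnj B - 1))"
        by (simp only:)
      also have "\<dots> = J f + J f * (A - 1) + J f * (cnj B - 1)"
        by (simp only: distrib_left mult_1_right)
      also have "\<dots> = J f + (\<Sum>k<n. c k * (J f * of_bool (P ^ Suc k dvd f))) + (\<Sum>k<n. cnj (c k) * (J f * of_bool (P ^ Suc k dvd f + 1)))"
        unfolding A B add_diff_cancel_left' sum_distrib_left by (simp only: mult.left_commute)
      finally show "J f + (\<Sum>k<n. c k * (J f * of_bool (P ^ Suc k dvd f))) + (\<Sum>k<n. cnj (c k) * (J f * of_bool (P ^ Suc k dvd f + 1))) =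
          H f * (\<phi> (P ^ pval P f) * cnj (\<phi> (P ^ pval P (f + 1)))) * of_bool (D dvd f - r)"
        unfolding A_def[symmetric] B_def[symmetric] by (simp add: J_def mult_ac)
    qed
    finally show ?thesis .
  qed
  then have "eventually (\<lambda>n. avg n J + (\<Sum>k. a k n) + (\<Sum>k. b k n) =
      avg n (\<lambda>f. H f * (\<phi> (P ^ pval P f) * cnj (\<phi> (P ^ pval P (f + 1)))) * of_bool (D dvd f - r))) sequentially"
    by (rule eventually_sequentiallyI)
  with main show "(\<lambda>n. avg n (\<lambda>f. H f * (\<phi> (P ^ pval P f) * cnj (\<phi> (P ^ pval P (f + 1)))) * of_bool (D dvd f - r)))
      \<longlonglongrightarrow> m * of_real (local_factor \<phi> P) / of_real (pnorm D)"
    by (rule Lim_transform_eventually)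
qed

lemma equid_union:
  fixes H :: "'a::{field,finite} poly \<Rightarrow> complex" and \<phi> :: "'a poly \<Rightarrow> complex"
  assumes eq: "equid S H m" and H: "\<And>f. norm (H f) \<le> 1" and S: "S \<subseteq> monic_irreds"
    and T: "finite T" "T \<subseteq> monic_irreds" "S \<inter> T = {}"
    and g: "\<phi> 1 = 1" "\<And>P i. P \<in> T \<Longrightarrow> norm (\<phi> (P ^ i)) \<le> 1"
  shows "equid (S \<union> T) (\<lambda>f. H f * (\<Prod>P\<in>T. \<phi> (P ^ pval P f) * cnj (\<phi> (P ^ pval P (f + 1)))))
    (m * of_real (\<Prod>P\<in>T. local_factor \<phi> P))"
  using T g(2)
proof (induction T rule: finite_induct)
  case empty
  then show ?case
    using eq by simp
next
  case (insert P T)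
  let ?H = "\<lambda>f. H f * (\<Prod>P\<in>T. \<phi> (P ^ pval P f) * cnj (\<phi> (P ^ pval P (f + 1))))"
  have "norm (?H f) \<le> 1" for f
  proof (rule norm_mult_le_1[OF H])
    have "norm (\<Prod>P\<in>T. \<phi> (P ^ pval P f) * cnj (\<phi> (P ^ pval P (f + 1)))) \<le> (\<Prod>P\<in>T. 1)"
      unfolding prod_norm[symmetric] using insert.prems by (intro prod_mono) (auto intro!: norm_mult_le_1)
    then show "norm (\<Prod>P\<in>T. \<phi> (P ^ pval P f) * cnj (\<phi> (P ^ pval P (f + 1)))) \<le> 1"
      by simp
  qed
  then have "equid (insert P (S \<union> T)) (\<lambda>f. ?H f * (\<phi> (P ^ pval P f) * cnj (\<phi> (P ^ pval P (f + 1)))))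
    (m * of_real (\<Prod>P\<in>T. local_factor \<phi> P) * of_real (local_factor \<phi> P))"
    using insert S g(1) by (intro equid_insert) auto
  then show ?case
    using insert.hyps by (simp add: mult_ac)
qed

subsection \<open>Concentration of the rough part\<close>

text \<open>On the left half-plane, which is convex, the derivative of \<open>exp\<close> has
  modulus at most 1. The exponents \<open>\<Phi> P - 1\<close> and their sums lie there because
  \<open>norm (\<Phi> P) \<le> 1\<close>.\<close>

lemma norm_exp_diff_le:
  fixes a b :: complex
  assumes "Re a \<le> 0" "Re b \<le> 0"
  shows "norm (exp a - exp b) \<le> norm (a - b)"
proof -
  have "norm (exp a - exp b) \<le> 1 * norm (a - b)"
  proof (rule field_differentiable_bound[of "{z. Re z \<le> 0}" exp exp])
    show "convex {z. Re z \<le> 0}"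
      by (rule convex_halfspace_Re_le)
    show "(exp has_field_derivative exp z) (at z within {z. Re z \<le> 0})" for z
      by (auto intro!: derivative_eq_intros)
  qed (use assms in auto)
  then show ?thesis
    by simp
qed

text \<open>The derivative \<open>exp v - 1\<close> is bounded by \<open>norm w\<close> on the part
  of the half-plane inside the ball of radius \<open>norm w\<close>, by the preceding bound; this
  makes the error quadratic.\<close>

lemma norm_exp_minus_linear_le:
  fixes w :: complex
  assumes "Re w \<le> 0"
  shows "norm (exp w - (1 + w)) \<le> (norm w)\<^sup>2"
proof -
  let ?S = "{v. Re v \<le> 0} \<inter> cball 0 (norm w)"
  have "norm ((exp w - (1 + w)) - (exp 0 - (1 + 0))) \<le> norm w * norm (w - 0)"
  proof (rule field_differentiable_bound[of ?S "\<lambda>v. exp v - (1 + v)" "\<lambda>v. exp v - 1"])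
    show "convex ?S"
      by (intro convex_Int convex_halfspace_Re_le convex_cball)
    show "((\<lambda>v. exp v - (1 + v)) has_field_derivative exp v - 1) (at v within ?S)" for v
      by (auto intro!: derivative_eq_intros)
    show "norm (exp v - 1) \<le> norm w" if "v \<in> ?S" for v
      using norm_exp_diff_le[of v 0] that by auto
  qed (use assms in auto)
  then show ?thesis
    by (simp add: power2_eq_square)
qed

text \<open>The products are compared factor by factor, all factors having norm at most 1. A prime
  dividing \<open>f\<close> exactly once costs the quadratic error of \<open>exp\<close>; one whose
  square divides \<open>f\<close> costs the trivial bound 2. The exponent is an additive function,
  to which a variance computation applies.\<close>

lemma multiplicative_exp_approx:
  fixes \<Phi> :: "'a::{field,finite} poly \<Rightarrow> complex"
  assumes mult: "multiplicative \<Phi>" and bound: "\<And>f. f \<in> monics \<Longrightarrow> norm (\<Phi> f) \<le> 1"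
    and f: "f \<in> monics"
  shows "norm (\<Phi> f - exp (\<Sum>P | P \<in> monic_irreds \<and> P dvd f. \<Phi> P - 1)) \<le>
    (\<Sum>P | P \<in> monic_irreds \<and> P dvd f. (norm (\<Phi> P - 1))\<^sup>2 + 2 * of_bool (P\<^sup>2 dvd f))"
proof -
  let ?D = "{P. P \<in> monic_irreds \<and> P dvd f}"
  have f0: "f \<noteq> 0"
    using f monics_nonzero by blast
  have fin: "finite ?D"
    using finite_monic_irred_divisors[OF f0] .
  have sub: "?D \<subseteq> monic_irreds"
    by auto
  let ?r = "f div ppart ?D f"
  have r: "?r \<in> monics"
    using f ppart_monic[OF sub] ppart_dvd[OF fin sub f0] by (intro monics_div)
  have "is_unit ?r"
  proof (rule ccontr)
    assume "\<not> is_unit ?r"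
    then obtain P where P: "P \<in> monic_irreds" "P dvd ?r"
      using monic_irred_divisor_exists[of ?r] monics_nonzero[OF r] by auto
    have "?r dvd f"
      using ppart_dvd[OF fin sub f0] by (metis dvd_div_mult_self dvd_triv_left)
    then have "P \<in> ?D"
      using P dvd_trans by auto
    then show False
      using ppart_coprime_cofactor[OF fin sub f0] P by blast
  qed
  then have "?r = 1"
    using monics_degree_0[OF r] is_unit_iff_degree[OF monics_nonzero[OF r]] by simp
  then have "\<Phi> f = \<Phi> (ppart ?D f)"
    using multiplicative_split[OF mult fin sub f] mult by (simp add: multiplicative_def)
  also have "\<dots> = (\<Prod>P\<in>?D. \<Phi> (P ^ pval P f))"
    by (rule multiplicative_ppart[OF mult fin sub])
  finally have 1: "\<Phi> f = (\<Prod>P\<in>?D. \<Phi> (P ^ pval P f))" .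
  have Re: "Re (\<Phi> P - 1) \<le> 0" if "P \<in> monics" for P
    using bound[OF that] complex_Re_le_cmod[of "\<Phi> P"] by simp
  have "norm ((\<Prod>P\<in>?D. \<Phi> (P ^ pval P f)) - (\<Prod>P\<in>?D. exp (\<Phi> P - 1))) \<le>
      (\<Sum>P\<in>?D. norm (\<Phi> (P ^ pval P f) - exp (\<Phi> P - 1)))"
  proof (rule norm_prod_diff)
    fix P assume P: "P \<in> ?D"
    show "norm (\<Phi> (P ^ pval P f)) \<le> 1"
      using P by (intro bound monics_power) auto
    show "norm (exp (\<Phi> P - 1)) \<le> 1"
      using P Re[of P] by (subst norm_exp_eq_Re) auto
  qed
  also have "\<dots> \<le> (\<Sum>P\<in>?D. (norm (\<Phi> P - 1))\<^sup>2 + 2 * of_bool (P\<^sup>2 dvd f))"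
  proof (rule sum_mono)
    fix P assume P: "P \<in> ?D"
    then have irr: "P \<in> monic_irreds"
      by simp
    show "norm (\<Phi> (P ^ pval P f) - exp (\<Phi> P - 1)) \<le> (norm (\<Phi> P - 1))\<^sup>2 + 2 * of_bool (P\<^sup>2 dvd f)"
    proof (cases "P\<^sup>2 dvd f")
      case True
      have "norm (\<Phi> (P ^ pval P f)) \<le> 1" "norm (exp (\<Phi> P - 1)) \<le> 1"
        using irr Re[of P] by (auto intro!: bound monics_power simp: norm_exp_eq_Re)
      then have "norm (\<Phi> (P ^ pval P f) - exp (\<Phi> P - 1)) \<le> 2"
        using norm_triangle_ineq4[of "\<Phi> (P ^ pval P f)" "exp (\<Phi> P - 1)"] by linarith
      then show ?thesis
        using True by (simp add: add_increasing)
    next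
      case False
      have "pval P f = 1"
        using P False by (intro pval_eqI) (auto simp: power2_eq_square)
      then show ?thesis
        using False norm_exp_minus_linear_le[OF Re[of P]] irr by (simp add: norm_minus_commute)
    qed
  qed
  finally show ?thesis
    unfolding 1 using fin by (simp add: exp_sum)
qed

text \<open>A Turan-Kubilius inequality without error term: the product of two distinct primes of
  \<open>T\<close> has degree at most \<open>n\<close>, so the divisibility events are exactly
  uncorrelated and only the diagonal remains.\<close>

lemma avg_dvd_variance:
  fixes h :: "'a::{field,finite} poly \<Rightarrow> complex"
  assumes T: "finite T" "T \<subseteq> monic_irreds" "\<And>P. P \<in> T \<Longrightarrow> 2 * degree P \<le> n"
  shows "avg n (\<lambda>f. (norm ((\<Sum>P\<in>T. h P * of_bool (P dvd f)) - (\<Sum>P\<in>T. h P / of_real (pnorm P))))\<^sup>2)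
    \<le> (\<Sum>P\<in>T. (norm (h P))\<^sup>2 / pnorm P)"
proof -
  define X where "X P f = of_bool (P dvd f) - 1 / pnorm P" for P f :: "'a poly"
  have avg1: "avg n (\<lambda>f. of_bool (P dvd f)) = 1 / pnorm P" if "P \<in> T" for P
    using avg_dvd[of P n 0] T(2) T(3)[OF that] that by auto
  have cov: "avg n (\<lambda>f. X P f * X R f) = (if P = R then 1 / pnorm P - 1 / (pnorm P)\<^sup>2 else 0)"
    if PR: "P \<in> T" "R \<in> T" for P R
  proof -
    have irr: "P \<in> monic_irreds" "R \<in> monic_irreds"
      using PR T by auto
    have "avg n (\<lambda>f. X P f * X R f) = avg n (\<lambda>f. (of_bool (P dvd f \<and> R dvd f) - 1 / pnorm R * of_bool (P dvd f))
        - 1 / pnorm P * of_bool (R dvd f) + 1 / (pnorm P * pnorm R))"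
      by (intro avg_cong) (auto simp: X_def algebra_simps)
    also have "\<dots> = avg n (\<lambda>f. of_bool (P dvd f \<and> R dvd f)) - 1 / pnorm R * (1 / pnorm P) - 1 / pnorm P * (1 / pnorm R) + 1 / (pnorm P * pnorm R)"
      unfolding avg_add avg_diff avg_cmult avg_const by (simp only: avg1 PR)
    also have "avg n (\<lambda>f. of_bool (P dvd f \<and> R dvd f)) = (if P = R then 1 / pnorm P else 1 / (pnorm P * pnorm R))"
    proof (cases "P = R")
      case True
      then show ?thesis
        using avg1 PR by simp
    next
      case False
      have "P dvd f \<and> R dvd f \<longleftrightarrow> P * R dvd f - 0" for f
        using poly_divides_mult[OF coprime_monic_irreds[OF irr False], of f] by (auto dest: dvd_mult_left dvd_mult_right)
      moreover have "degree (P * R) \<le> n" "P * R \<in> monics"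
        using irr T(3)[OF PR(1)] T(3)[OF PR(2)] monic_irreds_nonzero[OF irr(1)] monic_irreds_nonzero[OF irr(2)]
        by (auto simp: degree_mult_eq)
      ultimately show ?thesis
        using False avg_dvd[of "P * R" n 0]
        by (simp add: pnorm_mult monic_irreds_nonzero[OF irr(1)] monic_irreds_nonzero[OF irr(2)])
    qed
    finally show ?thesis
      by (simp add: power2_eq_square)
  qed
  have "of_real (avg n (\<lambda>f. (norm ((\<Sum>P\<in>T. h P * of_bool (P dvd f)) - (\<Sum>P\<in>T. h P / of_real (pnorm P))))\<^sup>2)) =
      avg n (\<lambda>f. \<Sum>P\<in>T. \<Sum>R\<in>T. (h P * cnj (h R)) * of_real (X P f * X R f))"
    unfolding avg_of_real[symmetric]
  proof (rule avg_cong)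
    fix f :: "'a poly"
    have "(\<Sum>P\<in>T. h P * of_bool (P dvd f)) - (\<Sum>P\<in>T. h P / of_real (pnorm P)) = (\<Sum>P\<in>T. h P * of_real (X P f))"
      unfolding sum_subtractf[symmetric] X_def by (intro sum.cong) (auto simp: algebra_simps)
    then have "complex_of_real ((norm ((\<Sum>P\<in>T. h P * of_bool (P dvd f)) - (\<Sum>P\<in>T. h P / of_real (pnorm P))))\<^sup>2) =
        (\<Sum>P\<in>T. h P * of_real (X P f)) * cnj (\<Sum>P\<in>T. h P * of_real (X P f))"
      by (simp only: complex_norm_square)
    also have "\<dots> = (\<Sum>P\<in>T. \<Sum>R\<in>T. (h P * cnj (h R)) * of_real (X P f * X R f))"
      unfolding cnj_sum sum_product by (intro sum.cong) auto
    finally show "complex_of_real ((norm ((\<Sum>P\<in>T. h P * of_bool (P dvd f)) - (\<Sum>P\<in>T. h P / of_real (pnorm P))))\<^sup>2) =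
      (\<Sum>P\<in>T. \<Sum>R\<in>T. (h P * cnj (h R)) * of_real (X P f * X R f))" .
  qed
  also have "\<dots> = (\<Sum>P\<in>T. \<Sum>R\<in>T. (h P * cnj (h R)) * of_real (avg n (\<lambda>f. X P f * X R f)))"
    unfolding avg_sum avg_cmult avg_of_real ..
  also have "\<dots> = (\<Sum>P\<in>T. \<Sum>R\<in>T. if P = R then of_real ((norm (h P))\<^sup>2 * (1 / pnorm P - 1 / (pnorm P)\<^sup>2)) else 0)"
    by (intro sum.cong refl) (simp add: cov complex_norm_square[symmetric])
  also have "\<dots> = of_real (\<Sum>P\<in>T. (norm (h P))\<^sup>2 * (1 / pnorm P - 1 / (pnorm P)\<^sup>2))"
    using T(1) by (simp add: sum.delta')
  finally have "avg n (\<lambda>f. (norm ((\<Sum>P\<in>T. h P * of_bool (P dvd f)) - (\<Sum>P\<in>T. h P / of_real (pnorm P))))\<^sup>2) =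
      (\<Sum>P\<in>T. (norm (h P))\<^sup>2 * (1 / pnorm P - 1 / (pnorm P)\<^sup>2))"
    by (simp only: of_real_eq_iff)
  also have "\<dots> \<le> (\<Sum>P\<in>T. (norm (h P))\<^sup>2 / pnorm P)"
    by (intro sum_mono) (simp add: algebra_simps)
  finally show ?thesis .
qed

text \<open>The sum is the average number of divisors of \<open>f\<close> in \<open>T\<close>. Two
  distinct ones would have a product of degree above \<open>n\<close>, so this number never exceeds
  1.\<close>

lemma sum_large_primes_le_1:
  fixes T :: "'a::{field,finite} poly set"
  assumes T: "finite T" "T \<subseteq> monic_irreds" "\<And>P. P \<in> T \<Longrightarrow> n < 2 * degree P" "\<And>P. P \<in> T \<Longrightarrow> degree P \<le> n"
  shows "(\<Sum>P\<in>T. 1 / pnorm P) \<le> 1"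
proof -
  have "(\<Sum>P\<in>T. 1 / pnorm P) = (\<Sum>P\<in>T. avg n (\<lambda>f. of_bool (P dvd f)))"
  proof (rule sum.cong[OF refl])
    fix P assume "P \<in> T"
    then show "1 / pnorm P = avg n (\<lambda>f. of_bool (P dvd f))"
      using avg_dvd[of P n 0] T(2) T(4)[of P] by auto
  qed
  also have "\<dots> = avg n (\<lambda>f. \<Sum>P\<in>T. of_bool (P dvd f))"
    by (rule avg_sum[symmetric])
  also have "\<dots> \<le> avg n (\<lambda>f :: 'a poly. 1)"
  proof (rule avg_mono)
    fix f :: "'a poly" assume f: "f \<in> monics_deg n"
    have "card {P \<in> T. P dvd f} \<le> Suc 0"
    proof (subst card_le_Suc0_iff_eq)
      show "\<forall>P\<in>{P \<in> T. P dvd f}. \<forall>R\<in>{P \<in> T. P dvd f}. P = R"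
      proof (intro ballI, rule ccontr)
        fix P R assume PR: "P \<in> {P \<in> T. P dvd f}" "R \<in> {P \<in> T. P dvd f}" "P \<noteq> R"
        then have irr: "P \<in> monic_irreds" "R \<in> monic_irreds"
          using T by auto
        have "P * R dvd f"
          using PR coprime_monic_irreds[OF irr] by (intro poly_divides_mult) auto
        then have "degree (P * R) \<le> n"
          using monics_degD[OF f] dvd_imp_degree_le by blast
        then show False
          using PR T(3)[of P] T(3)[of R] monic_irreds_nonzero[OF irr(1)] monic_irreds_nonzero[OF irr(2)]
          by (simp add: degree_mult_eq)
      qed
    qed (use T(1) in simp)
    then show "(\<Sum>P\<in>T. of_bool (P dvd f) :: real) \<le> 1"
      using T(1) by (simp add: Int_def conj_commute)
  qed
  finally show ?thesis
    by simp
qed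

text \<open>Three approximations lead to the constant: the exponential of the additive function
  (\<open>A\<close>), omission of the primes of degree above \<open>n / 2\<close>
  (\<open>B\<close>), and replacement of the rest by its mean (\<open>C\<close>). Proper prime
  powers account for \<open>\<kappa>\<close>. The lower bound for \<open>norm c\<close> holds
  because the mean has a real part between \<open>- \<tau>\<close> and 0.\<close>

lemma rough_part_concentration:
  fixes \<Phi> :: "'a::{field,finite} poly \<Rightarrow> complex" and y n :: nat
  assumes mult: "multiplicative \<Phi>" and bound: "\<And>f. f \<in> monics \<Longrightarrow> norm (\<Phi> f) \<le> 1"
  defines "S \<equiv> {P \<in> monic_irreds. degree P \<le> y}"
    and "L \<equiv> {P \<in> monic_irreds. y < degree P \<and> degree P \<le> n}"
  defines "\<tau> \<equiv> \<Sum>P\<in>L. (1 - Re (\<Phi> P)) / pnorm P" and "\<kappa> \<equiv> \<Sum>P\<in>L. 1 / (pnorm P)\<^sup>2"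
  obtains c where "norm c \<le> 1" "1 - (norm c)\<^sup>2 \<le> 2 * \<tau>"
    "avg n (\<lambda>f. norm (\<Phi> (f div ppart S f) - c)) \<le> 2 * \<tau> + 2 * \<kappa> + 2 * sqrt (2 * \<tau>)"
proof -
  define h where "h P = \<Phi> P - 1" for P
  define L1 where "L1 = {P \<in> L. 2 * degree P \<le> n}"
  define L2 where "L2 = {P \<in> L. n < 2 * degree P}"
  have fin: "finite S" "finite L"
    unfolding S_def L_def by (rule finite_subset[OF _ finite_degree_le]; auto)+
  then have fin': "finite L1" "finite L2"
    by (auto simp: L1_def L2_def)
  have L12: "L = L1 \<union> L2" "L1 \<inter> L2 = {}"
    by (auto simp: L1_def L2_def)
  have irr: "S \<subseteq> monic_irreds" "L \<subseteq> monic_irreds" "L1 \<subseteq> monic_irreds" "L2 \<subseteq> monic_irreds"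
    by (auto simp: S_def L_def L1_def L2_def)
  define t where "t P = (norm (h P))\<^sup>2 / pnorm P" for P
  have t0: "0 \<le> t P" for P
    by (simp add: t_def less_imp_le)
  have Re_h: "Re (h P) \<le> 0" if "P \<in> monic_irreds" for P
    using bound[of P] that complex_Re_le_cmod[of "\<Phi> P"] by (simp add: h_def)
  \<comment> \<open>Expanding the square and using \<open>norm (\<Phi> P) \<le> 1\<close>. This
    turns the distance, which is linear in the real part, into control of second moments.\<close>
  have norm_h: "(norm (h P))\<^sup>2 \<le> 2 * (1 - Re (\<Phi> P))" if "P \<in> monic_irreds" for P
  proof -
    have "(norm (\<Phi> P))\<^sup>2 \<le> 1"
      using bound[of P] that by (simp add: power_le_one)
    then show ?thesis
      unfolding h_def cmod_power2 by (simp add: power2_eq_square algebra_simps)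
  qed
  have "(\<Sum>P\<in>L. t P) \<le> (\<Sum>P\<in>L. 2 * ((1 - Re (\<Phi> P)) / pnorm P))"
  proof (rule sum_mono)
    fix P assume "P \<in> L"
    then show "t P \<le> 2 * ((1 - Re (\<Phi> P)) / pnorm P)"
      using norm_h[of P] irr unfolding t_def by (auto simp: divide_right_mono less_imp_le)
  qed
  then have sumt: "(\<Sum>P\<in>L. t P) \<le> 2 * \<tau>"
    by (simp add: \<tau>_def sum_distrib_left)
  have sumt1: "(\<Sum>P\<in>L1. t P) \<le> 2 * \<tau>" "(\<Sum>P\<in>L2. t P) \<le> 2 * \<tau>"
    using sumt L12 fin' t0 sum_nonneg[of L1 t] sum_nonneg[of L2 t] by (auto simp: sum.union_disjoint)
  define e1 where "e1 f = (\<Sum>P\<in>L1. h P * of_bool (P dvd f))" for f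
  define e2 where "e2 f = (\<Sum>P\<in>L2. h P * of_bool (P dvd f))" for f
  \<comment> \<open>The mean runs over \<open>L1\<close> only, the primes for which the variance is
    computed exactly; its imaginary part is not controlled.\<close>
  define \<mu> where "\<mu> = (\<Sum>P\<in>L1. h P / of_real (pnorm P))"
  have Re_e: "Re (e1 f) \<le> 0" "Re (e2 f) \<le> 0" for f
    unfolding e1_def e2_def Re_sum using Re_h irr by (auto intro!: sum_nonpos)
  have Re_mu: "Re \<mu> \<le> 0"
    unfolding \<mu>_def Re_sum using Re_h irr by (auto intro!: sum_nonpos divide_nonpos_pos)
  have A: "avg n (\<lambda>f. norm (\<Phi> (f div ppart S f) - exp (e1 f + e2 f))) \<le> 2 * \<tau> + 2 * \<kappa>"
  proof -
    have "avg n (\<lambda>f. norm (\<Phi> (f div ppart S f) - exp (e1 f + e2 f))) \<le>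
        avg n (\<lambda>f. \<Sum>P\<in>L. (norm (h P))\<^sup>2 * of_bool (P dvd f) + 2 * of_bool (P\<^sup>2 dvd f))"
    proof (rule avg_mono)
      fix f :: "'a poly" assume f: "f \<in> monics_deg n"
      note fD = monics_degD[OF f]
      let ?r = "f div ppart S f"
      have dvd: "ppart S f dvd f"
        using ppart_dvd[OF fin(1) irr(1) fD(3)] .
      have rm: "?r \<in> monics"
        using fD dvd irr by (intro monics_div ppart_monic)
      have rf: "?r dvd f"
        using dvd by (metis dvd_div_mult_self dvd_triv_left)
      \<comment> \<open>Division by the smooth part removes the prime divisors of degree at most
        \<open>y\<close>, and those of degree above \<open>n\<close> cannot occur.\<close>
      have D: "{P. P \<in> monic_irreds \<and> P dvd ?r} = {P \<in> L. P dvd f}"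
      proof (intro equalityI subsetI)
        fix P assume P: "P \<in> {P. P \<in> monic_irreds \<and> P dvd ?r}"
        then have "P dvd f" "P \<notin> S"
          using rf dvd_trans ppart_coprime_cofactor[OF fin(1) irr(1) fD(3)] by auto
        moreover from this have "degree P \<le> n"
          using dvd_imp_degree_le fD by blast
        ultimately show "P \<in> {P \<in> L. P dvd f}"
          using P by (auto simp: S_def L_def)
      next
        fix P assume P: "P \<in> {P \<in> L. P dvd f}"
        then have Pi: "P \<in> monic_irreds" "P \<notin> S" "P dvd f"
          by (auto simp: S_def L_def)
        have "\<not> P dvd ppart S f"
          unfolding coprime_monic_irred_iff[OF Pi(1), symmetric] ppart_def
          using Pi irr by (intro poly_coprime_prod_right poly_coprime_power_right coprime_monic_irreds) auto
        moreover have "P dvd ppart S f * ?r"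
          using Pi dvd by simp
        ultimately show "P \<in> {P. P \<in> monic_irreds \<and> P dvd ?r}"
          using Pi monic_irred_dvd_mult_iff by blast
      qed
      have e: "e1 f + e2 f = (\<Sum>P | P \<in> monic_irreds \<and> P dvd ?r. \<Phi> P - 1)"
      proof -
        have "e1 f + e2 f = (\<Sum>P\<in>L. h P * of_bool (P dvd f))"
          unfolding e1_def e2_def L12(1) using fin' L12 by (simp only: sum.union_disjoint)
        also have "\<dots> = (\<Sum>P | P \<in> L \<and> P dvd f. h P)"
          using fin by (simp add: Int_def)
        finally show ?thesis
          unfolding D h_def .
      qed
      have "norm (\<Phi> ?r - exp (e1 f + e2 f)) \<le> (\<Sum>P | P \<in> L \<and> P dvd f. (norm (h P))\<^sup>2 + 2 * of_bool (P\<^sup>2 dvd ?r))"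
        using multiplicative_exp_approx[OF mult bound rm] unfolding e D h_def by simp
      also have "\<dots> \<le> (\<Sum>P | P \<in> L \<and> P dvd f. (norm (h P))\<^sup>2 + 2 * of_bool (P\<^sup>2 dvd f))"
        using rf dvd_trans by (intro sum_mono) auto
      also have "\<dots> = (\<Sum>P | P \<in> L \<and> P dvd f. (norm (h P))\<^sup>2 * of_bool (P dvd f) + 2 * of_bool (P\<^sup>2 dvd f))"
        by (intro sum.cong) auto
      also have "\<dots> \<le> (\<Sum>P\<in>L. (norm (h P))\<^sup>2 * of_bool (P dvd f) + 2 * of_bool (P\<^sup>2 dvd f))"
        using fin by (intro sum_mono2) auto
      finally show "norm (\<Phi> ?r - exp (e1 f + e2 f)) \<le> \<dots>" .
    qed
    also have "\<dots> = (\<Sum>P\<in>L. (norm (h P))\<^sup>2 * avg n (\<lambda>f. of_bool (P dvd f)) + 2 * avg n (\<lambda>f. of_bool (P\<^sup>2 dvd f)))"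
      unfolding avg_sum avg_add avg_cmult ..
    also have "\<dots> \<le> (\<Sum>P\<in>L. t P + 2 * (1 / (pnorm P)\<^sup>2))"
    proof (rule sum_mono)
      fix P assume "P \<in> L"
      then have P: "P \<in> monic_irreds"
        using irr by auto
      have "avg n (\<lambda>f. of_bool (P dvd f) :: real) \<le> 1 / pnorm P"
        using P by (intro avg_dvd_le) simp
      then have "(norm (h P))\<^sup>2 * avg n (\<lambda>f. of_bool (P dvd f)) \<le> t P"
        using mult_left_mono[of "avg n (\<lambda>f. of_bool (P dvd f))" "1 / pnorm P" "(norm (h P))\<^sup>2"] by (simp add: t_def)
      moreover have "avg n (\<lambda>f. of_bool (P\<^sup>2 dvd f) :: real) \<le> 1 / (pnorm P)\<^sup>2"
        using avg_dvd_le[of "P\<^sup>2" n] monics_power[of P 2] P monic_irreds_nonzero[OF P] by (simp add: pnorm_power)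
      ultimately show "(norm (h P))\<^sup>2 * avg n (\<lambda>f. of_bool (P dvd f)) + 2 * avg n (\<lambda>f. of_bool (P\<^sup>2 dvd f)) \<le> t P + 2 * (1 / (pnorm P)\<^sup>2)"
        by linarith
    qed
    also have "\<dots> = (\<Sum>P\<in>L. t P) + 2 * \<kappa>"
      unfolding \<kappa>_def sum.distrib sum_distrib_left ..
    finally show ?thesis
      using sumt by linarith
  qed
  have B: "avg n (\<lambda>f. norm (exp (e1 f + e2 f) - exp (e1 f))) \<le> sqrt (2 * \<tau>)"
  proof -
    have "avg n (\<lambda>f. norm (exp (e1 f + e2 f) - exp (e1 f))) \<le> avg n (\<lambda>f. \<Sum>P\<in>L2. norm (h P) * of_bool (P dvd f))"
    proof (rule avg_mono)
      fix f
      have "norm (exp (e1 f + e2 f) - exp (e1 f)) \<le> norm (e2 f)"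
        using norm_exp_diff_le[of "e1 f + e2 f" "e1 f"] Re_e[of f] by simp
      also have "\<dots> \<le> (\<Sum>P\<in>L2. norm (h P) * of_bool (P dvd f))"
        unfolding e2_def by (rule sum_norm_le) (simp add: norm_mult)
      finally show "norm (exp (e1 f + e2 f) - exp (e1 f)) \<le> \<dots>" .
    qed
    also have "\<dots> = (\<Sum>P\<in>L2. norm (h P) * avg n (\<lambda>f. of_bool (P dvd f)))"
      unfolding avg_sum avg_cmult ..
    also have "\<dots> \<le> (\<Sum>P\<in>L2. norm (h P) * (1 / pnorm P))"
      using irr by (intro sum_mono mult_left_mono avg_dvd_le) auto
    \<comment> \<open>The weight 1/|P| is split evenly for Cauchy-Schwarz: one half completes
      \<open>t P\<close>, the other leads to the sum bounded by
      \<open>sum_large_primes_le_1\<close>.\<close>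
    also have "\<dots> = (\<Sum>P\<in>L2. (norm (h P) / sqrt (pnorm P)) * (1 / sqrt (pnorm P)))"
      by (intro sum.cong) (auto simp: less_imp_le simp flip: real_sqrt_mult)
    also have "\<dots> \<le> sqrt ((\<Sum>P\<in>L2. (norm (h P) / sqrt (pnorm P))\<^sup>2) * (\<Sum>P\<in>L2. (1 / sqrt (pnorm P))\<^sup>2))"
      by (rule real_le_rsqrt) (rule Cauchy_Schwarz_ineq_sum)
    also have "\<dots> = sqrt ((\<Sum>P\<in>L2. t P) * (\<Sum>P\<in>L2. 1 / pnorm P))"
      by (simp add: t_def power_divide less_imp_le)
    also have "\<dots> \<le> sqrt (2 * \<tau> * 1)"
    proof (intro real_sqrt_le_mono mult_mono)
      show "(\<Sum>P\<in>L2. 1 / pnorm P) \<le> 1"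
        using fin' irr by (intro sum_large_primes_le_1[of L2 n]) (auto simp: L2_def L_def)
      show "0 \<le> (\<Sum>P\<in>L2. 1 / pnorm P)"
        by (intro sum_nonneg) (simp add: less_imp_le)
      show "0 \<le> 2 * \<tau>"
        using sum_nonneg[of L t, OF t0] sumt by linarith
    qed (use sumt1 in auto)
    finally show ?thesis
      by simp
  qed
  have C: "avg n (\<lambda>f. norm (exp (e1 f) - exp \<mu>)) \<le> sqrt (2 * \<tau>)"
  proof (rule real_le_rsqrt)
    have "(avg n (\<lambda>f. norm (exp (e1 f) - exp \<mu>)))\<^sup>2 \<le> avg n (\<lambda>f. (norm (exp (e1 f) - exp \<mu>))\<^sup>2)"
      by (rule avg_Cauchy_Schwarz)
    also have "\<dots> \<le> avg n (\<lambda>f. (norm (e1 f - \<mu>))\<^sup>2)"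
      using Re_e Re_mu by (intro avg_mono power_mono norm_exp_diff_le) auto
    also have "\<dots> \<le> (\<Sum>P\<in>L1. t P)"
      unfolding e1_def \<mu>_def t_def using fin' irr by (intro avg_dvd_variance) (auto simp: L1_def)
    finally show "(avg n (\<lambda>f. norm (exp (e1 f) - exp \<mu>)))\<^sup>2 \<le> 2 * \<tau>"
      using sumt1 by linarith
  qed
  have "avg n (\<lambda>f. norm (\<Phi> (f div ppart S f) - exp \<mu>)) \<le>
      avg n (\<lambda>f. norm (\<Phi> (f div ppart S f) - exp (e1 f + e2 f)) + norm (exp (e1 f + e2 f) - exp (e1 f)) + norm (exp (e1 f) - exp \<mu>))"
  proof (rule avg_mono)
    fix f
    have "\<Phi> (f div ppart S f) - exp \<mu> = (\<Phi> (f div ppart S f) - exp (e1 f + e2 f)) + (exp (e1 f + e2 f) - exp (e1 f)) + (exp (e1 f) - exp \<mu>)"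
      by simp
    then show "norm (\<Phi> (f div ppart S f) - exp \<mu>) \<le> norm (\<Phi> (f div ppart S f) - exp (e1 f + e2 f)) + norm (exp (e1 f + e2 f) - exp (e1 f)) + norm (exp (e1 f) - exp \<mu>)"
      using norm_triangle_ineq[of "(\<Phi> (f div ppart S f) - exp (e1 f + e2 f)) + (exp (e1 f + e2 f) - exp (e1 f))" "exp (e1 f) - exp \<mu>"]
        norm_triangle_ineq[of "\<Phi> (f div ppart S f) - exp (e1 f + e2 f)" "exp (e1 f + e2 f) - exp (e1 f)"]
      by simp
  qed
  also have "\<dots> \<le> 2 * \<tau> + 2 * \<kappa> + 2 * sqrt (2 * \<tau>)"
    unfolding avg_add using A B C by linarith
  finally have "avg n (\<lambda>f. norm (\<Phi> (f div ppart S f) - exp \<mu>)) \<le> 2 * \<tau> + 2 * \<kappa> + 2 * sqrt (2 * \<tau>)" .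
  moreover have "norm (exp \<mu>) \<le> 1"
    using Re_mu by (simp add: norm_exp_eq_Re)
  \<comment> \<open>The first-order lower bound for \<open>exp (2 * Re \<mu>)\<close>; here
    \<open>- Re \<mu> \<le> \<tau>\<close> because \<open>\<tau>\<close> sums the same nonnegative
    terms over the larger set \<open>L\<close>.\<close>
  moreover have "1 - (norm (exp \<mu>))\<^sup>2 \<le> 2 * \<tau>"
  proof -
    have "(norm (exp \<mu>))\<^sup>2 = exp (2 * Re \<mu>)"
      by (simp add: norm_exp_eq_Re power2_eq_square flip: exp_add)
    moreover have "1 + 2 * Re \<mu> \<le> exp (2 * Re \<mu>)"
      by (rule exp_ge_add_one_self)
    moreover have "- Re \<mu> \<le> \<tau>"
    proof -
      have "- Re \<mu> = (\<Sum>P\<in>L1. (1 - Re (\<Phi> P)) / pnorm P)"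
        unfolding \<mu>_def Re_sum sum_negf[symmetric] h_def
        by (intro sum.cong refl) (simp add: minus_divide_left)
      also have "\<dots> \<le> \<tau>"
        unfolding \<tau>_def
      proof (rule sum_mono2[OF fin(2)])
        show "L1 \<subseteq> L"
          by (auto simp: L1_def)
        show "0 \<le> (1 - Re (\<Phi> P)) / pnorm P" if "P \<in> L - L1" for P
          using that irr Re_h[of P] by (auto simp: h_def less_imp_le)
      qed
      finally show ?thesis .
    qed
    ultimately show ?thesis
      by linarith
  qed
  ultimately show ?thesis
    using that by blast
qed

text \<open>Both rough parts are close on average to the same \<open>c\<close>, so their joint
  distribution does not enter. The bound is twice that of the concentration, plus
  \<open>2 * \<tau>\<close> for the distance of \<open>c * cnj c\<close> from 1.\<close>

lemma rough_part_correlation: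
  fixes \<Phi> :: "'a::{field,finite} poly \<Rightarrow> complex" and y n :: nat
  assumes mult: "multiplicative \<Phi>" and bound: "\<And>f. f \<in> monics \<Longrightarrow> norm (\<Phi> f) \<le> 1" and n: "n \<ge> 1"
  defines "S \<equiv> {P \<in> monic_irreds. degree P \<le> y}"
    and "L \<equiv> {P \<in> monic_irreds. y < degree P \<and> degree P \<le> n}"
  defines "\<tau> \<equiv> \<Sum>P\<in>L. (1 - Re (\<Phi> P)) / pnorm P" and "\<kappa> \<equiv> \<Sum>P\<in>L. 1 / (pnorm P)\<^sup>2"
  shows "avg n (\<lambda>f. norm (\<Phi> (f div ppart S f) * cnj (\<Phi> ((f + 1) div ppart S (f + 1))) - 1))
    \<le> 6 * \<tau> + 4 * \<kappa> + 4 * sqrt (2 * \<tau>)"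
proof -
  obtain c where c: "norm c \<le> 1" "1 - (norm c)\<^sup>2 \<le> 2 * \<tau>"
    "avg n (\<lambda>f. norm (\<Phi> (f div ppart S f) - c)) \<le> 2 * \<tau> + 2 * \<kappa> + 2 * sqrt (2 * \<tau>)"
    unfolding S_def \<tau>_def \<kappa>_def L_def
    using rough_part_concentration[OF mult bound, where n = n and y = y] by blast
  let ?A = "\<lambda>f. \<Phi> (f div ppart S f)"
  have fin: "finite S"
    unfolding S_def by (rule finite_subset[OF _ finite_degree_le]) auto
  have irr: "S \<subseteq> monic_irreds"
    by (auto simp: S_def)
  have A1: "norm (?A f) \<le> 1" if "f \<in> monics" for f
    using that ppart_dvd[OF fin irr monics_nonzero[OF that]] ppart_monic[OF irr] by (intro bound monics_div)
  have "avg n (\<lambda>f. norm (?A f * cnj (?A (f + 1)) - 1)) \<le>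
      avg n (\<lambda>f. norm (?A f - c) + norm (?A (f + 1) - c) + 2 * \<tau>)"
  proof (rule avg_mono)
    fix f :: "'a poly" assume f: "f \<in> monics_deg n"
    let ?B = "?A (f + 1)"
    have B: "norm ?B \<le> 1"
      using monics_degD[OF monics_deg_add_1[OF f n]] A1 by blast
    have c2: "(norm c)\<^sup>2 \<le> 1"
      using c by (simp add: power_le_one)
    have "c * cnj c - 1 = of_real ((norm c)\<^sup>2 - 1)"
      using complex_norm_square[of c] by simp
    then have 3: "norm (c * cnj c - 1) \<le> 2 * \<tau>"
      using c(2) c2 by (simp only: norm_of_real)
    have 1: "norm ((?A f - c) * cnj ?B) \<le> norm (?A f - c)"
      unfolding norm_mult using B by (intro mult_left_le) auto
    have "norm (c * cnj (?B - c)) \<le> norm (?B - c)"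
      unfolding norm_mult complex_mod_cnj using c by (intro mult_left_le_one_le) auto
    then have 2: "norm (c * (cnj ?B - cnj c)) \<le> norm (?B - c)"
      by simp
    have eq: "?A f * cnj ?B - 1 = (?A f - c) * cnj ?B + c * (cnj ?B - cnj c) + (c * cnj c - 1)"
      by (simp add: algebra_simps)
    have "norm (?A f * cnj ?B - 1) \<le> norm ((?A f - c) * cnj ?B) + norm (c * (cnj ?B - cnj c)) + norm (c * cnj c - 1)"
      using norm_triangle_ineq[of "(?A f - c) * cnj ?B + c * (cnj ?B - cnj c)" "c * cnj c - 1"]
        norm_triangle_ineq[of "(?A f - c) * cnj ?B" "c * (cnj ?B - cnj c)"] unfolding eq by linarith
    then show "norm (?A f * cnj ?B - 1) \<le> norm (?A f - c) + norm (?B - c) + 2 * \<tau>"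
      using 1 2 3 by linarith
  qed
  also have "\<dots> = avg n (\<lambda>f. norm (?A f - c)) + avg n (\<lambda>f. norm (?A (f + 1) - c)) + 2 * \<tau>"
    unfolding avg_add avg_const ..
  also have "avg n (\<lambda>f. norm (?A (f + 1) - c)) = avg n (\<lambda>f. norm (?A f - c))"
    using n by (rule avg_shift)
  finally show ?thesis
    using c(3) by linarith
qed

subsection \<open>Unordered sums and products over the irreducible polynomials\<close>

lemma summable_on_le:
  fixes f g :: "'b \<Rightarrow> real"
  assumes g: "g summable_on A" and "\<And>x. x \<in> A \<Longrightarrow> 0 \<le> f x" "\<And>x. x \<in> A \<Longrightarrow> f x \<le> g x"
  shows "f summable_on A"
proof (rule nonneg_bdd_above_summable_on)
  have g0: "0 \<le> g x" if "x \<in> A" for x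
    using assms(2,3)[OF that] by linarith
  show "bdd_above (sum f ` {F. F \<subseteq> A \<and> finite F})"
  proof (rule bdd_aboveI2)
    fix F assume F: "F \<in> {F. F \<subseteq> A \<and> finite F}"
    then have "sum f F \<le> sum g F"
      using assms(3) by (intro sum_mono) auto
    also have "\<dots> \<le> infsum g A"
      using F g g0 by (intro finite_sum_le_infsum) auto
    finally show "sum f F \<le> infsum g A" .
  qed
qed (use assms in auto)

lemma summable_on_tail:
  fixes t :: "'b \<Rightarrow> real"
  assumes "t summable_on A" "e > 0"
  obtains X where "finite X" "X \<subseteq> A" "\<And>Y. finite Y \<Longrightarrow> Y \<subseteq> A - X \<Longrightarrow> \<bar>sum t Y\<bar> < e"
proof -
  obtain s where "(t has_sum s) A"
    using assms(1) by (auto simp: summable_on_def)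
  then have "eventually (\<lambda>X. dist (sum t X) s < e / 2) (finite_subsets_at_top A)"
    unfolding has_sum_def using assms(2) by (intro tendstoD) auto
  then obtain X where X: "finite X" "X \<subseteq> A"
    "\<forall>Y. finite Y \<and> X \<subseteq> Y \<and> Y \<subseteq> A \<longrightarrow> dist (sum t Y) s < e / 2"
    unfolding eventually_finite_subsets_at_top by (elim exE conjE)
  show ?thesis
  proof (rule that[OF X(1,2)])
    fix Y assume Y: "finite Y" "Y \<subseteq> A - X"
    have "sum t (X \<union> Y) = sum t X + sum t Y"
      using X Y by (intro sum.union_disjoint) auto
    moreover have "dist (sum t (X \<union> Y)) s < e / 2" "dist (sum t X) s < e / 2"
      using X(1,2) X(3)[rule_format, of "X \<union> Y"] X(3)[rule_format, of X] Y by auto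
    ultimately show "\<bar>sum t Y\<bar> < e"
      unfolding dist_real_def by linarith
  qed
qed

text \<open>Outside a finite \<open>X0\<close> the factors lie within 1/2 of 1, so their logarithms
  form a summable family. The factors in \<open>X0\<close>, which may vanish or be negative, are
  multiplied in separately.\<close>

lemma has_unordered_prod_exists:
  fixes F :: "'b \<Rightarrow> real"
  assumes "(\<lambda>x. \<bar>F x - 1\<bar>) summable_on A"
  shows "\<exists>p. has_unordered_prod F A p"
proof -
  obtain X0 where X0: "finite X0" "X0 \<subseteq> A"
    "\<And>Y. finite Y \<Longrightarrow> Y \<subseteq> A - X0 \<Longrightarrow> \<bar>\<Sum>x\<in>Y. \<bar>F x - 1\<bar>\<bar> < 1 / 2"
    using summable_on_tail[OF assms, of "1 / 2"] by auto
  have small: "\<bar>F x - 1\<bar> < 1 / 2" if "x \<in> A - X0" for x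
    using X0(3)[of "{x}"] that by simp
  have ln_le: "\<bar>ln (F x)\<bar> \<le> 2 * \<bar>F x - 1\<bar>" if x: "x \<in> A - X0" for x
  proof -
    let ?u = "F x - 1"
    have "\<bar>ln (F x) - ?u\<bar> \<le> 2 * ?u\<^sup>2"
      using abs_ln_one_plus_x_minus_x_bound[of ?u] small[OF x] by simp
    moreover have "2 * ?u\<^sup>2 \<le> \<bar>?u\<bar>"
    proof -
      have "\<bar>?u\<bar> * (2 * \<bar>?u\<bar>) \<le> \<bar>?u\<bar> * 1"
        using small[OF x] by (intro mult_left_mono) auto
      then show ?thesis
        by (simp add: power2_eq_square abs_mult_self_eq)
    qed
    moreover have "\<bar>a\<bar> \<le> 2 * \<bar>u\<bar>" if "\<bar>a - u\<bar> \<le> w" "w \<le> \<bar>u\<bar>" for a u w :: real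
      using that by linarith
    ultimately show ?thesis
      by blast
  qed
  have "(\<lambda>x. \<bar>F x - 1\<bar>) summable_on A - X0"
    by (rule summable_on_subset_banach[OF assms]) auto
  then have "(\<lambda>x. 2 * \<bar>F x - 1\<bar>) summable_on A - X0"
    by (rule summable_on_cmult_right)
  then have "(\<lambda>x. norm (ln (F x))) summable_on A - X0"
    by (rule summable_on_le) (use ln_le in auto)
  then have "(\<lambda>x. ln (F x)) summable_on A - X0"
    by (rule abs_summable_summable)
  then obtain s where "((\<lambda>x. ln (F x)) has_sum s) (A - X0)"
    by (auto simp: summable_on_def)
  then have "((\<lambda>X. \<Sum>x\<in>X. ln (F x)) \<longlongrightarrow> s) (finite_subsets_at_top (A - X0))"
    by (simp add: has_sum_def)
  then have lim: "((\<lambda>X. exp (\<Sum>x\<in>X. ln (F x))) \<longlongrightarrow> exp s) (finite_subsets_at_top (A - X0))"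
    by (rule tendsto_exp)
  \<comment> \<open>Every finite subset of \<open>A - X0\<close> is eventually contained in
    \<open>X - X0\<close>, which transfers the limit from \<open>A - X0\<close> to
    \<open>A\<close>.\<close>
  have "filterlim (\<lambda>X. X - X0) (finite_subsets_at_top (A - X0)) (finite_subsets_at_top A)"
    unfolding filterlim_finite_subsets_at_top eventually_finite_subsets_at_top
  proof (intro allI impI)
    fix X assume "finite X \<and> X \<subseteq> A - X0"
    then show "\<exists>Z. finite Z \<and> Z \<subseteq> A \<and> (\<forall>Y. finite Y \<and> Z \<subseteq> Y \<and> Y \<subseteq> A \<longrightarrow>
        finite (Y - X0) \<and> X \<subseteq> Y - X0 \<and> Y - X0 \<subseteq> A - X0)"
      by (intro exI[of _ X]) auto
  qed
  then have "((\<lambda>X. (\<Prod>x\<in>X0. F x) * exp (\<Sum>x\<in>X - X0. ln (F x))) \<longlongrightarrow> (\<Prod>x\<in>X0. F x) * exp s) (finite_subsets_at_top A)"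
    by (intro tendsto_mult tendsto_const filterlim_compose[OF lim])
  moreover have "eventually (\<lambda>X. (\<Prod>x\<in>X0. F x) * exp (\<Sum>x\<in>X - X0. ln (F x)) = (\<Prod>x\<in>X. F x)) (finite_subsets_at_top A)"
    unfolding eventually_finite_subsets_at_top
  proof (intro exI[of _ X0] conjI allI impI X0(1,2))
    fix Y assume Y: "finite Y \<and> X0 \<subseteq> Y \<and> Y \<subseteq> A"
    have "exp (\<Sum>x\<in>Y - X0. ln (F x)) = (\<Prod>x\<in>Y - X0. exp (ln (F x)))"
      using Y by (intro exp_sum) auto
    also have "\<dots> = (\<Prod>x\<in>Y - X0. F x)"
    proof (intro prod.cong refl exp_ln)
      fix x assume "x \<in> Y - X0"
      then show "0 < F x"
        using small[of x] Y by (auto simp: abs_if split: if_splits)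
    qed
    finally show "(\<Prod>x\<in>X0. F x) * exp (\<Sum>x\<in>Y - X0. ln (F x)) = (\<Prod>x\<in>Y. F x)"
      using Y prod.subset_diff[of X0 Y F] by (simp add: mult.commute)
  qed
  ultimately show ?thesis
    unfolding has_unordered_prod_def using Lim_transform_eventually by blast
qed

text \<open>The sum over all monics is already bounded by a geometric series: with q the size of the
  field, degree d contributes q^d polynomials of weight q^(-2d).\<close>

lemma summable_on_inverse_pnorm_square:
  "(\<lambda>P. 1 / (pnorm P)\<^sup>2) summable_on (monic_irreds :: 'a::{field,finite} poly set)"
proof (rule nonneg_bdd_above_summable_on)
  show "bdd_above (sum (\<lambda>P. 1 / (pnorm P)\<^sup>2) ` {F. F \<subseteq> (monic_irreds :: 'a poly set) \<and> finite F})"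
  proof (rule bdd_aboveI2)
    fix F assume F: "F \<in> {F. F \<subseteq> (monic_irreds :: 'a poly set) \<and> finite F}"
    define N where "N = Max (insert 0 (degree ` F))"
    have N: "degree P \<le> N" if "P \<in> F" for P
      unfolding N_def using F that by (intro Max_ge) auto
    have "(\<Sum>P\<in>F. 1 / (pnorm P)\<^sup>2) \<le> (\<Sum>P\<in>(\<Union>d\<in>{..N}. (monics_deg d :: 'a poly set)). 1 / (pnorm P)\<^sup>2)"
    proof (rule sum_mono2)
      show "F \<subseteq> (\<Union>d\<in>{..N}. monics_deg d)"
        using F N by (auto simp: monics_deg_def)
    qed auto
    also have "\<dots> = (\<Sum>d\<le>N. \<Sum>P\<in>(monics_deg d :: 'a poly set). 1 / (pnorm P)\<^sup>2)"
      by (rule sum.UNION_disjoint) (auto dest: monics_degD)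
    also have "\<dots> = (\<Sum>d\<le>N. \<Sum>P\<in>(monics_deg d :: 'a poly set). 1 / (real CARD('a) ^ d)\<^sup>2)"
      by (intro sum.cong) (auto simp: monics_deg_def pnorm_def)
    also have "\<dots> = (\<Sum>d\<le>N. 1 / real CARD('a) ^ d)"
      by (simp add: card_monics_deg power2_eq_square)
    also have "\<dots> \<le> (\<Sum>d\<le>N. (1 / 2) ^ d)"
    proof (rule sum_mono)
      fix d
      have "(2 :: real) ^ d \<le> real CARD('a) ^ d"
        using CARD_field_ge_2[where ?'a = 'a] by (intro power_mono) auto
      then show "1 / real CARD('a) ^ d \<le> (1 / 2) ^ d"
        by (simp add: power_divide frac_le)
    qed
    also have "\<dots> \<le> (\<Sum>d. (1 / 2) ^ d)"
      by (intro sum_le_suminf) (auto simp: summable_geometric)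
    finally show "(\<Sum>P\<in>F. 1 / (pnorm P)\<^sup>2) \<le> (\<Sum>d. (1 / 2) ^ d)" .
  qed
qed auto

text \<open>The finite exceptional set of an unordered sum has bounded degree, so a cut-off by
  degree works as well. That \<open>y0\<close> does not depend on \<open>n\<close> makes the error
  terms uniform in \<open>n\<close>.\<close>

lemma degree_tail:
  fixes t :: "'a::{field,finite} poly \<Rightarrow> real"
  assumes "t summable_on monic_irreds" "e > 0"
  shows "\<exists>y0. \<forall>y\<ge>y0. \<forall>n. (\<Sum>P | P \<in> monic_irreds \<and> y < degree P \<and> degree P \<le> n. t P) < e"
proof -
  obtain X where X: "finite X" "X \<subseteq> monic_irreds" "\<And>Y. finite Y \<Longrightarrow> Y \<subseteq> monic_irreds - X \<Longrightarrow> \<bar>sum t Y\<bar> < e"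
    using summable_on_tail[OF assms] by blast
  define y0 where "y0 = Max (insert 0 (degree ` X))"
  have y0: "degree P \<le> y0" if "P \<in> X" for P
    unfolding y0_def using X that by (intro Max_ge) auto
  show ?thesis
  proof (intro exI[of _ y0] allI impI)
    fix y n assume y: "y \<ge> y0"
    have "\<bar>\<Sum>P | P \<in> monic_irreds \<and> y < degree P \<and> degree P \<le> n. t P\<bar> < e"
    proof (rule X(3))
      show "finite {P. P \<in> (monic_irreds :: 'a poly set) \<and> y < degree P \<and> degree P \<le> n}"
        by (rule finite_subset[OF _ finite_degree_le[of n]]) auto
      show "{P. P \<in> monic_irreds \<and> y < degree P \<and> degree P \<le> n} \<subseteq> monic_irreds - X"
      proof
        fix P :: "'a poly" assume P: "P \<in> {P. P \<in> monic_irreds \<and> y < degree P \<and> degree P \<le> n}"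
        then have "P \<notin> X"
          using y y0[of P] by auto
        then show "P \<in> monic_irreds - X"
          using P by simp
      qed
    qed
    then show "(\<Sum>P | P \<in> monic_irreds \<and> y < degree P \<and> degree P \<le> n. t P) < e"
      by linarith
  qed
qed

text \<open>The difference with \<open>i = 0\<close> gives the term of the distance, the others a
  geometric tail. The constant 8 collects a 2 from the local factor, a 2 from the bound on
  \<open>c i\<close>, and a 2 from 1 / (1 - x) with \<open>x \<le> 1 / 2\<close>. The product over
  the primes converges by this bound.\<close>

lemma local_factor_minus_1_le:
  fixes \<phi> :: "'a::{field,finite} poly \<Rightarrow> complex"
  assumes P: "P \<in> monic_irreds" and 1: "\<phi> 1 = 1" and bound: "\<And>i. norm (\<phi> (P ^ i)) \<le> 1"
  shows "\<bar>local_factor \<phi> P - 1\<bar> \<le> 2 * ((1 - Re (\<phi> P)) / pnorm P) + 8 * (1 / (pnorm P)\<^sup>2)"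
proof -
  define x where "x = 1 / pnorm P"
  have x: "0 \<le> x" "x \<le> 1 / 2"
    using pnorm_irred_ge_2[OF P] by (auto simp: x_def field_simps)
  define c where "c = (\<lambda>i. \<phi> (P ^ Suc i) - \<phi> (P ^ i))"
  define d where "d = (\<lambda>i. Re (c i) * x ^ Suc i)"
  have c2: "\<bar>Re (c i)\<bar> \<le> 2" for i
    unfolding c_def using norm_triangle_ineq4[of "\<phi> (P ^ Suc i)" "\<phi> (P ^ i)"] bound[of i] bound[of "Suc i"]
      abs_Re_le_cmod[of "\<phi> (P ^ Suc i) - \<phi> (P ^ i)"]
    by linarith
  have d: "d = (\<lambda>i. Re (c i) / pnorm P ^ Suc i)"
    by (simp add: d_def x_def power_divide fun_eq_iff)
  have sd: "summable d" and F: "local_factor \<phi> P - 1 = 2 * (\<Sum>i. d i)"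
    unfolding d c_def using local_factor_conv_differences[OF P 1 bound] by simp_all
  have geo: "summable (\<lambda>i. 2 * x\<^sup>2 * x ^ i)"
    using x by (intro summable_mult summable_geometric) auto
  have le: "\<bar>d (Suc i)\<bar> \<le> 2 * x\<^sup>2 * x ^ i" for i
  proof -
    have "\<bar>d (Suc i)\<bar> = \<bar>Re (c (Suc i))\<bar> * (x\<^sup>2 * x ^ i)"
      using x by (simp add: d_def abs_mult power2_eq_square mult_ac)
    also have "\<dots> \<le> 2 * (x\<^sup>2 * x ^ i)"
      using c2 x by (intro mult_right_mono) auto
    finally show ?thesis
      by simp
  qed
  have "\<bar>\<Sum>i. d (Suc i)\<bar> \<le> (\<Sum>i. 2 * x\<^sup>2 * x ^ i)"
  proof -
    have s: "summable (\<lambda>i. \<bar>d (Suc i)\<bar>)"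
      using le by (intro summable_comparison_test'[OF geo, of 0]) auto
    then have "\<bar>\<Sum>i. d (Suc i)\<bar> \<le> (\<Sum>i. \<bar>d (Suc i)\<bar>)"
      by (rule summable_rabs)
    also have "\<dots> \<le> (\<Sum>i. 2 * x\<^sup>2 * x ^ i)"
      using le s geo by (intro suminf_le) auto
    finally show ?thesis .
  qed
  also have "\<dots> = 2 * x\<^sup>2 * (1 / (1 - x))"
    using x by (subst suminf_mult) (auto simp: summable_geometric suminf_geometric)
  also have "\<dots> \<le> 2 * x\<^sup>2 * 2"
    using x by (intro mult_left_mono) (auto simp: field_simps)
  finally have tail: "\<bar>\<Sum>i. d (Suc i)\<bar> \<le> 4 * x\<^sup>2"
    by simp
  have "d 0 = - ((1 - Re (\<phi> P)) / pnorm P)"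
    using 1 by (simp add: d_def c_def x_def minus_divide_left)
  moreover have "Re (\<phi> P) \<le> 1"
    using bound[of 1] complex_Re_le_cmod[of "\<phi> P"] by simp
  ultimately have "\<bar>d 0\<bar> = (1 - Re (\<phi> P)) / pnorm P"
    by (simp add: less_imp_le)
  moreover have "(\<Sum>i. d i) = d 0 + (\<Sum>i. d (Suc i))"
    using suminf_split_head[OF sd] by simp
  ultimately show ?thesis
  proof -
    assume d0: "\<bar>d 0\<bar> = (1 - Re (\<phi> P)) / pnorm P" and "(\<Sum>i. d i) = d 0 + (\<Sum>i. d (Suc i))"
    then have "\<bar>2 * (\<Sum>i. d i)\<bar> \<le> 2 * ((1 - Re (\<phi> P)) / pnorm P) + 8 * x\<^sup>2"
      using tail by linarith
    then show ?thesis
      unfolding F by (simp add: x_def power_divide)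
  qed
qed

subsection \<open>The correlation formula\<close>

context multiplicative_with_char
begin

lemma chi_prod: "chi (\<Prod>x\<in>A. f x) = (\<Prod>x\<in>A. chi (f x))"
  by (induction A rule: infinite_finite_induct) (simp_all add: chi_mult)

lemma chi_cnj_self: "coprime f Q \<Longrightarrow> chi f * cnj (chi f) = 1"
  using norm_chi[of f] complex_norm_square[of "chi f"] by simp

lemma twisted_multiplicative:
  "multiplicative (\<lambda>f. \<psi> f * cnj (chi f))" "f \<in> monics \<Longrightarrow> norm (\<psi> f * cnj (chi f)) \<le> 1"
proof -
  show "multiplicative (\<lambda>f. \<psi> f * cnj (chi f))"
    using psi_mult by (auto simp: multiplicative_def chi_mult)
  show "norm (\<psi> f * cnj (chi f)) \<le> 1" if "f \<in> monics"
    using psi_bound[OF that] norm_chi_le by (intro norm_mult_le_1) auto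
qed

text \<open>\<open>Psi f\<close> carries \<open>chi\<close> of the whole cofactor prime to
  \<open>Q\<close>. Since \<open>chi f * cnj (chi f)\<close> is 1 for \<open>f\<close> prime to
  \<open>Q\<close>, the factors \<open>\<Phi>\<close> restore \<open>\<psi>\<close>: prime by prime
  on \<open>T\<close>, and as one value on the rough rest.\<close>

lemma psi_decompose:
  fixes T :: "'a poly set"
  assumes f: "f \<in> monics" and T: "finite T" "T \<subseteq> monic_irreds" "QP \<inter> T = {}"
  defines "\<Phi> \<equiv> \<lambda>f. \<psi> f * cnj (chi f)"
  shows "\<psi> f = Psi f * (\<Prod>P\<in>T. \<Phi> (P ^ pval P f)) * \<Phi> (f div ppart (QP \<union> T) f)"
proof -
  let ?S = "QP \<union> T"
  have fin: "finite ?S" and irr: "?S \<subseteq> monic_irreds"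
    using T QP_irreds by auto
  have f0: "f \<noteq> 0"
    using f monics_nonzero by blast
  let ?r = "f div ppart ?S f"
  have pp: "ppart ?S f = ppart QP f * ppart T f"
    unfolding ppart_def using T by (intro prod.union_disjoint) auto
  have "ppart ?S f * ?r = f"
    using ppart_dvd[OF fin irr f0] by simp
  then have "f = ppart QP f * (ppart T f * ?r)"
    unfolding pp by (simp add: mult.assoc)
  moreover have "ppart QP f \<noteq> 0"
    using ppart_monic[OF QP_irreds] monics_nonzero by blast
  ultimately have div: "f div ppart QP f = ppart T f * ?r"
    by (metis nonzero_mult_div_cancel_left)
  have cop_r: "coprime ?r Q"
    using ppart_coprime_cofactor[OF fin irr f0] by (auto simp: coprime_Q_iff)
  have cop_P: "coprime (P ^ k) Q" if "P \<in> T" for P k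
  proof (intro poly_coprime_power_left)
    have "P \<in> monic_irreds" "P \<notin> QP"
      using that T by auto
    then show "coprime P Q"
      by (simp add: coprime_monic_irred_iff QP_def)
  qed
  have "\<psi> f = \<psi> (ppart ?S f) * \<psi> ?r"
    by (rule multiplicative_split[OF psi_mult fin irr f])
  also have "\<psi> (ppart ?S f) = (\<Prod>P\<in>?S. \<psi> (P ^ pval P f))"
    by (rule multiplicative_ppart[OF psi_mult fin irr])
  also have "\<dots> = (\<Prod>P\<in>QP. \<psi> (P ^ pval P f)) * (\<Prod>P\<in>T. \<psi> (P ^ pval P f))"
    using T by (intro prod.union_disjoint) auto
  also have "(\<Prod>P\<in>QP. \<psi> (P ^ pval P f)) = \<psi> (ppart QP f)"
    by (rule multiplicative_ppart[OF psi_mult finite_QP QP_irreds, symmetric])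
  finally have 1: "\<psi> f = \<psi> (ppart QP f) * (\<Prod>P\<in>T. \<psi> (P ^ pval P f)) * \<psi> ?r" .
  have 2: "Psi f = \<psi> (ppart QP f) * ((\<Prod>P\<in>T. chi (P ^ pval P f)) * chi ?r)"
    unfolding Psi_def div chi_mult by (simp add: ppart_def chi_prod)
  have "(\<Prod>P\<in>T. chi (P ^ pval P f)) * (\<Prod>P\<in>T. \<Phi> (P ^ pval P f)) = (\<Prod>P\<in>T. \<psi> (P ^ pval P f))"
    unfolding prod.distrib[symmetric]
  proof (rule prod.cong[OF refl])
    fix P assume "P \<in> T"
    then show "chi (P ^ pval P f) * \<Phi> (P ^ pval P f) = \<psi> (P ^ pval P f)"
      using chi_cnj_self[OF cop_P] by (simp add: \<Phi>_def mult.left_commute)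
  qed
  moreover have "chi ?r * \<Phi> ?r = \<psi> ?r"
    using chi_cnj_self[OF cop_r] by (simp add: \<Phi>_def mult.left_commute)
  moreover have "Psi f * (\<Prod>P\<in>T. \<Phi> (P ^ pval P f)) * \<Phi> ?r =
      \<psi> (ppart QP f) * ((\<Prod>P\<in>T. chi (P ^ pval P f)) * (\<Prod>P\<in>T. \<Phi> (P ^ pval P f))) * (chi ?r * \<Phi> ?r)"
    unfolding 2 by (simp only: mult_ac)
  ultimately show ?thesis
    using 1 by simp
qed

text \<open>The average of \<open>G y\<close> converges in \<open>n\<close> to a partial product,
  because \<open>G y\<close> involves only \<open>Psi\<close> and the valuations at the primes of
  \<open>T y\<close>. As \<open>approx\<close> bounds the remaining error uniformly in
  \<open>n\<close>, a large \<open>y\<close> can be fixed first and \<open>n\<close> taken large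
  afterwards.\<close>

lemma correlation_limit:
  defines "\<Phi> \<equiv> \<lambda>f. \<psi> f * cnj (chi f)"
  assumes summ: "(\<lambda>P. (1 - Re (\<Phi> P)) / pnorm P) summable_on monic_irreds"
  shows "\<exists>p. has_unordered_prod (local_factor \<Phi>) {P \<in> monic_irreds. \<not> P dvd Q} p \<and>
    (\<lambda>n. avg n (\<lambda>f. \<psi> f * cnj (\<psi> (f + 1)))) \<longlonglongrightarrow> complex_of_real (pmoebius Q / pnorm Q * p)"
proof -
  let ?A = "{P \<in> monic_irreds. \<not> P dvd Q}"
  let ?t = "\<lambda>P. (1 - Re (\<Phi> P)) / pnorm P" and ?s = "\<lambda>P :: 'a poly. 1 / (pnorm P)\<^sup>2"
  let ?m = "of_real (pmoebius Q / pnorm Q) :: complex"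
  have mult: "multiplicative \<Phi>" and bound: "\<And>f. f \<in> monics \<Longrightarrow> norm (\<Phi> f) \<le> 1"
    unfolding \<Phi>_def using twisted_multiplicative by auto
  have Phi1: "\<Phi> 1 = 1"
    using mult by (simp add: multiplicative_def)
  have boundP: "norm (\<Phi> (P ^ i)) \<le> 1" if "P \<in> monic_irreds" for P i
    using that by (intro bound monics_power) simp
  have t0: "0 \<le> ?t P" if "P \<in> monic_irreds" for P
    using boundP[OF that, of 1] complex_Re_le_cmod[of "\<Phi> P"] by (simp add: less_imp_le)
  have "(\<lambda>P. 2 * ?t P + 8 * ?s P) summable_on monic_irreds"
    by (intro summable_on_add summable_on_cmult_right summ summable_on_inverse_pnorm_square)
  then have "(\<lambda>P. \<bar>local_factor \<Phi> P - 1\<bar>) summable_on monic_irreds"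
  proof (rule summable_on_le)
    show "\<bar>local_factor \<Phi> P - 1\<bar> \<le> 2 * ?t P + 8 * ?s P" if "P \<in> monic_irreds" for P
      using local_factor_minus_1_le[of P \<Phi>, OF that Phi1 boundP[OF that]] .
  qed simp
  then have "(\<lambda>P. \<bar>local_factor \<Phi> P - 1\<bar>) summable_on ?A"
    by (rule summable_on_subset_banach) auto
  then obtain p where p: "has_unordered_prod (local_factor \<Phi>) ?A p"
    using has_unordered_prod_exists by blast
  define T where "T y = {P \<in> ?A. degree P \<le> y}" for y
  have T: "finite (T y)" "T y \<subseteq> monic_irreds" "QP \<inter> T y = {}" for y
  proof -
    show "finite (T y)"
      by (rule finite_subset[OF _ finite_degree_le[of y]]) (auto simp: T_def)
  qed (auto simp: T_def QP_def)
  \<comment> \<open>For \<open>y \<ge> degree Q\<close> no prime of \<open>Q\<close> has degree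
    above \<open>y\<close>, so the primes already split off are exactly the small ones.\<close>
  have S: "QP \<union> T y = {P \<in> monic_irreds. degree P \<le> y}" if "y \<ge> degree Q" for y
  proof -
    have "degree P \<le> y" if "P dvd Q" for P
      using dvd_imp_degree_le[OF that Q_nonzero] \<open>degree Q \<le> y\<close> by simp
    then show ?thesis
      by (auto simp: T_def QP_def)
  qed
  have "filterlim T (finite_subsets_at_top ?A) sequentially"
    unfolding filterlim_finite_subsets_at_top
  proof (intro allI impI)
    fix X assume X: "finite X \<and> X \<subseteq> ?A"
    have "X \<subseteq> T y" if "y \<ge> Max (insert 0 (degree ` X))" for y
    proof
      fix P assume P: "P \<in> X"
      have "degree P \<le> Max (insert 0 (degree ` X))"
        using X P by (intro Max_ge) auto
      then show "P \<in> T y"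
        using X P that by (auto simp: T_def)
    qed
    then show "eventually (\<lambda>y. finite (T y) \<and> X \<subseteq> T y \<and> T y \<subseteq> ?A) sequentially"
      using T by (intro eventually_sequentiallyI[of "Max (insert 0 (degree ` X))"]) (auto simp: T_def)
  qed
  then have "(\<lambda>y. \<Prod>P\<in>T y. local_factor \<Phi> P) \<longlonglongrightarrow> p"
    using p unfolding has_unordered_prod_def by (rule filterlim_compose[rotated])
  then have limT: "(\<lambda>y. ?m * of_real (\<Prod>P\<in>T y. local_factor \<Phi> P)) \<longlonglongrightarrow> ?m * of_real p"
    by (intro tendsto_intros)
  define G where "G y f = Psi f * cnj (Psi (f + 1)) * (\<Prod>P\<in>T y. \<Phi> (P ^ pval P f) * cnj (\<Phi> (P ^ pval P (f + 1))))" for y f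
  have limG: "(\<lambda>n. avg n (G y)) \<longlonglongrightarrow> ?m * of_real (\<Prod>P\<in>T y. local_factor \<Phi> P)" for y
  proof -
    have "norm (Psi f * cnj (Psi (f + 1))) \<le> 1" for f
      using norm_Psi_le by (intro norm_mult_le_1) auto
    then have "equid (QP \<union> T y) (G y) (?m * of_real (\<Prod>P\<in>T y. local_factor \<Phi> P))"
      unfolding G_def using T by (intro equid_union equid_Psi QP_irreds Phi1 boundP) auto
    \<comment> \<open>The full average is the case \<open>D = 1\<close> of
      \<open>equid\<close>.\<close>
    moreover have "\<not> P dvd 1" if "P \<in> QP \<union> T y" for P
      using that T(2)[of y] QP_irreds monic_irreds_not_unit[of P] by blast
    ultimately have "(\<lambda>n. avg n (\<lambda>f. G y f * of_bool (1 dvd f - 0))) \<longlonglongrightarrow> ?m * of_real (\<Prod>P\<in>T y. local_factor \<Phi> P) / of_real (pnorm (1 :: 'a poly))"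
      unfolding equid_def by (elim ballE[of _ _ 1] impE allE[of _ 0]) simp_all
    then show ?thesis
      by simp
  qed
  have approx: "norm (avg n (\<lambda>f. \<psi> f * cnj (\<psi> (f + 1))) - avg n (G y)) \<le>
      6 * (\<Sum>P | P \<in> monic_irreds \<and> y < degree P \<and> degree P \<le> n. ?t P) +
      4 * (\<Sum>P | P \<in> monic_irreds \<and> y < degree P \<and> degree P \<le> n. ?s P) +
      4 * sqrt (2 * (\<Sum>P | P \<in> monic_irreds \<and> y < degree P \<and> degree P \<le> n. ?t P))"
    if n: "n \<ge> 1" and y: "y \<ge> degree Q" for n y
  proof -
    let ?R = "\<lambda>f. \<Phi> (f div ppart (QP \<union> T y) f)"
    have "norm (avg n (\<lambda>f. \<psi> f * cnj (\<psi> (f + 1)) - G y f)) \<le> avg n (\<lambda>f. norm (?R f * cnj (?R (f + 1)) - 1))"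
    proof (rule norm_avg_le')
      fix f :: "'a poly" assume f: "f \<in> monics_deg n"
      note fm = monics_degD(1)[OF f] monics_degD(1)[OF monics_deg_add_1[OF f n]]
      have 1: "\<psi> f = Psi f * (\<Prod>P\<in>T y. \<Phi> (P ^ pval P f)) * ?R f"
        using psi_decompose[OF fm(1) T[of y]] by (simp only: \<Phi>_def)
      have 2: "\<psi> (f + 1) = Psi (f + 1) * (\<Prod>P\<in>T y. \<Phi> (P ^ pval P (f + 1))) * ?R (f + 1)"
        using psi_decompose[OF fm(2) T[of y]] by (simp only: \<Phi>_def)
      have "\<psi> f * cnj (\<psi> (f + 1)) = G y f * (?R f * cnj (?R (f + 1)))"
        unfolding 1 2 G_def prod.distrib cnj_prod complex_cnj_mult by (simp only: mult_ac)
      then have "\<psi> f * cnj (\<psi> (f + 1)) - G y f = G y f * (?R f * cnj (?R (f + 1)) - 1)"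
        by (simp only: right_diff_distrib mult_1_right)
      moreover have "norm (G y f) \<le> 1"
      proof -
        have "norm (\<Prod>P\<in>T y. \<Phi> (P ^ pval P f) * cnj (\<Phi> (P ^ pval P (f + 1)))) \<le> (\<Prod>P\<in>T y. 1)"
          unfolding prod_norm[symmetric] using T(2)[of y] boundP
          by (intro prod_mono) (auto intro!: norm_mult_le_1)
        then show ?thesis
          unfolding G_def using norm_Psi_le by (intro norm_mult_le_1) auto
      qed
      ultimately show "norm (\<psi> f * cnj (\<psi> (f + 1)) - G y f) \<le> norm (?R f * cnj (?R (f + 1)) - 1)"
        by (simp add: norm_mult mult_left_le_one_le)
    qed
    also have "\<dots> \<le> 6 * (\<Sum>P | P \<in> monic_irreds \<and> y < degree P \<and> degree P \<le> n. ?t P) +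
      4 * (\<Sum>P | P \<in> monic_irreds \<and> y < degree P \<and> degree P \<le> n. ?s P) +
      4 * sqrt (2 * (\<Sum>P | P \<in> monic_irreds \<and> y < degree P \<and> degree P \<le> n. ?t P))"
      unfolding S[OF y] by (rule rough_part_correlation[OF mult bound n])
    finally show ?thesis
      by (simp only: avg_diff)
  qed
  have "(\<lambda>n. avg n (\<lambda>f. \<psi> f * cnj (\<psi> (f + 1)))) \<longlonglongrightarrow> ?m * of_real p"
  proof (rule LIMSEQ_I)
    fix e :: real assume e: "e > 0"
    \<comment> \<open>With \<open>\<eta> \<le> 1\<close> the three error terms are at most 6, 4 and
      8 times \<open>\<eta>\<close>, in total less than \<open>20 * \<eta>\<close> and hence less
      than \<open>e / 3\<close>.\<close>
    define \<eta> where "\<eta> = min 1 (e / 60)"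
    have \<eta>: "0 < \<eta>" "\<eta> \<le> 1" "60 * \<eta> \<le> e"
      using e by (auto simp: \<eta>_def min_def)
    obtain y1 where y1: "\<forall>y\<ge>y1. \<forall>n. (\<Sum>P | P \<in> monic_irreds \<and> y < degree P \<and> degree P \<le> n. ?t P) < \<eta>\<^sup>2"
      using degree_tail[OF summ zero_less_power[OF \<eta>(1), of 2]] by (elim exE)
    obtain y2 where y2: "\<forall>y\<ge>y2. \<forall>n. (\<Sum>P | P \<in> (monic_irreds :: 'a poly set) \<and> y < degree P \<and> degree P \<le> n. ?s P) < \<eta>\<^sup>2"
      using degree_tail[OF summable_on_inverse_pnorm_square zero_less_power[OF \<eta>(1), of 2]] by (elim exE)
    obtain y3 where y3: "\<And>y. y \<ge> y3 \<Longrightarrow> norm (?m * of_real (\<Prod>P\<in>T y. local_factor \<Phi> P) - ?m * of_real p) < e / 3"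
      using LIMSEQ_D[OF limT, of "e / 3"] e by auto
    define y where "y = Max {degree Q, y1, y2, y3}"
    have y: "y \<ge> degree Q" "y \<ge> y1" "y \<ge> y2" "y \<ge> y3"
      by (simp_all add: y_def)
    obtain N where N: "\<And>n. n \<ge> N \<Longrightarrow> norm (avg n (G y) - ?m * of_real (\<Prod>P\<in>T y. local_factor \<Phi> P)) < e / 3"
      using LIMSEQ_D[OF limG[of y], of "e / 3"] e by auto
    show "\<exists>N. \<forall>n\<ge>N. norm (avg n (\<lambda>f. \<psi> f * cnj (\<psi> (f + 1))) - ?m * of_real p) < e"
    proof (intro exI[of _ "max 1 N"] allI impI)
      fix n assume n: "max 1 N \<le> n"
      define t where "t = (\<Sum>P | P \<in> monic_irreds \<and> y < degree P \<and> degree P \<le> n. ?t P)"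
      define k where "k = (\<Sum>P | P \<in> (monic_irreds :: 'a poly set) \<and> y < degree P \<and> degree P \<le> n. ?s P)"
      have \<tau>: "t < \<eta>\<^sup>2" "k < \<eta>\<^sup>2"
        unfolding t_def k_def using y1 y2 y by auto
      have "(2 * \<eta>)\<^sup>2 = 4 * \<eta>\<^sup>2"
        by (simp add: power_mult_distrib)
      then have "2 * t \<le> (2 * \<eta>)\<^sup>2"
        using \<tau>(1) zero_le_power2[of \<eta>] by linarith
      then have "sqrt (2 * t) \<le> sqrt ((2 * \<eta>)\<^sup>2)"
        by (rule real_sqrt_le_mono)
      also have "\<dots> = 2 * \<eta>"
        using \<eta> by (intro real_sqrt_unique) auto
      finally have "sqrt (2 * t) \<le> 2 * \<eta>" .
      moreover have "\<eta>\<^sup>2 \<le> \<eta>"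
        using \<eta> by (simp add: power2_eq_square mult_left_le)
      ultimately have "6 * t + 4 * k + 4 * sqrt (2 * t) < e / 3"
        using \<tau> \<eta> by linarith
      then have "norm (avg n (\<lambda>f. \<psi> f * cnj (\<psi> (f + 1))) - avg n (G y)) < e / 3"
        using approx[of n y] n y(1) unfolding t_def[symmetric] k_def[symmetric] by simp
      moreover have "norm (avg n (G y) - ?m * of_real (\<Prod>P\<in>T y. local_factor \<Phi> P)) < e / 3"
        using N n by simp
      moreover have "norm (?m * of_real (\<Prod>P\<in>T y. local_factor \<Phi> P) - ?m * of_real p) < e / 3"
        using y3 y by simp
      ultimately have "norm (avg n (\<lambda>f. \<psi> f * cnj (\<psi> (f + 1))) - avg n (G y)) +
          norm (avg n (G y) - ?m * of_real (\<Prod>P\<in>T y. local_factor \<Phi> P)) +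
          norm (?m * of_real (\<Prod>P\<in>T y. local_factor \<Phi> P) - ?m * of_real p) < e"
        by linarith
      moreover have "norm (a - d) \<le> norm (a - b) + norm (b - c) + norm (c - d)" for a b c d :: complex
        using norm_triangle_ineq[of "a - b" "b - c"] norm_triangle_ineq[of "a - c" "c - d"] by simp
      ultimately show "norm (avg n (\<lambda>f. \<psi> f * cnj (\<psi> (f + 1))) - ?m * of_real p) < e"
        by (rule le_less_trans[rotated])
    qed
  qed
  then show ?thesis
    using p by (intro exI[of _ p]) simp
qed

end

section \<open>Removal of the short interval character and of \<open>e_twist\<close>\<close>

lemma short_interval_character_add_1:
  assumes "short_interval_character l \<xi>" "f \<in> monics_deg n" "n > l"
  shows "\<xi> (f + 1) = \<xi> f"
proof -
  have f: "f \<in> monics" "degree f = n" "f + 1 \<in> monics" "degree (f + 1) = n"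
    using monics_degD[OF assms(2)] monics_degD[OF monics_deg_add_1[OF assms(2)]] assms(3) by auto
  \<comment> \<open>Adding 1 changes only the constant coefficient, which has index \<open>n\<close>
    from the top and so lies beyond \<open>l\<close>.\<close>
  have "top_coeff (f + 1) i = top_coeff f i" if "i \<le> l" for i
    using that assms(3) f by (simp add: top_coeff_def)
  then show ?thesis
    using assms(1) f unfolding short_interval_character_def by blast
qed

theorem corollary1p6:
  fixes \<psi> chi \<xi> :: "'a::{field,finite} poly \<Rightarrow> complex"
    and Q :: "'a poly" and l :: nat and \<theta> :: real
  assumes "odd CARD('a)"
    and "\<forall>f\<in>monics. norm (\<psi> f) \<le> 1"
    and "multiplicative \<psi>"
    and "Q \<in> monics"
    and "primitive_character Q chi"
    and "short_interval_character l \<xi>"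
    and "\<theta> \<in> {0..1}"
    and "pretentious_dist \<psi> (\<lambda>f. chi f * \<xi> f * e_twist \<theta> f) < \<infinity>"
  shows "\<exists>p. has_unordered_prod
              (local_factor (\<lambda>f. \<psi> f * cnj (chi f) * cnj (\<xi> f) * e_twist (- \<theta>) f))
              {P \<in> monic_irreds. \<not> P dvd Q} p \<and>
            (\<lambda>n. (\<Sum>f\<in>(monics_deg n :: 'a poly set). \<psi> f * cnj (\<psi> (f + 1)))
                    / of_nat (card (monics_deg n :: 'a poly set)))
              \<longlonglongrightarrow> complex_of_real (pmoebius Q / pnorm Q * p)"
proof -
  \<comment> \<open>Both twisting factors have modulus 1 on monics, so \<open>\<psi>'\<close> stays
    multiplicative and bounded, and its distance to \<open>chi\<close> is the original
    distance.\<close>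
  define \<psi>' where "\<psi>' = (\<lambda>f. \<psi> f * cnj (\<xi> f) * e_twist (- \<theta>) f)"
  have "completely_multiplicative \<xi>" "\<forall>f\<in>monics. norm (\<xi> f) = 1"
    using assms(6) unfolding short_interval_character_def by blast+
  then have \<xi>: "\<xi> 1 = 1" "\<And>f g. f \<in> monics \<Longrightarrow> g \<in> monics \<Longrightarrow> \<xi> (f * g) = \<xi> f * \<xi> g"
    "\<And>f. f \<in> monics \<Longrightarrow> norm (\<xi> f) = 1"
    by (auto simp: completely_multiplicative_def)
  have e: "e_twist (- \<theta>) f = cnj (e_twist \<theta> f)" "norm (e_twist (- \<theta>) f) = 1" for f :: "'a poly"
    by (simp_all add: e_twist_def cis_cnj)
  have e_mult: "e_twist (- \<theta>) (f * g) = e_twist (- \<theta>) f * e_twist (- \<theta>) g"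
    if "f \<in> monics" "g \<in> monics" for f g :: "'a poly"
    using monics_nonzero[OF that(1)] monics_nonzero[OF that(2)]
    by (simp add: e_twist_def degree_mult_eq cis_mult distrib_left)
  interpret multiplicative_with_char Q chi \<psi>'
  proof
    show "multiplicative \<psi>'"
      using assms(3) \<xi> e_mult by (simp add: multiplicative_def \<psi>'_def) (simp add: e_twist_def)
    show "norm (\<psi>' f) \<le> 1" if "f \<in> monics" for f
      using assms(2) that \<xi>(3)[OF that] e by (simp add: \<psi>'_def norm_mult)
  qed (use assms in auto)
  have eq1: "(\<lambda>f. \<psi>' f * cnj (chi f)) = (\<lambda>f. \<psi> f * cnj (chi f) * cnj (\<xi> f) * e_twist (- \<theta>) f)"
    by (simp add: \<psi>'_def mult_ac fun_eq_iff)
  have eq2: "(1 - Re (\<psi>' P * cnj (chi P))) / pnorm P = (1 - Re (\<psi> P * cnj (chi P * \<xi> P * e_twist \<theta> P))) / pnorm P" for P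
    by (simp add: \<psi>'_def e mult_ac)
  \<comment> \<open>A finite distance rules out the value \<open>\<infinity>\<close> assigned to
    non-summable families.\<close>
  have "(\<lambda>P. (1 - Re (\<psi>' P * cnj (chi P))) / pnorm P) summable_on monic_irreds"
    using assms(8) unfolding eq2 pretentious_dist_def Let_def by (auto split: if_splits)
  then obtain p where p: "has_unordered_prod (local_factor (\<lambda>f. \<psi>' f * cnj (chi f))) {P \<in> monic_irreds. \<not> P dvd Q} p"
    "(\<lambda>n. avg n (\<lambda>f. \<psi>' f * cnj (\<psi>' (f + 1)))) \<longlonglongrightarrow> complex_of_real (pmoebius Q / pnorm Q * p)"
    using correlation_limit by blast
  \<comment> \<open>The invariance of \<open>\<xi>\<close> under adding 1 is available in degrees
    above \<open>l\<close>; the finitely many other degrees do not affect the limit.\<close>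
  have "avg n (\<lambda>f. \<psi>' f * cnj (\<psi>' (f + 1))) =
      (\<Sum>f\<in>(monics_deg n :: 'a poly set). \<psi> f * cnj (\<psi> (f + 1))) / of_nat (card (monics_deg n :: 'a poly set))"
    if n: "n \<ge> Suc l" for n
  proof -
    have "avg n (\<lambda>f. \<psi>' f * cnj (\<psi>' (f + 1))) = avg n (\<lambda>f. \<psi> f * cnj (\<psi> (f + 1)))"
    proof (rule avg_cong)
      fix f :: "'a poly" assume f: "f \<in> monics_deg n"
      have 1: "\<xi> (f + 1) = \<xi> f"
        using n by (intro short_interval_character_add_1[OF assms(6) f]) simp
      have "degree (f + 1) = degree f"
        using monics_degD[OF f] monics_degD[OF monics_deg_add_1[OF f]] n by simp
      then have 2: "e_twist (- \<theta>) (f + 1) = e_twist (- \<theta>) f"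
        by (simp add: e_twist_def)
      have "cnj (\<xi> f) * \<xi> f = 1" "e_twist (- \<theta>) f * cnj (e_twist (- \<theta>) f) = 1"
        using complex_norm_square[of "\<xi> f"] complex_norm_square[of "e_twist (- \<theta>) f"] e(2)[of f]
          \<xi>(3)[OF monics_degD(1)[OF f]] by (simp_all add: mult.commute)
      moreover have "\<psi>' f * cnj (\<psi>' (f + 1)) =
          \<psi> f * cnj (\<psi> (f + 1)) * (cnj (\<xi> f) * \<xi> f) * (e_twist (- \<theta>) f * cnj (e_twist (- \<theta>) f))"
        unfolding \<psi>'_def 1 2 by (simp add: mult_ac)
      ultimately show "\<psi>' f * cnj (\<psi>' (f + 1)) = \<psi> f * cnj (\<psi> (f + 1))"
        by simp
    qed
    then show ?thesis
      by (simp add: avg_def card_monics_deg)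
  qed
  then have "eventually (\<lambda>n. avg n (\<lambda>f. \<psi>' f * cnj (\<psi>' (f + 1))) =
      (\<Sum>f\<in>(monics_deg n :: 'a poly set). \<psi> f * cnj (\<psi> (f + 1))) / of_nat (card (monics_deg n :: 'a poly set))) sequentially"
    by (rule eventually_sequentiallyI)
  then have "(\<lambda>n. (\<Sum>f\<in>(monics_deg n :: 'a poly set). \<psi> f * cnj (\<psi> (f + 1)))
      / of_nat (card (monics_deg n :: 'a poly set))) \<longlonglongrightarrow> complex_of_real (pmoebius Q / pnorm Q * p)"
    by (rule Lim_transform_eventually[OF p(2)])
  then show ?thesis
    using p(1) unfolding eq1 by blast
qed

end
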